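(* Let $\sigma\in(0,1)$, $\beta>0$, $c>0$, $r>0$, let $\Theta\sim\mathrm{SBSP}(\beta,\sigma,c)$, and let $Z_1,Z_2,\dots\mid\Theta$ be i.i.d. $\mathrm{NBP}(\Theta,r)$. Let $D_0,D_1\ge1$ be integers, and let $0<N_{D_0}<\infty$ be the number of distinct units observed in $Z_{1:D_0}=(Z_1,\dots,Z_{D_0})$, indexed $n=1,\dots,N_{D_0}$, with total counts $m_{D_0,n}=\sum_{d=1}^{D_0}A_{d,n}$. Define $$T_{D_0}^{(D_1)}=\sum_{n\ge1}\ \sum_{d=D_0+1}^{D_0+D_1}A_{d,n},\qquad S_{D_0}^{(D_1)}=\sum_{d=1}^{D_1}\sum_{n=1}^{N_{D_0}}A_{D_0+d,n},$$ $$U_{D_0}^{(D_1,j)}=\sum_{n\ge1}\mathbf 1\left(\sum_{d=1}^{D_0}A_{d,n}=0\right)\mathbf 1\left(\sum_{d=1}^{D_1}A_{D_0+d,n}=j\right),\qquad j\ge1.$$ Then, conditionally on $Z_{1:D_0}$, $$T_{D_0}^{(D_1)}\mid Z_{1:D_0}\ \overset{d}{=}\ \sum_{j\ge1}j\,U_{D_0}^{(D_1,j)}+S_{D_0}^{(D_1)},$$ where, for each $j\ge1$, $$U_{D_0}^{(D_1,j)}\mid Z_{1:D_0}\sim\mathrm{NegBin}\left(N_{D_0}+c+1,\ \frac{\rho_{D_0}^{(D_1,j)}}{\beta+\psi_0^{(D_0)}+\rho_{D_0}^{(D_1,j)}}\right),\qquad \rho_{D_0}^{(D_1,j)}=\binom{j+rD_1-1}{j}\,\sigma\,B\left(r(D_0+D_1)+1,\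 j-\sigma\right),$$ and $$S_{D_0}^{(D_1)}\mid Z_{1:D_0}\ \overset{d}{=}\ \sum_{n=1}^{N_{D_0}}X_n,\qquad X_n\mid J_n\sim\mathrm{NegBin}(rD_1,J_n),\qquad J_n\sim\mathrm{Beta}(m_{D_0,n}-\sigma,\ rD_0+1),$$ with the pairs $(J_n,X_n)$ independent across $n$.
   Context: Conventions. $\mathrm{NegBin}(a,p)$, for $a>0$ and $p\in(0,1)$, has mass function $x\mapsto\binom{x+a-1}{x}p^x(1-p)^a$ on $\{0,1,2,\dots\}$. $B(a,b)=\Gamma(a)\Gamma(b)/\Gamma(a+b)$, also for negative non-integer $b$. For $x,y\ge 0$, $\psi_x^{(y)}=\sigma\left[B(rx+1,-\sigma)-B(r(x+y)+1,-\sigma)\right]$. The prior $\mathrm{SBSP}(\beta,\sigma,c)$ (stable-beta scaled process). Let $\rho(s)=\sigma s^{-1-\sigma}\mathbf 1(s>0)$ and let $\Delta_0>\Delta_1>\cdots$ be the points, in decreasing order, of a Poisson point process on $\mathbb R_+$ with intensity $\rho(s)\,ds$. The density of $\Delta_0$ is $f_{\Delta_0}(s)=\sigma s^{-1-\sigma}e^{-s^{-\sigma}}\mathbf 1(s>0)$. Let $G_t$ be the conditional joint law of $(\Delta_n/\Delta_0)_{n\ge1}$ given $\Delta_0=t$. Let $h_{c,\beta}(s)=\frac{\beta^{c+1}}{\Gamma(c+1)}s^{-c\sigma}\exp\{-(\beta-1)s^{-\sigma}\}$. Let $\Delta_{0,h}$ have density $h_{c,\beta}(s)f_{\Delta_0}(s)$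 and, given $\Delta_{0,h}=t$, let $(\theta_n)_{n\ge1}\sim G_t$. Let $\omega_1,\omega_2,\dots$ be i.i.d. from the uniform distribution $P_0$ on $\Omega=[0,1]$, independent of $(\Delta_{0,h},(\theta_n))$. Then $\Theta=\sum_{n\ge1}\theta_n\delta_{\omega_n}\sim\mathrm{SBSP}(\beta,\sigma,c)$. The likelihood. Given $\Theta=\sum_n\theta_n\delta_{\omega_n}$, $Z_d\sim\mathrm{NBP}(\Theta,r)$ means $Z_d=\sum_{n\ge1}A_{d,n}\delta_{\omega_n}$ with $A_{d,n}\sim\mathrm{NegBin}(r,\theta_n)$ independently across $n$. A unit is observed in $Z_{1:D_0}$ if it has a positive count on at least one of the days $1,\dots,D_0$. Units are re-indexed so that the observed ones are $n=1,\dots,N_{D_0}$, with labels $W_n^\star\in\Omega$ and $A_{d,n}=Z_d(\{W_n^\star\})$ for every day $d$; sums over $n\ge1$ run over all units. *)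

theory Defs
  imports "HOL-Probability.Probability"
begin

text \<open>The library's \<^const>\<open>neg_binomial_pmf\<close> only has natural shape parameters. Outside the
  parameter range the value is a harmless point mass, which keeps the law measurable in \<open>p\<close>.\<close>

definition negbin_pmf :: "real \<Rightarrow> real \<Rightarrow> nat pmf" where
  "negbin_pmf a p =
     (if 0 < a \<and> 0 < p \<and> p < 1
      then embed_pmf (\<lambda>x. ((real x + a - 1) gchoose x) * p ^ x * (1 - p) powr a)
      else return_pmf 0)"

lemma pmf_negbin:
  assumes "0 < a" "0 < p" "p < 1"
  shows "pmf (negbin_pmf a p) x = ((real x + a - 1) gchoose x) * p ^ x * (1 - p) powr a"
proof -
  let ?f = "\<lambda>x::nat. ((real x + a - 1) gchoose x) * p ^ x * (1 - p) powr a"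
  have nn: "0 \<le> ?f x" for x
  proof -
    have "0 \<le> (real x + a - 1) gchoose x"
      unfolding gbinomial_prod_rev
    proof (intro divide_nonneg_nonneg prod_nonneg)
      fix i assume "i \<in> {0..<x}"
      then have "real i + 1 \<le> real x"
        by simp
      then show "0 \<le> real x + a - 1 - of_nat i"
        using assms(1) by simp
    qed simp
    then show ?thesis using assms by simp
  qed
  have "(\<lambda>n. ((-a) gchoose n) * (-p) ^ n) sums (1 + (-p)) powr (-a)"
    by (rule gen_binomial_real) (use assms in auto)
  moreover have "((-a) gchoose n) * (-p) ^ n = ((real n + a - 1) gchoose n) * p ^ n" for n
  proof -
    have *: "(-1) ^ n * (-p) ^ n = p ^ n"
      by (metis minus_mult_minus mult_1 power_mult_distrib)
    have "((-a) gchoose n) * (-p) ^ n = ((a + real n - 1) gchoose n) * ((-1) ^ n * (-p) ^ n)"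
      by (subst gbinomial_minus) (simp only: mult_ac)
    then show ?thesis
      by (simp add: add.commute[of a] diff_add_eq *)
  qed
  ultimately have "(\<lambda>n. ((real n + a - 1) gchoose n) * p ^ n) sums (1 - p) powr (-a)"
    by simp
  from sums_mult2[OF this, of "(1 - p) powr a"] have s: "?f sums 1"
    using assms by (simp add: powr_minus field_simps)
  have "(\<integral>\<^sup>+x. ennreal (?f x) \<partial>count_space UNIV) = (\<Sum>x. ennreal (?f x))"
    by (rule nn_integral_count_space_nat)
  also have "\<dots> = 1"
    using suminf_ennreal_eq[OF nn s] by (simp only: ennreal_1)
  finally show ?thesis
    using assms nn by (simp add: negbin_pmf_def pmf_embed_pmf)
qed

definition beta_law :: "real \<Rightarrow> real \<Rightarrow> real measure" where
  "beta_law a b = density lborel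
     (\<lambda>x. ennreal (indicator {0<..<1} x * x powr (a - 1) * (1 - x) powr (b - 1) / Beta a b))"

abbreviation real_seq :: "(nat \<Rightarrow> real) measure" where
  "real_seq \<equiv> \<Pi>\<^sub>M n\<in>UNIV. borel"

abbreviation count_array :: "(nat \<times> nat \<Rightarrow> nat) measure" where
  "count_array \<equiv> \<Pi>\<^sub>M i\<in>UNIV. count_space UNIV"

definition points_in :: "(nat \<Rightarrow> 'a \<Rightarrow> 'b) \<Rightarrow> 'b set \<Rightarrow> 'a \<Rightarrow> ennreal" where
  "points_in X B \<omega> = emeasure (count_space UNIV) {n. X n \<omega> \<in> B}"

definition poisson_points :: "'a measure \<Rightarrow> 'b measure \<Rightarrow> (nat \<Rightarrow> 'a \<Rightarrow> 'b) \<Rightarrow> bool" where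
  "poisson_points M \<mu> X \<longleftrightarrow>
     prob_space M \<and> (\<forall>n. X n \<in> measurable M \<mu>) \<and>
     (\<forall>B\<in>sets \<mu>. emeasure \<mu> B < \<infinity> \<longrightarrow>
        (\<forall>k::nat. measure M {\<omega>\<in>space M. points_in X B \<omega> = of_nat k} =
           exp (- measure \<mu> B) * measure \<mu> B ^ k / fact k)) \<and>
     (\<forall>(k::nat) B. (\<forall>i<k. B i \<in> sets \<mu>) \<and> disjoint_family_on B {..<k} \<longrightarrow>
        prob_space.indep_vars M (\<lambda>_. borel) (\<lambda>i. points_in X (B i)) {..<k})"

definition stable_intensity :: "real \<Rightarrow> real measure" where
  "stable_intensity \<sigma> = density lborel (\<lambda>s. ennreal (\<sigma> * s powr (-1 - \<sigma>) * indicator {0<..} s))"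

text \<open>\<open>L\<close> is the law of the decreasingly ordered points, on the space of real sequences.\<close>

definition ranked_stable_law :: "real \<Rightarrow> (nat \<Rightarrow> real) measure \<Rightarrow> bool" where
  "ranked_stable_law \<sigma> L \<longleftrightarrow>
     sets L = sets real_seq \<and>
     poisson_points L (stable_intensity \<sigma>) (\<lambda>n \<Delta>. \<Delta> n) \<and>
     (AE \<Delta> in L. \<forall>n. \<Delta> (Suc n) < \<Delta> n)"

text \<open>\<open>G\<close> is a version of the conditional law of the ratios
  \<open>(\<Delta> 1 / \<Delta> 0, \<Delta> 2 / \<Delta> 0, \<dots>)\<close> given \<open>\<Delta> 0\<close>; position \<open>n\<close> of a sequence holds the ratio
  of index \<open>n + 1\<close>.\<close>

definition jump_ratio_kernel :: "real \<Rightarrow> (real \<Rightarrow> (nat \<Rightarrow> real) measure) \<Rightarrow> bool" where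
  "jump_ratio_kernel \<sigma> G \<longleftrightarrow>
     G \<in> measurable borel (prob_algebra real_seq) \<and>
     (\<exists>L. ranked_stable_law \<sigma> L \<and>
        distr L (borel \<Otimes>\<^sub>M real_seq) (\<lambda>\<Delta>. (\<Delta> 0, \<lambda>n. \<Delta> (Suc n) / \<Delta> 0)) =
        distr L borel (\<lambda>\<Delta>. \<Delta> 0) \<bind>
          (\<lambda>t. distr (G t) (borel \<Otimes>\<^sub>M real_seq) (\<lambda>\<theta>. (t, \<theta>))))"

definition largest_jump_density :: "real \<Rightarrow> real \<Rightarrow> real" where
  "largest_jump_density \<sigma> s =
     \<sigma> * s powr (-1 - \<sigma>) * exp (- (s powr (-\<sigma>))) * indicator {0<..} s"

definition jump_tilt :: "real \<Rightarrow> real \<Rightarrow> real \<Rightarrow> real \<Rightarrow> real" where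
  "jump_tilt \<beta> \<sigma> c s =
     \<beta> powr (c + 1) / Gamma (c + 1) * s powr (- c * \<sigma>) * exp (- (\<beta> - 1) * s powr (-\<sigma>))"

definition tilted_largest_jump :: "real \<Rightarrow> real \<Rightarrow> real \<Rightarrow> real measure" where
  "tilted_largest_jump \<beta> \<sigma> c =
     density lborel (\<lambda>s. ennreal (jump_tilt \<beta> \<sigma> c s * largest_jump_density \<sigma> s))"

text \<open>\<open>P\<close> is the joint law of the weights \<open>\<theta>\<close> and labels \<open>w\<close> of the random measure
  \<open>\<Theta> = (\<Sum>n. \<theta> n * \<delta>(w n))\<close> with law \<open>SBSP(\<beta>, \<sigma>, c)\<close>.\<close>

definition SBSP_atoms :: "real \<Rightarrow> real \<Rightarrow> real \<Rightarrow> ((nat \<Rightarrow> real) \<times> (nat \<Rightarrow> real)) measure \<Rightarrow> bool" where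
  "SBSP_atoms \<beta> \<sigma> c P \<longleftrightarrow>
     (\<exists>G. jump_ratio_kernel \<sigma> G \<and>
        P = (tilted_largest_jump \<beta> \<sigma> c \<bind> G) \<Otimes>\<^sub>M
            (\<Pi>\<^sub>M n\<in>UNIV. uniform_measure lborel {0..1}))"

text \<open>\<open>A d n\<close> is the count of unit \<open>n\<close> on day \<open>d\<close>; days start at \<open>1\<close>, so day \<open>d\<close> sits in row
  \<open>d - 1\<close> of the array. Given weights and labels, all counts are independent.\<close>

definition NBP_counts ::
  "'a measure \<Rightarrow> real \<Rightarrow> (nat \<Rightarrow> 'a \<Rightarrow> real) \<Rightarrow> (nat \<Rightarrow> 'a \<Rightarrow> real) \<Rightarrow> (nat \<Rightarrow> nat \<Rightarrow> 'a \<Rightarrow> nat) \<Rightarrow> bool" where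
  "NBP_counts M r \<theta> w A \<longleftrightarrow>
     distr M ((real_seq \<Otimes>\<^sub>M real_seq) \<Otimes>\<^sub>M count_array)
       (\<lambda>\<omega>. ((\<lambda>n. \<theta> n \<omega>, \<lambda>n. w n \<omega>), \<lambda>(d, n). A (Suc d) n \<omega>)) =
     distr M (real_seq \<Otimes>\<^sub>M real_seq) (\<lambda>\<omega>. (\<lambda>n. \<theta> n \<omega>, \<lambda>n. w n \<omega>)) \<bind>
       (\<lambda>(x, y). distr (\<Pi>\<^sub>M (d, n)\<in>UNIV. measure_pmf (negbin_pmf r (x n)))
          ((real_seq \<Otimes>\<^sub>M real_seq) \<Otimes>\<^sub>M count_array) (\<lambda>a. ((x, y), a)))"

text \<open>The counting measure \<open>(\<Sum>n. A d n * \<delta>(w n))\<close> of day \<open>d\<close>, as a push-forward along the labels.\<close>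

definition day_measure ::
  "(nat \<Rightarrow> 'a \<Rightarrow> real) \<Rightarrow> (nat \<Rightarrow> nat \<Rightarrow> 'a \<Rightarrow> nat) \<Rightarrow> nat \<Rightarrow> 'a \<Rightarrow> real measure" where
  "day_measure w A d \<omega> = distr (point_measure UNIV (\<lambda>n. of_nat (A d n \<omega>))) borel (\<lambda>n. w n \<omega>)"

definition days_algebra :: "'a measure \<Rightarrow> (nat \<Rightarrow> 'a \<Rightarrow> real measure) \<Rightarrow> nat \<Rightarrow> 'a measure" where
  "days_algebra M Z D = sigma (space M)
     {(\<lambda>\<omega>. emeasure (Z d \<omega>) B) -` C \<inter> space M | d B C.
        d \<in> {1..D} \<and> B \<in> sets borel \<and> C \<in> sets borel}"

definition observed :: "(nat \<Rightarrow> nat \<Rightarrow> 'a \<Rightarrow> nat) \<Rightarrow> nat \<Rightarrow> 'a \<Rightarrow> nat set" where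
  "observed A D0 \<omega> = {n. \<exists>d\<in>{1..D0}. 0 < A d n \<omega>}"

definition unit_total :: "(nat \<Rightarrow> nat \<Rightarrow> 'a \<Rightarrow> nat) \<Rightarrow> nat \<Rightarrow> nat \<Rightarrow> 'a \<Rightarrow> nat" where
  "unit_total A D0 n \<omega> = (\<Sum>d=1..D0. A d n \<omega>)"

definition T_count :: "(nat \<Rightarrow> nat \<Rightarrow> 'a \<Rightarrow> nat) \<Rightarrow> nat \<Rightarrow> nat \<Rightarrow> 'a \<Rightarrow> ennreal" where
  "T_count A D0 D1 \<omega> = (\<Sum>n. \<Sum>d=D0+1..D0+D1. of_nat (A d n \<omega>))"

definition S_count :: "(nat \<Rightarrow> nat \<Rightarrow> 'a \<Rightarrow> nat) \<Rightarrow> nat \<Rightarrow> nat \<Rightarrow> 'a \<Rightarrow> ennreal" where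
  "S_count A D0 D1 \<omega> = (\<Sum>d=1..D1. \<Sum>n\<in>observed A D0 \<omega>. of_nat (A (D0 + d) n \<omega>))"

definition U_count :: "(nat \<Rightarrow> nat \<Rightarrow> 'a \<Rightarrow> nat) \<Rightarrow> nat \<Rightarrow> nat \<Rightarrow> nat \<Rightarrow> 'a \<Rightarrow> ennreal" where
  "U_count A D0 D1 j \<omega> =
     (\<Sum>n. of_bool ((\<Sum>d=1..D0. A d n \<omega>) = 0) * of_bool ((\<Sum>d=1..D1. A (D0 + d) n \<omega>) = j))"

definition psi :: "real \<Rightarrow> real \<Rightarrow> real \<Rightarrow> real \<Rightarrow> real" where
  "psi \<sigma> r x y = \<sigma> * (Beta (r * x + 1) (-\<sigma>) - Beta (r * (x + y) + 1) (-\<sigma>))"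

definition rho :: "real \<Rightarrow> real \<Rightarrow> nat \<Rightarrow> nat \<Rightarrow> nat \<Rightarrow> real" where
  "rho \<sigma> r D0 D1 j =
     ((real j + r * real D1 - 1) gchoose j) * \<sigma> * Beta (r * (real D0 + real D1) + 1) (real j - \<sigma>)"

text \<open>The law of a pair \<open>(J, X)\<close> with \<open>J\<close> beta distributed and, given \<open>J\<close>, \<open>X\<close> negative binomial.\<close>

definition beta_negbin_law :: "real \<Rightarrow> real \<Rightarrow> real \<Rightarrow> (real \<times> nat) measure" where
  "beta_negbin_law a b s = beta_law a b \<bind>
     (\<lambda>J. distr (measure_pmf (negbin_pmf s J)) (borel \<Otimes>\<^sub>M count_space UNIV) (\<lambda>x. (J, x)))"

definition cond_prob :: "'a measure \<Rightarrow> 'a measure \<Rightarrow> ('a \<Rightarrow> 'b) \<Rightarrow> 'b set \<Rightarrow> 'a \<Rightarrow> real" where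
  "cond_prob M F X B = real_cond_exp M F (indicator (X -` B \<inter> space M))"

text \<open>On the event \<open>E\<close>, the conditional law of \<open>X\<close> (with values in \<open>N\<close>) given \<open>F\<close> is \<open>K\<close>,
  respectively agrees with that of \<open>Y\<close>.\<close>

definition has_cond_law ::
  "'a measure \<Rightarrow> 'a measure \<Rightarrow> 'a set \<Rightarrow> 'b measure \<Rightarrow> ('a \<Rightarrow> 'b) \<Rightarrow> ('a \<Rightarrow> 'b measure) \<Rightarrow> bool" where
  "has_cond_law M F E N X K \<longleftrightarrow>
     subalgebra M F \<and> X \<in> measurable M N \<and>
     (\<forall>B\<in>sets N. AE \<omega> in M. \<omega> \<in> E \<longrightarrow> cond_prob M F X B \<omega> = measure (K \<omega>) B)"

definition same_cond_law ::
  "'a measure \<Rightarrow> 'a measure \<Rightarrow> 'a set \<Rightarrow> 'b measure \<Rightarrow> ('a \<Rightarrow> 'b) \<Rightarrow> ('a \<Rightarrow> 'b) \<Rightarrow> bool" where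
  "same_cond_law M F E N X Y \<longleftrightarrow>
     subalgebra M F \<and> X \<in> measurable M N \<and> Y \<in> measurable M N \<and>
     (\<forall>B\<in>sets N. AE \<omega> in M. \<omega> \<in> E \<longrightarrow> cond_prob M F X B \<omega> = cond_prob M F Y B \<omega>)"

end

theory Submission
  imports Defs
begin

text \<open>Give unit \<open>n\<close> the mark consisting of its label and its column of daily counts. The key formula is
  \<open>E exp (- (\<Sum>n. F (mark n))) = (\<beta> / (\<beta> + \<integral>(1 - exp (- F)) d\<Pi>)) powr (c + 1)\<close>
  for every nonnegative function \<open>F\<close> of the mark, where \<open>\<Pi>\<close> is the intensity of the marks. Indeed
  \<open>\<Delta> n powr (-\<sigma>)\<close> are the points of a Poisson process of unit rate, whose increments after the first
  point are an independent copy of the process; hence the ratios \<open>\<Delta> n / \<Delta> 0\<close> are, given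
  \<open>y = \<Delta> 0 powr (-\<sigma>)\<close>, Poisson with an intensity proportional to \<open>y\<close>, and the tilting makes \<open>y\<close>
  gamma distributed.

  The functionals \<open>exp (- Z d B)\<close> of the observed days generate their algebra and are of this form. So
  is \<open>s ^ U\<close>, for the number \<open>U\<close> of new units with \<open>j\<close> counts, as well as the generating function
  of the claimed negative binomial law, which is \<open>q powr (N + c + 1)\<close>; and likewise for \<open>S\<close>. Thus each claim
  reduces to an equality of two integrals against \<open>\<Pi>\<close>. For \<open>U\<close> the two integrals are computed; for
  \<open>S\<close> the equality is the conjugacy of the beta and the negative binomial distributions.\<close>

subsection \<open>Laplace transforms and multiplicative classes\<close>

text \<open>No posterior law of the random measure is computed. A conditional law is verified by
  testing the joint law of the observed days and the statistic against products of exponentials, so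
  everything rests on one formula for a gamma mixed Poisson process. Two obstacles shape the rest.
  First, \<open>\<Pi>\<close> has infinite mass, because the stable density is not integrable at
  \<open>0\<close>. The formula is therefore applied only to \<open>F\<close> that vanish on marks
  without counts in the days concerned; \<open>\<sigma> < 1\<close> then makes the integral of
  \<open>1 - exp (- F)\<close> finite. Second, the days are given as measures on labels, while the
  candidate laws are indexed by units. They depend on the units only through the multiset of
  positive totals, which can be recovered from the days, since labels are almost surely distinct and
  almost surely finitely many units are observed. The shape \<open>N + c + 1\<close> has two
  sources: \<open>c + 1\<close> is the exponent of the gamma mixing, and each of the
  \<open>N\<close> seen units contributes one further factor \<open>q\<close>.\<close>

definition exp_neg :: "ennreal \<Rightarrow> real" where
  "exp_neg x = (if x = \<top> then 0 else exp (- enn2real x))"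

lemma exp_neg_0[simp]: "exp_neg 0 = 1" by (simp add: exp_neg_def)
lemma exp_neg_top[simp]: "exp_neg \<top> = 0" by (simp add: exp_neg_def)
lemma exp_neg_nonneg[simp]: "0 \<le> exp_neg x" by (simp add: exp_neg_def)
lemma exp_neg_le_1[simp]: "exp_neg x \<le> 1" by (simp add: exp_neg_def)

lemma exp_neg_ennreal: "0 \<le> x \<Longrightarrow> exp_neg (ennreal x) = exp (- x)" by (simp add: exp_neg_def)

lemma exp_neg_add: "exp_neg (x + y) = exp_neg x * exp_neg y"
  by (auto simp: exp_neg_def enn2real_plus top.not_eq_extremum exp_add[symmetric] add_top)

lemma exp_neg_sum: "finite I \<Longrightarrow> exp_neg (\<Sum>i\<in>I. f i) = (\<Prod>i\<in>I. exp_neg (f i))"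
  by (induction I rule: finite_induct) (auto simp: exp_neg_add)

lemma exp_neg_antimono: "x \<le> y \<Longrightarrow> exp_neg y \<le> exp_neg x"
  by (auto simp: exp_neg_def enn2real_mono top.not_eq_extremum)

text \<open>\<open>enn2real\<close> sends \<open>\<top>\<close> to \<open>0\<close>, so that
  \<open>exp (- enn2real x)\<close> alone would jump to \<open>1\<close> there; the value
  \<open>0\<close> of \<open>exp_neg\<close> at \<open>\<top>\<close> makes it continuous on all
  extended values. Near \<open>\<top>\<close> the argument is by monotonicity.\<close>

lemma exp_neg_tendsto:
  assumes "(u \<longlongrightarrow> l) F" shows "((\<lambda>x. exp_neg (u x)) \<longlongrightarrow> exp_neg l) F"
proof (cases l)
  case (real r)
  have "eventually (\<lambda>x. u x < \<top>) F"
    using order_tendstoD(2)[OF assms, of \<top>] real by simp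
  then have e: "eventually (\<lambda>x. exp (- enn2real (u x)) = exp_neg (u x)) F"
    by eventually_elim (auto simp: exp_neg_def)
  have l: "((\<lambda>x. exp (- enn2real (u x))) \<longlongrightarrow> exp (- r)) F"
    using assms real by (auto intro!: tendsto_intros)
  have "((\<lambda>x. exp_neg (u x)) \<longlongrightarrow> exp (- r)) F"
    by (rule Lim_transform_eventually[OF l e])
  then show ?thesis using real by (simp add: exp_neg_ennreal)
next
  case top
  show ?thesis unfolding top exp_neg_top
  proof (rule order_tendstoI)
    fix a :: real assume "a < 0" then show "eventually (\<lambda>x. a < exp_neg (u x)) F"
      by (auto intro!: always_eventually intro: less_le_trans)
  next
    fix a :: real assume "0 < a"
    \<comment> \<open>Any \<open>K\<close> above \<open>- ln a\<close> gives
      \<open>exp (- K) < a\<close>; the absolute value also keeps \<open>K\<close> nonnegative, as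
      \<open>exp_neg_ennreal\<close> requires.\<close>
    define K where "K = \<bar>ln a\<bar> + 1"
    have "ennreal K < l" using top by simp
    from order_tendstoD(1)[OF assms this] have ev: "eventually (\<lambda>x. ennreal K < u x) F" .
    have lt: "exp (- K) < a"
    proof -
      have "exp (- K) < exp (ln a)" unfolding K_def by (subst exp_less_cancel_iff) linarith
      then show ?thesis using \<open>0 < a\<close> by simp
    qed
    show "eventually (\<lambda>x. exp_neg (u x) < a) F"
      using ev
    proof eventually_elim
      case (elim x)
      then have "exp_neg (u x) \<le> exp_neg (ennreal K)" by (intro exp_neg_antimono) simp
      also have "\<dots> = exp (- K)" by (rule exp_neg_ennreal) (simp add: K_def)
      finally show ?case using lt by simp
    qed
  qed
qed

lemma exp_neg_measurable[measurable]: "exp_neg \<in> borel_measurable borel"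
  unfolding exp_neg_def[abs_def] by measurable

lemma exp_neg_SUP:
  assumes "incseq u" shows "(\<lambda>i. exp_neg (u i)) \<longlonglongrightarrow> exp_neg (SUP i. u i)"
  by (intro exp_neg_tendsto LIMSEQ_SUP assms)

lemma exp_neg_suminf: "(\<lambda>N. \<Prod>n<N. exp_neg (f n)) \<longlonglongrightarrow> exp_neg (\<Sum>n. f n)"
proof -
  have "(\<lambda>N. exp_neg (\<Sum>n<N. f n)) \<longlonglongrightarrow> exp_neg (\<Sum>n. f n)"
    by (intro exp_neg_tendsto summable_LIMSEQ) simp
  then show ?thesis by (simp add: exp_neg_sum)
qed

text \<open>The inverse of \<open>exp_neg\<close>; it sends \<open>0\<close> back to \<open>\<top>\<close>.\<close>

definition neg_ln :: "real \<Rightarrow> ennreal" where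
  "neg_ln x = (if x \<le> 0 then \<top> else ennreal (- ln x))"

lemma neg_ln_measurable[measurable]: "neg_ln \<in> borel_measurable borel"
  unfolding neg_ln_def[abs_def] by measurable

lemma exp_neg_neg_ln: "0 \<le> x \<Longrightarrow> x \<le> 1 \<Longrightarrow> exp_neg (neg_ln x) = x"
  by (auto simp: neg_ln_def exp_neg_ennreal ln_le_zero_iff)

lemma neg_ln_exp_neg: "neg_ln (exp_neg x) = x"
  by (auto simp: neg_ln_def exp_neg_def top.not_eq_extremum)

text \<open>Weierstrass: the indicator of \<open>{x. a < f x}\<close> is a bounded limit of polynomials in \<open>f\<close>.\<close>

lemma power_family_indicator:
  fixes M1 M2 :: "'a measure" and f h :: "'a \<Rightarrow> real"
  assumes fin: "finite_measure M1" "finite_measure M2" and s: "sets M1 = sets M2"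
    and f[measurable]: "f \<in> borel_measurable M1" and h[measurable]: "h \<in> borel_measurable M1"
    and fb: "\<And>x. x \<in> space M1 \<Longrightarrow> 0 \<le> f x \<and> f x \<le> 1"
    and hb: "\<And>x. x \<in> space M1 \<Longrightarrow> 0 \<le> h x \<and> h x \<le> 1"
    and eq: "\<And>n::nat. (\<integral>x. f x ^ n * h x \<partial>M1) = (\<integral>x. f x ^ n * h x \<partial>M2)"
  shows "(\<integral>x. indicator {x. a < f x} x * h x \<partial>M1) = (\<integral>x. indicator {x. a < f x} x * h x \<partial>M2)"
proof -
  interpret m1: finite_measure M1 by fact
  interpret m2: finite_measure M2 by fact
  note [measurable_cong] = s[symmetric]
  have sp: "space M2 = space M1" using s sets_eq_imp_space_eq by metis
  \<comment> \<open>A ramp from \<open>0\<close> at \<open>a\<close> to \<open>1\<close> at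
    \<open>a + 1 / n\<close>. Pointwise it tends to the indicator of \<open>{a<..}\<close>, and the
    polynomial \<open>p n\<close> stays within \<open>1 / (n + 1)\<close> of it on the unit
    interval.\<close>
  define c where "c n x = min 1 (max 0 (real n * (x - a)))" for n :: nat and x :: real
  have "\<exists>p. real_polynomial_function p \<and> (\<forall>x\<in>{0..1}. \<bar>c n x - p x\<bar> < 1 / real (Suc n))" for n
  proof (rule Stone_Weierstrass_real_polynomial_function[of "{0..1::real}" "c n" "1 / real (Suc n)"])
    show "continuous_on {0..1} (c n)" unfolding c_def by (intro continuous_intros)
  qed auto
  then obtain p where p: "\<And>n. real_polynomial_function (p n)"
    and pc: "\<And>n x. 0 \<le> x \<Longrightarrow> x \<le> 1 \<Longrightarrow> \<bar>c n x - p n x\<bar> < 1 / real (Suc n)"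
    using that by (metis atLeastAtMost_iff)
  have pm[measurable]: "p n \<in> borel_measurable borel" for n
    using p[of n]
    by (intro borel_measurable_continuous_onI)
       (simp add: continuous_on_eq_continuous_at continuous_real_polymonial_function)
  have peq: "(\<integral>x. p n (f x) * h x \<partial>M1) = (\<integral>x. p n (f x) * h x \<partial>M2)" for n
  proof -
    obtain b k where bk: "p n = (\<lambda>x. \<Sum>i\<le>k. b i * x ^ i)"
      using p[of n] unfolding real_polynomial_function_iff_sum by (auto)
    have i1: "integrable M1 (\<lambda>x. f x ^ i * h x)" for i :: nat
      by (rule m1.integrable_const_bound[where B=1])
         (use fb hb in \<open>auto simp: abs_mult intro!: AE_I2 mult_le_one power_le_one\<close>)
    have i2: "integrable M2 (\<lambda>x. f x ^ i * h x)" for i :: nat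
      by (rule m2.integrable_const_bound[where B=1])
         (use fb hb in \<open>auto simp: abs_mult sp intro!: AE_I2 mult_le_one power_le_one\<close>)
    show ?thesis
      unfolding bk sum_distrib_right mult.assoc
      by (subst (1 2) Bochner_Integration.integral_sum) (auto intro!: i1 i2 simp: eq)
  qed
  have lim: "(\<lambda>n. p n y) \<longlonglongrightarrow> indicator {a<..} y" if y: "0 \<le> y" "y \<le> 1" for y
  proof -
    have "(\<lambda>n. c n y) \<longlonglongrightarrow> indicator {a<..} y"
    proof (cases "a < y")
      case True
      obtain m :: nat where m: "1 \<le> real m * (y - a)"
        using True by (metis ex_less_of_nat_mult diff_gt_0_iff_gt less_imp_le)
      have "eventually (\<lambda>n. c n y = 1) sequentially"
        using eventually_ge_at_top[of m]
      proof eventually_elim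
        case (elim n)
        then have "real m * (y - a) \<le> real n * (y - a)" using True by (intro mult_right_mono) auto
        then show ?case using m by (simp add: c_def)
      qed
      then show ?thesis using True by (simp add: tendsto_eventually)
    next
      case False
      then have "real n * (y - a) \<le> 0" for n by (intro mult_nonneg_nonpos) auto
      then have "c n y = 0" for n by (simp add: c_def max_absorb1)
      then show ?thesis using False by simp
    qed
    moreover have "(\<lambda>n. p n y - c n y) \<longlonglongrightarrow> 0"
    proof (rule Lim_null_comparison)
      show "eventually (\<lambda>n. norm (p n y - c n y) \<le> 1 / real (Suc n)) sequentially"
        using pc[OF y] by (intro always_eventually allI) (simp add: abs_minus_commute less_imp_le)
      show "(\<lambda>n. 1 / real (Suc n)) \<longlonglongrightarrow> 0" by (rule LIMSEQ_Suc) (rule lim_1_over_n)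
    qed
    ultimately show ?thesis using tendsto_add by fastforce
  qed
  have pb: "\<bar>p n y\<bar> \<le> 2" if y: "0 \<le> y" "y \<le> 1" for n y
  proof -
    have "\<bar>c n y\<bar> \<le> 1" by (auto simp: c_def)
    moreover have "1 / real (Suc n) \<le> 1" by simp
    ultimately show ?thesis using pc[OF y, of n] by linarith
  qed
  have dc: "(\<lambda>n. \<integral>x. p n (f x) * h x \<partial>M) \<longlonglongrightarrow> (\<integral>x. indicator {a<..} (f x) * h x \<partial>M)"
    if M: "finite_measure M" and sM: "sets M = sets M1" for M
  proof -
    interpret finite_measure M by fact
    note [measurable_cong] = sM
    have spM: "space M = space M1" using sM sets_eq_imp_space_eq by metis
    show ?thesis
    proof (rule integral_dominated_convergence[where w="\<lambda>_. 2"])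
      show "AE x in M. (\<lambda>i. p i (f x) * h x) \<longlonglongrightarrow> indicator {a<..} (f x) * h x"
        using lim fb by (intro AE_I2 tendsto_mult tendsto_const) (auto simp: spM)
      show "AE x in M. norm (p i (f x) * h x) \<le> 2" for i
      proof (intro AE_I2)
        fix x assume "x \<in> space M"
        then have "\<bar>p i (f x)\<bar> * \<bar>h x\<bar> \<le> 2 * 1"
          using pb fb hb by (intro mult_mono) (auto simp: spM)
        then show "norm (p i (f x) * h x) \<le> 2" by (simp add: abs_mult)
      qed
    qed auto
  qed
  have "(\<integral>x. indicator {a<..} (f x) * h x \<partial>M1) = (\<integral>x. indicator {a<..} (f x) * h x \<partial>M2)"
    using dc[OF fin(1) refl] dc[OF fin(2) s[symmetric]] unfolding peq by (rule LIMSEQ_unique)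
  moreover have "indicator {a<..} (f x) = (indicator {x. a < f x} x :: real)" for x
    by (simp add: indicator_def)
  ultimately show ?thesis by simp
qed

text \<open>A monotone class theorem for classes closed under products. Conditions
  \<open>a < f x\<close> are traded for indicators one at a time by
  \<open>power_family_indicator\<close>, whose spare factor carries the conditions already treated
  together with a member of \<open>C\<close>. The sets defined by finitely many such conditions form
  an intersection stable generator, and Dynkin's lemma does the rest.\<close>

lemma multiplicative_class_eq:
  fixes C :: "('a \<Rightarrow> real) set"
  assumes fin: "finite_measure M1" "finite_measure M2" and s: "sets M1 = sets M2"
    and meas: "\<And>f. f \<in> C \<Longrightarrow> f \<in> borel_measurable M1"
    and bnd: "\<And>f x. f \<in> C \<Longrightarrow> x \<in> space M1 \<Longrightarrow> 0 \<le> f x \<and> f x \<le> 1"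
    and one: "(\<lambda>_. 1) \<in> C"
    and mult: "\<And>f g. f \<in> C \<Longrightarrow> g \<in> C \<Longrightarrow> (\<lambda>x. f x * g x) \<in> C"
    and eq: "\<And>f. f \<in> C \<Longrightarrow> (\<integral>x. f x \<partial>M1) = (\<integral>x. f x \<partial>M2)"
    and A: "A \<in> sigma_sets (space M1) {f -` {a<..} \<inter> space M1 | f a. f \<in> C}"
  shows "emeasure M1 A = emeasure M2 A"
proof -
  interpret m1: finite_measure M1 by fact
  interpret m2: finite_measure M2 by fact
  note [measurable_cong] = s[symmetric]
  have sp: "space M2 = space M1" using s sets_eq_imp_space_eq by metis
  define S where "S xs = {x \<in> space M1. \<forall>(f, a)\<in>set xs. a < f x}" for xs :: "(('a \<Rightarrow> real) \<times> real) list"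
  define G where "G = {S xs | xs. fst ` set xs \<subseteq> C}"
  have Sm: "S xs \<in> sets M1" if "fst ` set xs \<subseteq> C" for xs
    using that
  proof (induction xs)
    case Nil then show ?case by (simp add: S_def)
  next
    case (Cons p xs)
    obtain f a where p: "p = (f, a)" by (cases p)
    have [measurable]: "f \<in> borel_measurable M1" using Cons.prems p meas by auto
    have [measurable]: "S xs \<in> sets M1" using Cons by auto
    have "S (p # xs) = {x \<in> space M1. a < f x} \<inter> S xs" by (auto simp: S_def p)
    then show ?case by simp
  qed
  have pw: "(\<lambda>x. f x ^ n * h x) \<in> C" if "f \<in> C" "h \<in> C" for f h and n :: nat
    by (induction n) (auto simp: that mult.assoc intro!: mult)
  \<comment> \<open>The weight \<open>h\<close> stays arbitrary in the induction: the powers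
    \<open>f x ^ n\<close> that Weierstrass needs are absorbed into it, by closure under
    products.\<close>
  have list: "(\<integral>x. indicator (S xs) x * h x \<partial>M1) = (\<integral>x. indicator (S xs) x * h x \<partial>M2)"
    if "fst ` set xs \<subseteq> C" "h \<in> C" for xs h
    using that
  proof (induction xs arbitrary: h)
    case Nil
    have "(\<integral>x. indicator (S []) x * h x \<partial>M1) = (\<integral>x. h x \<partial>M1)"
      "(\<integral>x. indicator (S []) x * h x \<partial>M2) = (\<integral>x. h x \<partial>M2)"
      by (auto intro!: Bochner_Integration.integral_cong simp: S_def sp)
    then show ?case using eq[OF Nil(2)] by simp
  next
    case (Cons fa xs)
    obtain f a where fa: "fa = (f, a)" by (cases fa)
    have fC: "f \<in> C" and xs: "fst ` set xs \<subseteq> C" using Cons.prems fa by auto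
    have [measurable]: "S xs \<in> sets M1" by (rule Sm[OF xs])
    have [measurable]: "f \<in> borel_measurable M1" "h \<in> borel_measurable M1"
      using fC Cons.prems meas by auto
    have "(\<integral>x. indicator {x. a < f x} x * (indicator (S xs) x * h x) \<partial>M1)
      = (\<integral>x. indicator {x. a < f x} x * (indicator (S xs) x * h x) \<partial>M2)"
    proof (rule power_family_indicator[OF fin s])
      fix n :: nat
      have "(\<integral>x. indicator (S xs) x * (f x ^ n * h x) \<partial>M1) = (\<integral>x. indicator (S xs) x * (f x ^ n * h x) \<partial>M2)"
        by (rule Cons.IH[OF xs pw[OF fC Cons.prems(2)]])
      then show "(\<integral>x. f x ^ n * (indicator (S xs) x * h x) \<partial>M1) = (\<integral>x. f x ^ n * (indicator (S xs) x * h x) \<partial>M2)"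
        by (simp add: mult_ac)
    qed (use bnd[OF fC] bnd[OF Cons.prems(2)] in \<open>auto simp: indicator_def\<close>)
    moreover have "indicator (S (fa # xs)) x * h x = indicator {x. a < f x} x * (indicator (S xs) x * h x)" for x
      by (auto simp: S_def fa indicator_def)
    ultimately show ?case by (simp only:)
  qed
  have Geq: "emeasure M1 X = emeasure M2 X" if "X \<in> G" for X
  proof -
    obtain xs where xs: "fst ` set xs \<subseteq> C" "X = S xs" using \<open>X \<in> G\<close> by (auto simp: G_def)
    have [measurable]: "S xs \<in> sets M1" by (rule Sm[OF xs(1)])
    have "measure M1 (S xs) = measure M2 (S xs)"
      using list[OF xs(1) one] sets.sets_into_space[OF \<open>S xs \<in> sets M1\<close>] sp
      by (simp add: Int_absorb1 Int_absorb2)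
    then show ?thesis using xs by (simp add: m1.emeasure_eq_measure m2.emeasure_eq_measure)
  qed
  have stable: "Int_stable G"
  proof (rule Int_stableI)
    fix a b assume "a \<in> G" "b \<in> G"
    then obtain xs ys where "fst ` set xs \<subseteq> C" "a = S xs" "fst ` set ys \<subseteq> C" "b = S ys"
      by (auto simp: G_def)
    then have "a \<inter> b = S (xs @ ys)" "fst ` set (xs @ ys) \<subseteq> C" by (auto simp: S_def)
    then show "a \<inter> b \<in> G" unfolding G_def by blast
  qed
  have Gp: "G \<subseteq> Pow (space M1)" by (auto simp: G_def S_def)
  have Gs: "sigma_sets (space M1) G \<subseteq> sets M1"
    using Sm by (intro sets.sigma_sets_subset) (auto simp: G_def)
  have "{f -` {a<..} \<inter> space M1 | f a. f \<in> C} \<subseteq> G"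
  proof safe
    fix f :: "'a \<Rightarrow> real" and a :: real assume "f \<in> C"
    then show "f -` {a<..} \<inter> space M1 \<in> G"
      unfolding G_def by (intro CollectI exI[of _ "[(f, a)]"]) (auto simp: S_def)
  qed
  then have "A \<in> sigma_sets (space M1) G" using A sigma_sets_mono' by blast
  then show ?thesis
  proof (induction rule: sigma_sets_induct_disjoint[OF stable Gp, consumes 1, case_names basic empty compl union])
    case (basic A) then show ?case by (rule Geq)
  next
    case empty then show ?case by simp
  next
    case (compl A)
    then have A: "A \<in> sets M1" using Gs by auto
    have "S [] \<in> G" unfolding G_def by auto
    then have *: "emeasure M1 (space M1) = emeasure M2 (space M2)"
      using Geq[of "S []"] by (simp add: S_def sp)
    have "emeasure M1 (space M1 - A) = emeasure M1 (space M1) - emeasure M1 A"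
      using A by (intro emeasure_compl) auto
    also have "\<dots> = emeasure M2 (space M2) - emeasure M2 A"
      using compl by (simp only: *)
    also have "\<dots> = emeasure M2 (space M2 - A)"
      using A m2.emeasure_finite by (subst emeasure_compl) (simp_all add: s[symmetric])
    finally show ?case by (simp only: sp)
  next
    case (union A)
    then have r: "range A \<subseteq> sets M1" using Gs by auto
    have "emeasure M1 (\<Union>(range A)) = (\<Sum>i. emeasure M1 (A i))"
      by (rule suminf_emeasure[symmetric]) (use r union(1) in auto)
    also have "\<dots> = (\<Sum>i. emeasure M2 (A i))" by (simp only: union(3))
    also have "\<dots> = emeasure M2 (\<Union>(range A))"
      by (rule suminf_emeasure) (use r union(1) s in auto)
    finally show ?case .
  qed
qed

subsection \<open>The Laplace functional of a Poisson process\<close>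

lemma points_in_suminf: "points_in X B \<omega> = (\<Sum>n. indicator B (X n \<omega>))"
proof -
  have "points_in X B \<omega> = (\<integral>\<^sup>+n. indicator {n. X n \<omega> \<in> B} n \<partial>count_space UNIV)"
    unfolding points_in_def by (rule nn_integral_indicator[symmetric]) simp
  also have "\<dots> = (\<Sum>n. indicator {n. X n \<omega> \<in> B} n)" by (rule nn_integral_count_space_nat)
  finally show ?thesis by (simp add: indicator_def)
qed

text \<open>Only the probabilities of natural values are given. Since they sum to \<open>1\<close>,
  the value \<open>\<top>\<close> is null, and the transform is the exponential series of the
  Poisson weights.\<close>

lemma exp_neg_poisson_variable:
  fixes N :: "'a \<Rightarrow> ennreal"
  assumes "prob_space M" and [measurable]: "N \<in> borel_measurable M"
    and P: "\<And>k::nat. measure M {\<omega>\<in>space M. N \<omega> = of_nat k} = exp (- m) * m ^ k / fact k"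
    and m: "0 \<le> m"
  shows "(\<integral>\<omega>. exp_neg (c * N \<omega>) \<partial>M) = exp (- (m * (1 - exp_neg c)))"
proof -
  interpret prob_space M by fact
  let ?A = "\<lambda>k::nat. {\<omega>\<in>space M. N \<omega> = of_nat k}"
  have dA: "disjoint_family ?A"
    by (auto simp: disjoint_family_on_def)
  have s: "(\<lambda>k. z * (x ^ k / fact k)) sums (z * exp x)" for x z :: real
    using exp_converges[of x] by (intro sums_mult) (simp add: divide_real_def mult.commute)
  have "(\<lambda>k. prob (?A k)) sums prob (\<Union>k. ?A k)"
    by (rule finite_measure_UNION[OF _ dA]) auto
  moreover have "(\<lambda>k. prob (?A k)) sums 1"
    using s[of "exp (- m)" m] by (simp add: P exp_minus)
  ultimately have "prob (\<Union>k. ?A k) = 1" by (rule sums_unique2)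
  then have AE: "AE \<omega> in M. \<omega> \<in> (\<Union>k. ?A k)"
    by (subst (asm) prob_eq_1) auto
  have ec: "exp_neg (c * of_nat k) = exp_neg c ^ k" for k
    by (induction k) (auto simp: distrib_left exp_neg_add)
  have "(\<integral>\<^sup>+\<omega>. ennreal (exp_neg (c * N \<omega>)) \<partial>M) = (\<integral>\<^sup>+\<omega>. (\<Sum>k. ennreal (exp_neg c ^ k) * indicator (?A k) \<omega>) \<partial>M)"
  proof (rule nn_integral_cong_AE)
    show "AE \<omega> in M. ennreal (exp_neg (c * N \<omega>)) = (\<Sum>k. ennreal (exp_neg c ^ k) * indicator (?A k) \<omega>)"
      using AE
    proof eventually_elim
      fix \<omega> assume "\<omega> \<in> (\<Union>k. ?A k)"
      then obtain k where k: "\<omega> \<in> ?A k" by auto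
      then have "(\<Sum>k. ennreal (exp_neg c ^ k) * indicator (?A k) \<omega>) = (\<Sum>j\<in>{k}. ennreal (exp_neg c ^ j) * indicator (?A j) \<omega>)"
        by (intro suminf_finite) (auto simp: indicator_def)
      also have "\<dots> = ennreal (exp_neg (c * N \<omega>))" using k by (simp add: ec)
      finally show "ennreal (exp_neg (c * N \<omega>)) = (\<Sum>k. ennreal (exp_neg c ^ k) * indicator (?A k) \<omega>)" ..
    qed
  qed
  also have "\<dots> = (\<Sum>k. ennreal (exp_neg c ^ k) * ennreal (prob (?A k)))"
    by (subst nn_integral_suminf) (auto simp: nn_integral_cmult_indicator emeasure_eq_measure)
  also have "\<dots> = (\<Sum>k. ennreal (exp (- m) * ((exp_neg c * m) ^ k / fact k)))"
    by (intro suminf_cong) (auto simp: P ennreal_mult'[symmetric] power_mult_distrib mult_ac)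
  also have "\<dots> = ennreal (exp (- m) * exp (exp_neg c * m))"
    using m by (intro suminf_ennreal_eq s) auto
  also have "exp (- m) * exp (exp_neg c * m) = exp (- (m * (1 - exp_neg c)))"
    by (simp add: exp_add[symmetric] algebra_simps)
  finally show ?thesis
    by (subst integral_eq_nn_integral) auto
qed

lemma poisson_points_in_measurable:
  assumes "poisson_points M \<mu> X" "B \<in> sets \<mu>"
  shows "points_in X B \<in> borel_measurable M"
proof -
  have [measurable]: "X n \<in> measurable M \<mu>" for n using assms(1) by (simp add: poisson_points_def)
  show ?thesis using assms(2) unfolding points_in_suminf[abs_def] by measurable
qed

text \<open>A step function turns the sum over points into a finite combination of the counts in its
  level sets; these sets are disjoint, so the counts are independent Poisson variables.\<close>

lemma poisson_laplace_simple:
  assumes PP: "poisson_points M \<mu> X"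
    and g: "simple_function \<mu> g" and gfin: "emeasure \<mu> {x\<in>space \<mu>. g x \<noteq> 0} < \<infinity>"
  shows "(\<integral>\<omega>. exp_neg (\<Sum>n. g (X n \<omega>)) \<partial>M) = exp_neg (\<integral>\<^sup>+x. ennreal (1 - exp_neg (g x)) \<partial>\<mu>)"
proof -
  interpret prob_space M using PP by (simp add: poisson_points_def)
  have [measurable]: "X n \<in> measurable M \<mu>" for n using PP by (simp add: poisson_points_def)
  have [measurable]: "g \<in> borel_measurable \<mu>" by (rule borel_measurable_simple_function[OF g])
  \<comment> \<open>The value \<open>0\<close> is left out: its level set may have infinite measure
    and contributes nothing.\<close>
  define V where "V = g ` space \<mu> - {0}"
  have "finite V" using g by (auto simp: V_def simple_function_def)
  then obtain v where v: "bij_betw v {..<card V} V"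
    using ex_bij_betw_nat_finite[of V] by (auto simp: atLeast0LessThan)
  define k where "k = card V"
  define B where "B i = {x\<in>space \<mu>. g x = v i}" for i
  have vi: "v i \<in> V" if "i < k" for i using v that by (auto simp: bij_betw_def k_def)
  have inj: "v i = v j \<Longrightarrow> i < k \<Longrightarrow> j < k \<Longrightarrow> i = j" for i j
    using v by (auto simp: bij_betw_def inj_on_def k_def)
  have Bm[measurable]: "B i \<in> sets \<mu>" for i unfolding B_def by measurable
  have disj: "disjoint_family_on B {..<k}"
    using inj by (auto simp: disjoint_family_on_def B_def)
  have Bfin: "emeasure \<mu> (B i) < \<infinity>" if "i < k" for i
    using vi[OF that] by (intro le_less_trans[OF emeasure_mono gfin]) (auto simp: B_def V_def)
  have ind: "indep_vars (\<lambda>_. borel) (\<lambda>i. points_in X (B i)) {..<k}"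
    using PP disj Bm by (auto simp: poisson_points_def)
  have P: "measure M {\<omega>\<in>space M. points_in X (B i) \<omega> = of_nat n} =
      exp (- measure \<mu> (B i)) * measure \<mu> (B i) ^ n / fact n" if "i < k" for i n
    using PP Bm Bfin[OF that] by (auto simp: poisson_points_def)
  \<comment> \<open>Stated for every \<open>h\<close> with \<open>h 0 = 0\<close>, because it is
    used twice: for \<open>g\<close> itself and for \<open>1 - exp_neg (g x)\<close>.\<close>
  have rep: "h (g x) = (\<Sum>i<k. h (v i) * indicator (B i) x)"
    if x: "x \<in> space \<mu>" and h0: "h 0 = (0::ennreal)" for x and h
  proof (cases "g x = 0")
    case True
    then have "indicator (B i) x = (0::ennreal)" if "i < k" for i
      using vi[OF that] by (auto simp: B_def V_def indicator_def)
    then show ?thesis using True h0 by simp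
  next
    case False
    then have "g x \<in> V" using x by (auto simp: V_def)
    then obtain j where j: "j < k" "g x = v j" using v by (auto simp: bij_betw_def k_def)
    have "(\<Sum>i<k. h (v i) * indicator (B i) x) = (\<Sum>i<k. if i = j then h (v i) else 0)"
      using j x inj by (intro sum.cong) (auto simp: B_def indicator_def)
    then show ?thesis using j by simp
  qed
  have sm: "(\<Sum>n. g (X n \<omega>)) = (\<Sum>i<k. v i * points_in X (B i) \<omega>)" if "\<omega> \<in> space M" for \<omega>
  proof -
    have "X n \<omega> \<in> space \<mu>" for n by (rule measurable_space[OF _ that]) measurable
    then have "(\<Sum>n. g (X n \<omega>)) = (\<Sum>n. \<Sum>i<k. v i * indicator (B i) (X n \<omega>))"
      using rep[of _ "\<lambda>x. x"] by simp
    also have "\<dots> = (\<Sum>i<k. \<Sum>n. v i * indicator (B i) (X n \<omega>))"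
      by (rule suminf_sum) simp
    finally show ?thesis by (simp add: points_in_suminf)
  qed
  have pm[measurable]: "points_in X (B i) \<in> borel_measurable M" for i
    by (rule poisson_points_in_measurable[OF PP Bm])
  have "(\<integral>\<omega>. exp_neg (\<Sum>n. g (X n \<omega>)) \<partial>M) = (\<integral>\<omega>. (\<Prod>i<k. exp_neg (v i * points_in X (B i) \<omega>)) \<partial>M)"
    by (intro Bochner_Integration.integral_cong) (auto simp: sm exp_neg_sum)
  also have "\<dots> = (\<Prod>i<k. \<integral>\<omega>. exp_neg (v i * points_in X (B i) \<omega>) \<partial>M)"
  proof (rule indep_vars_lebesgue_integral)
    show "indep_vars (\<lambda>_. borel) (\<lambda>i \<omega>. exp_neg (v i * points_in X (B i) \<omega>)) {..<k}"
      by (rule indep_vars_compose2[OF ind, where Y="\<lambda>i x. exp_neg (v i * x)"]) measurable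
    show "integrable M (\<lambda>\<omega>. exp_neg (v i * points_in X (B i) \<omega>))" for i
      by (rule integrable_const_bound[where B=1]) auto
  qed simp
  also have "\<dots> = (\<Prod>i<k. exp (- (measure \<mu> (B i) * (1 - exp_neg (v i)))))"
    by (intro prod.cong refl exp_neg_poisson_variable P) (auto intro: prob_space_axioms)
  also have "\<dots> = exp (- (\<Sum>i<k. measure \<mu> (B i) * (1 - exp_neg (v i))))"
    by (simp add: exp_sum sum_negf[symmetric])
  also have "\<dots> = exp_neg (ennreal (\<Sum>i<k. measure \<mu> (B i) * (1 - exp_neg (v i))))"
    by (rule exp_neg_ennreal[symmetric]) (auto intro!: sum_nonneg)
  also have "ennreal (\<Sum>i<k. measure \<mu> (B i) * (1 - exp_neg (v i))) = (\<Sum>i<k. ennreal (1 - exp_neg (v i)) * emeasure \<mu> (B i))"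
    using Bfin by (subst sum_ennreal[symmetric])
      (auto simp: ennreal_mult' emeasure_eq_ennreal_measure mult.commute top.not_eq_extremum intro!: sum.cong)
  also have "\<dots> = (\<integral>\<^sup>+x. (\<Sum>i<k. ennreal (1 - exp_neg (v i)) * indicator (B i) x) \<partial>\<mu>)"
    by (subst nn_integral_sum) (auto simp: nn_integral_cmult_indicator)
  also have "\<dots> = (\<integral>\<^sup>+x. ennreal (1 - exp_neg (g x)) \<partial>\<mu>)"
    using rep[of _ "\<lambda>y. ennreal (1 - exp_neg y)"] by (intro nn_integral_cong) simp
  finally show ?thesis .
qed

text \<open>Simple functions increasing to \<open>f\<close>, cut off to sets of finite measure that
  exhaust the space, satisfy the previous lemma; both sides pass to the limit along increasing
  sequences.\<close>

lemma poisson_laplace: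
  assumes PP: "poisson_points M \<mu> X" and "sigma_finite_measure \<mu>"
    and f[measurable]: "f \<in> borel_measurable \<mu>"
  shows "(\<integral>\<omega>. exp_neg (\<Sum>n. f (X n \<omega>)) \<partial>M) = exp_neg (\<integral>\<^sup>+x. ennreal (1 - exp_neg (f x)) \<partial>\<mu>)"
proof -
  interpret prob_space M using PP by (simp add: poisson_points_def)
  interpret S: sigma_finite_measure \<mu> by fact
  have [measurable]: "X n \<in> measurable M \<mu>" for n using PP by (simp add: poisson_points_def)
  obtain A :: "nat \<Rightarrow> _" where A: "range A \<subseteq> sets \<mu>" "(\<Union>i. A i) = space \<mu>"
      "\<And>i. emeasure \<mu> (A i) \<noteq> \<infinity>" "incseq A"
    using S.sigma_finite_incseq by blast
  have [measurable]: "A i \<in> sets \<mu>" for i using A by auto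
  obtain g where g: "\<And>i. simple_function \<mu> (g i)" "incseq g" "\<And>x. (SUP i. g i x) = f x"
    using borel_measurable_implies_simple_function_sequence'[OF f] by metis
  define h where "h i x = g i x * indicator (A i) x" for i x
  have hs: "simple_function \<mu> (h i)" for i
    unfolding h_def[abs_def] by (intro simple_function_mult g simple_function_indicator) auto
  have [measurable]: "h i \<in> borel_measurable \<mu>" for i
    by (rule borel_measurable_simple_function[OF hs])
  have hinc: "incseq (\<lambda>i. h i x)" for x
    unfolding h_def using g(2) A(4)
    by (intro incseq_SucI mult_mono) (auto simp: incseq_Suc_iff le_fun_def indicator_def)
  have hSUP: "(SUP i. h i x) = f x" if "x \<in> space \<mu>" for x
  proof -
    have "x \<in> (\<Union>i. A i)" using A(2) that by simp
    then obtain j where j: "x \<in> A j" by blast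
    have xA: "x \<in> A i" if "j \<le> i" for i using j A(4) that by (auto simp: incseq_def)
    have "(\<lambda>i. h i x) \<longlonglongrightarrow> f x"
    proof (rule Lim_transform_eventually)
      show "(\<lambda>i. g i x) \<longlonglongrightarrow> f x"
        unfolding g(3)[symmetric] using g(2)
        by (intro LIMSEQ_SUP) (auto simp: incseq_def le_fun_def)
      show "eventually (\<lambda>i. g i x = h i x) sequentially"
        using eventually_ge_at_top[of j] by eventually_elim (auto simp: h_def xA)
    qed
    then show ?thesis using LIMSEQ_SUP[OF hinc] LIMSEQ_unique by blast
  qed
  have hfin: "emeasure \<mu> {x \<in> space \<mu>. h i x \<noteq> 0} < \<infinity>" for i
  proof -
    have "emeasure \<mu> {x \<in> space \<mu>. h i x \<noteq> 0} \<le> emeasure \<mu> (A i)"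
      by (intro emeasure_mono) (auto simp: h_def indicator_def split: if_splits)
    then show ?thesis using A(3)[of i] by (simp add: top.not_eq_extremum)
  qed
  have "(\<lambda>i. \<integral>\<omega>. exp_neg (\<Sum>n. h i (X n \<omega>)) \<partial>M) \<longlonglongrightarrow> (\<integral>\<omega>. exp_neg (\<Sum>n. f (X n \<omega>)) \<partial>M)"
  proof (rule integral_dominated_convergence[where w="\<lambda>_. 1"])
    show "AE \<omega> in M. (\<lambda>i. exp_neg (\<Sum>n. h i (X n \<omega>))) \<longlonglongrightarrow> exp_neg (\<Sum>n. f (X n \<omega>))"
    proof (intro AE_I2)
      fix \<omega> assume w: "\<omega> \<in> space M"
      have X: "X n \<omega> \<in> space \<mu>" for n by (rule measurable_space[OF _ w]) measurable
      have "(SUP i. \<Sum>n. h i (X n \<omega>)) = (\<Sum>n. SUP i. h i (X n \<omega>))"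
        unfolding nn_integral_count_space_nat[symmetric] using hinc
        by (intro nn_integral_monotone_convergence_SUP[symmetric])
          (auto simp: incseq_def le_fun_def)
      also have "\<dots> = (\<Sum>n. f (X n \<omega>))" using hSUP X by simp
      finally have "(SUP i. \<Sum>n. h i (X n \<omega>)) = (\<Sum>n. f (X n \<omega>))" .
      moreover have "incseq (\<lambda>i. \<Sum>n. h i (X n \<omega>))"
        using hinc by (auto simp: incseq_def intro!: suminf_le)
      ultimately show "(\<lambda>i. exp_neg (\<Sum>n. h i (X n \<omega>))) \<longlonglongrightarrow> exp_neg (\<Sum>n. f (X n \<omega>))"
        using exp_neg_SUP by metis
    qed
  qed auto
  moreover have "(\<lambda>i. \<integral>\<omega>. exp_neg (\<Sum>n. h i (X n \<omega>)) \<partial>M) \<longlonglongrightarrow> exp_neg (\<integral>\<^sup>+x. ennreal (1 - exp_neg (f x)) \<partial>\<mu>)"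
    unfolding poisson_laplace_simple[OF PP hs hfin]
  proof -
    have lim: "(\<lambda>i. ennreal (1 - exp_neg (h i x))) \<longlonglongrightarrow> ennreal (1 - exp_neg (f x))" if "x \<in> space \<mu>" for x
      using exp_neg_SUP[OF hinc, of x] hSUP[OF that] by (auto intro!: tendsto_intros)
    have inc: "incseq (\<lambda>i. ennreal (1 - exp_neg (h i x)))" for x
      using hinc[of x] by (auto simp: incseq_def intro!: ennreal_leI exp_neg_antimono)
    have "(SUP i. \<integral>\<^sup>+x. ennreal (1 - exp_neg (h i x)) \<partial>\<mu>) = (\<integral>\<^sup>+x. (SUP i. ennreal (1 - exp_neg (h i x))) \<partial>\<mu>)"
      using inc by (intro nn_integral_monotone_convergence_SUP[symmetric]) (auto simp: incseq_def le_fun_def)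
    also have "\<dots> = (\<integral>\<^sup>+x. ennreal (1 - exp_neg (f x)) \<partial>\<mu>)"
      using LIMSEQ_unique[OF LIMSEQ_SUP[OF inc] lim] by (intro nn_integral_cong) auto
    finally have "(SUP i. \<integral>\<^sup>+x. ennreal (1 - exp_neg (h i x)) \<partial>\<mu>) = (\<integral>\<^sup>+x. ennreal (1 - exp_neg (f x)) \<partial>\<mu>)" .
    moreover have "incseq (\<lambda>i. \<integral>\<^sup>+x. ennreal (1 - exp_neg (h i x)) \<partial>\<mu>)"
      using inc by (auto simp: incseq_def intro!: nn_integral_mono)
    ultimately show "(\<lambda>i. exp_neg (\<integral>\<^sup>+x. ennreal (1 - exp_neg (h i x)) \<partial>\<mu>)) \<longlonglongrightarrow> exp_neg (\<integral>\<^sup>+x. ennreal (1 - exp_neg (f x)) \<partial>\<mu>)"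
      using exp_neg_SUP by metis
  qed
  ultimately show ?thesis by (rule LIMSEQ_unique)
qed

subsection \<open>Ranked points of the stable process\<close>

lemma sigma_finite_stable_intensity: "sigma_finite_measure (stable_intensity \<sigma>)"
  unfolding stable_intensity_def
  by (subst sigma_finite_measure.sigma_finite_iff_density_finite[OF lborel.sigma_finite_measure_axioms]) auto

lemma sets_stable_intensity[measurable_cong, simp]: "sets (stable_intensity \<sigma>) = sets borel"
  by (simp add: stable_intensity_def)

lemma space_stable_intensity[simp]: "space (stable_intensity \<sigma>) = UNIV"
  by (simp add: stable_intensity_def)

lemma emeasure_stable_tail:
  assumes \<sigma>: "0 < \<sigma>" and a: "0 < a"
  shows "emeasure (stable_intensity \<sigma>) {a..} = ennreal (a powr (- \<sigma>))"
proof -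
  have "emeasure (stable_intensity \<sigma>) {a..} =
      (\<integral>\<^sup>+x. ennreal (\<sigma> * x powr (-1 - \<sigma>)) * indicator {a..} x \<partial>lborel)"
    using a unfolding stable_intensity_def
    by (subst emeasure_density) (auto intro!: nn_integral_cong simp: indicator_def)
  also have "\<dots> = ennreal (0 - (- (a powr (- \<sigma>))))"
  proof (rule nn_integral_FTC_atLeast)
    show "((\<lambda>x. - (x powr (- \<sigma>))) \<longlongrightarrow> 0) at_top"
      using tendsto_minus[OF tendsto_neg_powr[OF _ filterlim_ident, of "- \<sigma>"]] \<sigma> by simp
    show "DERIV (\<lambda>x. - (x powr (- \<sigma>))) x :> \<sigma> * x powr (-1 - \<sigma>)" if "a \<le> x" for x
    proof -
      have "-1 - \<sigma> = - \<sigma> - 1" by simp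
      then show ?thesis using a that by (auto intro!: derivative_eq_intros simp only:)
    qed
  qed (use \<sigma> in auto)
  finally show ?thesis by simp
qed

lemma powr_neg_le_iff:
  fixes x b \<sigma> :: real
  assumes "0 < \<sigma>" "0 < x" "0 < b"
  shows "x powr (- \<sigma>) \<le> b \<longleftrightarrow> b powr (- (1 / \<sigma>)) \<le> x"
proof -
  have "x powr (- \<sigma>) \<le> b \<longleftrightarrow> - \<sigma> * ln x \<le> ln b"
    using assms by (subst ln_le_cancel_iff[symmetric]) (auto simp: ln_powr)
  also have "\<dots> \<longleftrightarrow> - (1 / \<sigma>) * ln b \<le> ln x"
    using assms by (auto simp: field_simps)
  also have "\<dots> \<longleftrightarrow> b powr (- (1 / \<sigma>)) \<le> x"
    using assms by (subst (2) ln_le_cancel_iff[symmetric]) (auto simp: ln_powr)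
  finally show ?thesis .
qed

text \<open>The tail \<open>{a..}\<close> has mass \<open>a powr (-\<sigma>)\<close>, so the
  decreasing map carries it to an interval \<open>{0<..b}\<close> of mass exactly \<open>b\<close>:
  in power coordinates the stable process has unit rate.\<close>

lemma distr_stable_intensity:
  assumes \<sigma>: "0 < \<sigma>"
  shows "distr (stable_intensity \<sigma>) borel (\<lambda>x. x powr (- \<sigma>)) = density lborel (indicator {0<..})"
proof (rule measure_eqI_generator_eq[where E="range atMost" and \<Omega>=UNIV and A="\<lambda>n. {..real n}"])
  have em: "emeasure (distr (stable_intensity \<sigma>) borel (\<lambda>x. x powr (- \<sigma>))) {..b} = ennreal (max 0 b)" for b
  proof -
    have "emeasure (distr (stable_intensity \<sigma>) borel (\<lambda>x. x powr (- \<sigma>))) {..b} =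
        emeasure (stable_intensity \<sigma>) ((\<lambda>x. x powr (- \<sigma>)) -` {..b})"
      by (subst emeasure_distr) auto
    \<comment> \<open>Points \<open>x \<le> 0\<close> may lie in the preimage, since
      \<open>powr\<close> has a value there too; the intensity does not charge them.\<close>
    also have "\<dots> = emeasure (stable_intensity \<sigma>) ((\<lambda>x. x powr (- \<sigma>)) -` {..b} \<inter> {0<..})"
    proof -
      have [measurable]: "(\<lambda>x. x powr (- \<sigma>)) -` {..b} \<in> sets borel"
        by (rule measurable_sets_borel[of _ borel]) auto
      show ?thesis
        unfolding stable_intensity_def
        by (subst (1 2) emeasure_density) (auto intro!: nn_integral_cong simp: indicator_def)
    qed
    also have "\<dots> = ennreal (max 0 b)"
    proof (cases "0 < b")
      case True
      then have "(\<lambda>x. x powr (- \<sigma>)) -` {..b} \<inter> {0<..} = {b powr (- (1 / \<sigma>))..}"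
      proof (intro set_eqI iffI)
        fix x assume x: "x \<in> {b powr (- (1 / \<sigma>))..}"
        have "0 < b powr (- (1 / \<sigma>))" using True by simp
        also have "\<dots> \<le> x" using x by simp
        finally show "x \<in> (\<lambda>x. x powr (- \<sigma>)) -` {..b} \<inter> {0<..}"
          using x powr_neg_le_iff[OF \<sigma> _ True] by simp
      qed (use powr_neg_le_iff[OF \<sigma> _ True] in auto)
      then show ?thesis using True \<sigma> by (simp add: emeasure_stable_tail powr_powr)
    next
      case False
      then have "(\<lambda>x. x powr (- \<sigma>)) -` {..b} \<inter> {0<..} = {}"
        by (auto simp: not_less not_le) (metis less_le_trans not_less powr_gt_zero less_irrefl order.trans)
      then show ?thesis using False by (simp add: max_def)
    qed
    finally show ?thesis .
  qed
  show "emeasure (distr (stable_intensity \<sigma>) borel (\<lambda>x. x powr (- \<sigma>))) X =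
      emeasure (density lborel (indicator {0<..})) X" if "X \<in> range atMost" for X :: "real set"
  proof -
    from that obtain b where b: "X = {..b}" by auto
    have "emeasure (density lborel (indicator {0<..})) X = (\<integral>\<^sup>+x. indicator {0<..b} x \<partial>lborel)"
      unfolding b by (subst emeasure_density)
        (auto intro!: nn_integral_cong simp: indicator_def simp del: nn_integral_indicator)
    also have "\<dots> = ennreal (max 0 b)" by (cases "0 \<le> b") auto
    finally show ?thesis unfolding b em ..
  qed
  show "emeasure (distr (stable_intensity \<sigma>) borel (\<lambda>x. x powr (- \<sigma>))) {..real n} \<noteq> \<infinity>" for n
    unfolding em by simp
  show "(\<Union>n. {..real n}) = UNIV" using real_arch_simple by auto
  show "sets (distr (stable_intensity \<sigma>) borel (\<lambda>x. x powr (- \<sigma>))) = sigma_sets UNIV (range atMost)"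
    by (simp add: borel_eq_atMost)
  show "sets (density lborel (indicator {0<..})) = sigma_sets UNIV (range (atMost :: real \<Rightarrow> _))"
    by (simp add: borel_eq_atMost)
qed (auto simp: Int_stable_def)

lemma nn_integral_stable_subst:
  assumes "0 < \<sigma>" and [measurable]: "f \<in> borel_measurable borel"
  shows "(\<integral>\<^sup>+x. f (x powr (- \<sigma>)) \<partial>stable_intensity \<sigma>) = (\<integral>\<^sup>+y. f y * indicator {0<..} y \<partial>lborel)"
proof -
  have "(\<integral>\<^sup>+x. f (x powr (- \<sigma>)) \<partial>stable_intensity \<sigma>) =
      (\<integral>\<^sup>+y. f y \<partial>distr (stable_intensity \<sigma>) borel (\<lambda>x. x powr (- \<sigma>)))"
    by (rule nn_integral_distr[symmetric]) auto
  also have "\<dots> = (\<integral>\<^sup>+y. f y * indicator {0<..} y \<partial>lborel)"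
    by (simp add: distr_stable_intensity[OF assms(1)] nn_integral_density mult.commute)
  finally show ?thesis .
qed

text \<open>The arrival times of a unit rate Poisson process, in increasing order because the ranked
  jumps decrease.\<close>

definition unit_rate_law :: "real \<Rightarrow> (nat \<Rightarrow> real) measure \<Rightarrow> (nat \<Rightarrow> real) measure" where
  "unit_rate_law \<sigma> L = distr L real_seq (\<lambda>\<Delta> n. \<Delta> n powr (- \<sigma>))"

lemma ranked_stable_lawD:
  assumes "ranked_stable_law \<sigma> L"
  shows "prob_space L" and "sets L = sets real_seq"
    and "poisson_points L (stable_intensity \<sigma>) (\<lambda>n \<Delta>. \<Delta> n)"
    and "AE \<Delta> in L. \<forall>n. 0 < \<Delta> n" and "AE \<Delta> in L. \<forall>n. \<Delta> (Suc n) < \<Delta> n"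
proof -
  show s[measurable_cong]: "sets L = sets real_seq" and PP: "poisson_points L (stable_intensity \<sigma>) (\<lambda>n \<Delta>. \<Delta> n)"
    and "AE \<Delta> in L. \<forall>n. \<Delta> (Suc n) < \<Delta> n"
    using assms by (auto simp: ranked_stable_law_def)
  show "prob_space L" using PP by (simp add: poisson_points_def)
  then interpret prob_space L .
  \<comment> \<open>The nonpositive half line has intensity \<open>0\<close>, hence almost surely
    contains no point.\<close>
  have "emeasure (stable_intensity \<sigma>) {..0} = 0"
    unfolding stable_intensity_def by (subst emeasure_density) (auto simp: indicator_def nn_integral_0_iff_AE)
  then have "prob {\<Delta>\<in>space L. points_in (\<lambda>n \<Delta>. \<Delta> n) {..0} \<Delta> = of_nat 0} = 1"
    using PP[unfolded poisson_points_def, THEN conjunct2, THEN conjunct2, THEN conjunct1, rule_format,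
        of "{..0}" 0] by (simp add: measure_def)
  then have "AE \<Delta> in L. points_in (\<lambda>n \<Delta>. \<Delta> n) {..0} \<Delta> = of_nat 0"
    using poisson_points_in_measurable[OF PP, of "{..0}"] by (subst (asm) prob_Collect_eq_1) auto
  then show "AE \<Delta> in L. \<forall>n. 0 < \<Delta> n"
    by eventually_elim (auto simp: points_in_def emeasure_count_space_eq_0 not_le)
qed

lemma
  assumes L: "ranked_stable_law \<sigma> L" and \<sigma>: "0 < \<sigma>"
  shows prob_space_unit_rate_law: "prob_space (unit_rate_law \<sigma> L)"
    and sets_unit_rate_law: "sets (unit_rate_law \<sigma> L) = sets real_seq"
    and unit_rate_law_mono: "AE y in unit_rate_law \<sigma> L. strict_mono y \<and> 0 < y 0"
    and unit_rate_law_laplace: "\<And>f. f \<in> borel_measurable borel \<Longrightarrow>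
      (\<integral>y. exp_neg (\<Sum>n. f (y n)) \<partial>unit_rate_law \<sigma> L) =
      exp_neg (\<integral>\<^sup>+y. ennreal (1 - exp_neg (f y)) * indicator {0<..} y \<partial>lborel)"
proof -
  note LD = ranked_stable_lawD[OF L]
  interpret prob_space L by (rule LD)
  note [measurable_cong] = LD(2)
  have Ym[measurable]: "(\<lambda>\<Delta> n. \<Delta> n powr (- \<sigma>)) \<in> measurable L real_seq"
    by (rule measurable_PiM_single') auto
  show "prob_space (unit_rate_law \<sigma> L)" unfolding unit_rate_law_def by (rule prob_space_distr) fact
  show "sets (unit_rate_law \<sigma> L) = sets real_seq" by (simp add: unit_rate_law_def)
  show "AE y in unit_rate_law \<sigma> L. strict_mono y \<and> 0 < y 0"
    unfolding unit_rate_law_def strict_mono_Suc_iff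
  proof (subst AE_distr_iff)
    show "{x \<in> space real_seq. (\<forall>n. x n < x (Suc n)) \<and> 0 < x 0} \<in> sets real_seq" by measurable
    show "AE \<Delta> in L. (\<forall>n. \<Delta> n powr - \<sigma> < \<Delta> (Suc n) powr - \<sigma>) \<and> 0 < \<Delta> 0 powr - \<sigma>"
      using LD(4,5)
    proof eventually_elim
      case (elim \<Delta>)
      have "\<Delta> n powr - \<sigma> < \<Delta> (Suc n) powr - \<sigma>" for n
        using elim \<sigma> by (intro powr_less_mono2_neg) auto
      then show ?case using elim by (metis less_irrefl powr_gt_zero)
    qed
  qed fact
  fix f :: "real \<Rightarrow> ennreal" assume [measurable]: "f \<in> borel_measurable borel"
  have "(\<integral>y. exp_neg (\<Sum>n. f (y n)) \<partial>unit_rate_law \<sigma> L) = (\<integral>\<Delta>. exp_neg (\<Sum>n. f (\<Delta> n powr (- \<sigma>))) \<partial>L)"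
    unfolding unit_rate_law_def by (rule integral_distr) measurable
  also have "\<dots> = exp_neg (\<integral>\<^sup>+x. ennreal (1 - exp_neg (f (x powr (- \<sigma>)))) \<partial>stable_intensity \<sigma>)"
    by (rule poisson_laplace[OF LD(3) sigma_finite_stable_intensity]) measurable
  also have "\<dots> = exp_neg (\<integral>\<^sup>+y. ennreal (1 - exp_neg (f y)) * indicator {0<..} y \<partial>lborel)"
    by (subst nn_integral_stable_subst[OF \<sigma>, where f="\<lambda>y. ennreal (1 - exp_neg (f y))"]) auto
  finally show "(\<integral>y. exp_neg (\<Sum>n. f (y n)) \<partial>unit_rate_law \<sigma> L) =
      exp_neg (\<integral>\<^sup>+y. ennreal (1 - exp_neg (f y)) * indicator {0<..} y \<partial>lborel)" .
qed

lemma suminf_case_nat: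
  fixes h :: "'a \<Rightarrow> ennreal"
  shows "(\<Sum>n. h (case_nat a x n)) = h a + (\<Sum>n. h (x n))"
  using sums_Suc[of "\<lambda>n. h (case_nat a x n)", OF summable_sums]
  by (simp add: sums_unique[symmetric] add.commute)

lemma antiderivative_exists:
  fixes k :: "real \<Rightarrow> real"
  assumes "continuous_on UNIV k"
  obtains K where "\<And>x. (K has_real_derivative k x) (at x)"
proof -
  have "\<exists>K. \<forall>x. -\<infinity> < ereal x \<longrightarrow> ereal x < \<infinity> \<longrightarrow> (K has_vector_derivative k x) (at x)"
    by (rule einterval_antiderivative) (use assms in \<open>auto simp: continuous_on_eq_continuous_at\<close>)
  then have "\<exists>K. \<forall>x. (K has_real_derivative k x) (at x)"
    by (simp add: has_real_derivative_iff_has_vector_derivative)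
  then show ?thesis using that by blast
qed

text \<open>The renewal identity at the level of Laplace functionals: on the left the first point
  \<open>e\<close> is exponential and the others form a unit rate process beyond \<open>e\<close>,
  on the right stands the whole process. With \<open>k = 1 - exp (- f)\<close> and its tail integral
  \<open>K T - K e\<close> over \<open>{e<..}\<close>, the integrand
  \<open>(1 - k e) * exp (- e - (K T - K e))\<close> is the derivative of
  \<open>- exp (- e - (K T - K e))\<close>.\<close>

lemma exponential_shift_integral:
  fixes f :: "real \<Rightarrow> real"
  assumes f: "continuous_on UNIV f" "\<And>y. 0 \<le> f y" and T: "\<And>y. T \<le> y \<Longrightarrow> f y = 0"
  shows "(\<integral>\<^sup>+e. ennreal (exp (- f e) * exp_neg (\<integral>\<^sup>+v. ennreal (1 - exp (- f (e + v))) * indicator {0<..} v \<partial>lborel))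
      \<partial>density lborel (exponential_density 1)) =
    ennreal (exp_neg (\<integral>\<^sup>+y. ennreal (1 - exp (- f y)) * indicator {0<..} y \<partial>lborel))"
proof -
  define k where "k y = 1 - exp (- f y)" for y
  have kc: "continuous_on UNIV k" unfolding k_def by (intro continuous_intros f)
  have [measurable]: "k \<in> borel_measurable borel" by (rule borel_measurable_continuous_onI[OF kc])
  have [measurable]: "f \<in> borel_measurable borel" by (rule borel_measurable_continuous_onI[OF f(1)])
  have k0: "0 \<le> k y" for y using f(2) by (simp add: k_def)
  obtain K where K: "\<And>x. (K has_real_derivative k x) (at x)" using antiderivative_exists[OF kc] by blast
  have Km: "K x \<le> K y" if "x \<le> y" for x y
    using K k0 by (intro DERIV_nonneg_imp_nondecreasing[OF that]) auto
  have KT: "K x = K T" if "T \<le> x" for x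
  proof (rule antisym)
    have "(- K T) \<le> (- K x)"
    proof (rule DERIV_nonneg_imp_nondecreasing[OF that])
      fix y assume "T \<le> y" "y \<le> x"
      then have "k y = 0" using T by (simp add: k_def)
      then have "((\<lambda>y. - K y) has_real_derivative 0) (at y)" using DERIV_minus[OF K[of y]] by simp
      then show "\<exists>z. ((\<lambda>y. - K y) has_real_derivative z) (at y) \<and> 0 \<le> z" by auto
    qed
    then show "K x \<le> K T" by simp
  qed (rule Km[OF that])
  have KleT: "K x \<le> K T" for x using Km[of x T] KT[of x] by (cases "x \<le> T") auto
  have Klim: "(K \<longlongrightarrow> K T) at_top"
    by (rule tendsto_eventually, unfold eventually_at_top_linorder) (use KT in blast)
  have H: "(\<integral>\<^sup>+y. ennreal (k y) * indicator {e<..} y \<partial>lborel) = ennreal (K T - K e)" for e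
  proof -
    have "(\<integral>\<^sup>+y. ennreal (k y) * indicator {e<..} y \<partial>lborel) = (\<integral>\<^sup>+y. ennreal (k y) * indicator {e..} y \<partial>lborel)"
      by (intro nn_integral_cong_AE eventually_mono[OF AE_lborel_singleton[of e]]) (auto simp: indicator_def)
    also have "\<dots> = ennreal (K T - K e)"
      by (rule nn_integral_FTC_atLeast) (auto intro: K k0 Klim)
    finally show ?thesis .
  qed
  have H': "(\<integral>\<^sup>+v. ennreal (k (e + v)) * indicator {0<..} v \<partial>lborel) = ennreal (K T - K e)" for e
  proof -
    have "(\<integral>\<^sup>+y. ennreal (k y) * indicator {e<..} y \<partial>lborel) =
        (\<integral>\<^sup>+v. ennreal (k (e + v)) * indicator {0<..} v \<partial>lborel)"
      by (subst nn_integral_real_affine[where c=1 and t=e]) (auto intro!: nn_integral_cong simp: indicator_def)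
    then show ?thesis using H by simp
  qed
  have Kcont: "isCont K x" for x using K by (rule DERIV_isCont)
  have [measurable]: "K \<in> borel_measurable borel"
    using Kcont by (intro borel_measurable_continuous_onI) (simp add: continuous_on_eq_continuous_at)
  have "(\<integral>\<^sup>+e. ennreal (exp (- f e) * exp_neg (\<integral>\<^sup>+v. ennreal (k (e + v)) * indicator {0<..} v \<partial>lborel))
      \<partial>density lborel (exponential_density 1)) =
    (\<integral>\<^sup>+e. ennreal (exp (- f e) * exp (- (K T - K e))) \<partial>density lborel (exponential_density 1))"
    using KleT by (simp add: H' exp_neg_ennreal)
  also have "\<dots> = (\<integral>\<^sup>+e. ennreal ((1 - k e) * exp (- e - (K T - K e))) * indicator {0..} e \<partial>lborel)"
    by (subst nn_integral_density)
      (auto intro!: nn_integral_cong simp: exponential_density_def indicator_def k_def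
        ennreal_mult'[symmetric] exp_add[symmetric] exp_diff[symmetric] algebra_simps)
  also have "\<dots> = ennreal (0 - (- exp (- 0 - (K T - K 0))))"
  proof (rule nn_integral_FTC_atLeast)
    show "((\<lambda>e. - exp (- e - (K T - K e))) has_real_derivative (1 - k x) * exp (- x - (K T - K x))) (at x)" for x
      by (auto intro!: derivative_eq_intros K simp: algebra_simps)
    show "0 \<le> (1 - k x) * exp (- x - (K T - K x))" for x by (simp add: k_def)
    have "((\<lambda>e. - exp (- e - (K T - K e))) \<longlongrightarrow> - 0) at_top"
    proof (rule tendsto_minus, rule Lim_null_comparison)
      show "eventually (\<lambda>e. norm (exp (- e - (K T - K e))) \<le> exp (- e)) at_top"
        using KleT by (intro always_eventually) simp
      show "((\<lambda>e. exp (- e)) \<longlongrightarrow> (0::real)) at_top"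
        by (rule filterlim_compose[OF exp_at_bot filterlim_uminus_at_bot_at_top])
    qed
    then show "((\<lambda>e. - exp (- e - (K T - K e))) \<longlongrightarrow> 0) at_top" by simp
  qed measurable
  also have "\<dots> = ennreal (exp_neg (\<integral>\<^sup>+y. ennreal (k y) * indicator {0<..} y \<partial>lborel))"
    using KleT by (simp add: H exp_neg_ennreal)
  finally show ?thesis unfolding k_def .
qed

text \<open>Both laws have the same Laplace functional on continuous \<open>f\<close> that vanish far out. These
  functionals determine the number of points below each level \<open>t\<close>, and on increasing sequences
  \<open>y n < t\<close> holds iff more than \<open>n\<close> points lie below \<open>t\<close>; so they determine the law.\<close>

lemma unit_rate_law_renewal:
  assumes L: "ranked_stable_law \<sigma> L" and \<sigma>: "0 < \<sigma>"
  defines "Q \<equiv> unit_rate_law \<sigma> L"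
  shows "Q = distr (density lborel (exponential_density 1) \<Otimes>\<^sub>M Q) real_seq
    (\<lambda>(e, y). case_nat e (\<lambda>n. e + y n))" (is "_ = ?R")
proof -
  define X where "X = density lborel (exponential_density 1)"
  have sX[measurable_cong]: "sets X = sets borel" by (simp add: X_def)
  interpret X: prob_space X unfolding X_def by (rule prob_space_exponential_density) simp
  interpret Q: prob_space Q unfolding Q_def by (rule prob_space_unit_rate_law[OF L \<sigma>])
  have sQ[measurable_cong]: "sets Q = sets real_seq" unfolding Q_def by (rule sets_unit_rate_law[OF L \<sigma>])
  have spQ: "space Q = UNIV" using sets_eq_imp_space_eq[OF sQ] by (simp add: space_PiM)
  interpret XQ: pair_prob_space X Q ..
  define g where "g = (\<lambda>(e::real, y::nat \<Rightarrow> real). case_nat e (\<lambda>n. e + y n))"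
  have gm[measurable]: "g \<in> measurable (X \<Otimes>\<^sub>M Q) real_seq"
    unfolding g_def split_beta
  proof (rule measurable_case_nat')
    show "(\<lambda>x n. fst x + snd x n) \<in> measurable (X \<Otimes>\<^sub>M Q) real_seq"
      by (rule measurable_PiM_single') auto
  qed measurable
  define R where "R = distr (X \<Otimes>\<^sub>M Q) real_seq g"
  interpret R: prob_space R unfolding R_def by (rule XQ.prob_space_distr) measurable
  have sR[measurable_cong]: "sets R = sets real_seq" by (simp add: R_def)
  define S where "S = {y::nat \<Rightarrow> real. strict_mono y}"
  have Sm[measurable]: "S \<in> sets real_seq"
  proof -
    have "{y \<in> space real_seq. \<forall>n. y n < y (Suc n)} \<in> sets real_seq" by measurable
    then show ?thesis by (simp add: S_def strict_mono_Suc_iff space_PiM)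
  qed
  have QS: "AE y in Q. y \<in> S"
    using unit_rate_law_mono[OF L \<sigma>] unfolding Q_def S_def by auto
  have RS: "AE y in R. y \<in> S"
  proof -
    have "AE p in X \<Otimes>\<^sub>M Q. strict_mono (snd p) \<and> 0 < snd p 0"
    proof -
      have Y: "AE y in Q. strict_mono y \<and> 0 < y 0"
        using unit_rate_law_mono[OF L \<sigma>] unfolding Q_def .
      show ?thesis
      proof (rule XQ.AE_pair_measure)
        have "{p \<in> space (X \<Otimes>\<^sub>M Q). (\<forall>n. snd p n < snd p (Suc n)) \<and> 0 < snd p 0} \<in> sets (X \<Otimes>\<^sub>M Q)"
          by measurable
        then show "{p \<in> space (X \<Otimes>\<^sub>M Q). strict_mono (snd p) \<and> 0 < snd p 0} \<in> sets (X \<Otimes>\<^sub>M Q)"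
          by (simp add: strict_mono_Suc_iff)
      qed (use Y in simp)
    qed
    then have "AE p in X \<Otimes>\<^sub>M Q. g p \<in> S"
    proof eventually_elim
      case (elim p)
      then show ?case
        by (cases p) (auto simp: g_def S_def strict_mono_Suc_iff split: nat.split)
    qed
    then show ?thesis unfolding R_def by (subst AE_distr_iff) auto
  qed
  \<comment> \<open>Continuity provides the antiderivative in
    \<open>exponential_shift_integral\<close>; vanishing from some \<open>T\<close> on keeps the
    tail integrals finite. Sums of such functions are again of this kind, which makes
    \<open>C\<close> closed under products.\<close>
  define D where "D = {f::real \<Rightarrow> real. continuous_on UNIV f \<and> (\<forall>y. 0 \<le> f y) \<and> (\<exists>T. \<forall>y\<ge>T. f y = 0)}"
  define C where "C = (\<lambda>f x. exp_neg (\<Sum>n. ennreal (f (x n)))) ` D"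
  have Dm: "f \<in> borel_measurable borel" if "f \<in> D" for f
    using that by (intro borel_measurable_continuous_onI) (auto simp: D_def)
  have lap: "(\<integral>y. exp_neg (\<Sum>n. ennreal (f (y n))) \<partial>Q) = (\<integral>y. exp_neg (\<Sum>n. ennreal (f (y n))) \<partial>R)" if f: "f \<in> D" for f
  proof -
    have [measurable]: "f \<in> borel_measurable borel" by (rule Dm[OF f])
    have f0: "0 \<le> f y" for y using f by (auto simp: D_def)
    obtain T where T: "\<And>y. T \<le> y \<Longrightarrow> f y = 0" using f by (auto simp: D_def)
    have q: "(\<integral>y. exp_neg (\<Sum>n. ennreal (f (e + y n))) \<partial>Q) =
        exp_neg (\<integral>\<^sup>+v. ennreal (1 - exp (- f (e + v))) * indicator {0<..} v \<partial>lborel)" for e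
      unfolding Q_def
      by (subst unit_rate_law_laplace[OF L \<sigma>, where f="\<lambda>v. ennreal (f (e + v))"]) (auto simp: exp_neg_ennreal f0)
    have "(\<integral>\<^sup>+y. ennreal (exp_neg (\<Sum>n. ennreal (f (y n)))) \<partial>R) =
        (\<integral>\<^sup>+p. ennreal (exp_neg (\<Sum>n. ennreal (f (g p n)))) \<partial>(X \<Otimes>\<^sub>M Q))"
      unfolding R_def by (rule nn_integral_distr) measurable
    also have "\<dots> = (\<integral>\<^sup>+e. \<integral>\<^sup>+y. ennreal (exp_neg (\<Sum>n. ennreal (f (g (e, y) n)))) \<partial>Q \<partial>X)"
      by (rule Q.nn_integral_fst[symmetric]) measurable
    also have "\<dots> = (\<integral>\<^sup>+e. ennreal (exp (- f e)) * (\<integral>\<^sup>+y. ennreal (exp_neg (\<Sum>n. ennreal (f (e + y n)))) \<partial>Q) \<partial>X)"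
      by (intro nn_integral_cong, subst nn_integral_cmult[symmetric])
        (auto simp: g_def suminf_case_nat[of "\<lambda>x. ennreal (f x)"] exp_neg_add exp_neg_ennreal f0 ennreal_mult')
    also have "\<dots> = (\<integral>\<^sup>+e. ennreal (exp (- f e) *
        exp_neg (\<integral>\<^sup>+v. ennreal (1 - exp (- f (e + v))) * indicator {0<..} v \<partial>lborel)) \<partial>X)"
      by (intro nn_integral_cong, subst nn_integral_eq_integral)
        (auto simp: q ennreal_mult' intro!: Q.integrable_const_bound[where B=1])
    also have "\<dots> = ennreal (exp_neg (\<integral>\<^sup>+y. ennreal (1 - exp (- f y)) * indicator {0<..} y \<partial>lborel))"
      unfolding X_def using f f0 T by (intro exponential_shift_integral) (auto simp: D_def)
    finally have "(\<integral>y. exp_neg (\<Sum>n. ennreal (f (y n))) \<partial>R) =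
        exp_neg (\<integral>\<^sup>+y. ennreal (1 - exp (- f y)) * indicator {0<..} y \<partial>lborel)"
      by (subst integral_eq_nn_integral) auto
    also have "\<dots> = (\<integral>y. exp_neg (\<Sum>n. ennreal (f (y n))) \<partial>Q)"
      unfolding Q_def
      by (subst unit_rate_law_laplace[OF L \<sigma>, where f="\<lambda>v. ennreal (f v)"]) (auto simp: exp_neg_ennreal f0)
    finally show ?thesis ..
  qed
  define G where "G = {h -` {a<..} \<inter> space Q | h a. h \<in> C}"
  have agree: "emeasure Q A = emeasure R A" if "A \<in> sigma_sets (space Q) G" for A
    using that unfolding G_def
  proof (rule multiplicative_class_eq[rotated -1])
    show "finite_measure Q" "finite_measure R" by unfold_locales
    show "sets Q = sets R" by (simp add: sQ sR)
    show "h \<in> borel_measurable Q" if "h \<in> C" for h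
    proof -
      obtain f where "f \<in> D" "h = (\<lambda>x. exp_neg (\<Sum>n. ennreal (f (x n))))" using \<open>h \<in> C\<close> by (auto simp: C_def)
      then show ?thesis using Dm[OF \<open>f \<in> D\<close>] by simp
    qed
    show "0 \<le> h x \<and> h x \<le> 1" if "h \<in> C" for h x using that by (auto simp: C_def)
    have "(\<lambda>_. 0) \<in> D" by (auto simp: D_def)
    then show "(\<lambda>_. 1) \<in> C" unfolding C_def by (rule rev_image_eqI) simp
    show "(\<lambda>x. h x * h' x) \<in> C" if hh: "h \<in> C" "h' \<in> C" for h h'
    proof -
      obtain f f' where ff: "f \<in> D" "h = (\<lambda>x. exp_neg (\<Sum>n. ennreal (f (x n))))"
        "f' \<in> D" "h' = (\<lambda>x. exp_neg (\<Sum>n. ennreal (f' (x n))))" using hh unfolding C_def by blast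
      obtain T T' where TT: "\<And>y. T \<le> y \<Longrightarrow> f y = 0" "\<And>y. T' \<le> y \<Longrightarrow> f' y = 0" using ff by (auto simp: D_def)
      have d: "(\<lambda>y. f y + f' y) \<in> D"
        using ff unfolding D_def
        by (auto intro!: continuous_intros exI[of _ "max T T'"] simp: TT)
      have e: "(\<lambda>x. h x * h' x) = (\<lambda>x. exp_neg (\<Sum>n. ennreal (f (x n) + f' (x n))))"
        using ff by (auto simp: D_def ennreal_plus suminf_add[symmetric] exp_neg_add)
      show ?thesis unfolding C_def e by (rule image_eqI[OF _ d]) simp
    qed
    show "integral\<^sup>L Q h = integral\<^sup>L R h" if "h \<in> C" for h
      using that lap by (auto simp: C_def)
  qed
  \<comment> \<open>\<open>\<Sigma>\<close> is generated by the functionals in \<open>C\<close>. It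
    need not be the product algebra, but the two have the same trace on \<open>S\<close>, which
    carries both laws.\<close>
  define \<Sigma> where "\<Sigma> = sigma UNIV G"
  have s\<Sigma>: "sets \<Sigma> = sigma_sets UNIV G" "space \<Sigma> = UNIV" by (auto simp: \<Sigma>_def)
  have Cm: "h \<in> borel_measurable \<Sigma>" if "h \<in> C" for h
    unfolding borel_measurable_iff_greater
  proof
    fix a :: real
    have "h -` {a<..} \<inter> space Q \<in> G" using that unfolding G_def by auto
    then show "{w \<in> space \<Sigma>. a < h w} \<in> sets \<Sigma>"
      unfolding s\<Sigma> by (intro sigma_sets.Basic) (auto simp: spQ vimage_def)
  qed
  have cnt: "(\<lambda>x. \<Sum>n. indicator {..<t} (x n) :: ennreal) \<in> borel_measurable \<Sigma>" for t :: real
  proof -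
    \<comment> \<open>Ramps in \<open>D\<close> that increase to the indicator of
      \<open>{..<t}\<close>. As \<open>neg_ln\<close> turns their functionals back into sums, the
      number of points below \<open>t\<close> is measurable for \<open>\<Sigma>\<close>.\<close>
    define f where "f m y = min 1 (real m * max 0 (t - y))" for m :: nat and y :: real
    have fD: "f m \<in> D" for m
      unfolding D_def f_def by (auto intro!: continuous_intros exI[of _ t])
    have "(\<lambda>x. exp_neg (\<Sum>n. ennreal (f m (x n)))) \<in> borel_measurable \<Sigma>" for m
      by (rule Cm) (use fD in \<open>auto simp: C_def\<close>)
    then have "(\<lambda>x. neg_ln (exp_neg (\<Sum>n. ennreal (f m (x n))))) \<in> borel_measurable \<Sigma>" for m
      by measurable
    then have [measurable]: "(\<lambda>x. (\<Sum>n. ennreal (f m (x n)))) \<in> borel_measurable \<Sigma>" for m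
      by (simp add: neg_ln_exp_neg)
    have finc: "incseq (\<lambda>m. ennreal (f m y))" for y
      unfolding incseq_def
    proof (intro allI impI ennreal_leI)
      fix m n :: nat assume "m \<le> n"
      then have "real m * max 0 (t - y) \<le> real n * max 0 (t - y)" by (intro mult_right_mono) auto
      then show "f m y \<le> f n y" unfolding f_def by (intro min.mono) auto
    qed
    have fSUP: "(SUP m. ennreal (f m y)) = indicator {..<t} y" for y
    proof (rule LIMSEQ_unique[OF LIMSEQ_SUP[OF finc]])
      show "(\<lambda>m. ennreal (f m y)) \<longlonglongrightarrow> indicator {..<t} y"
      proof (cases "y < t")
        case True
        obtain m :: nat where m: "1 \<le> real m * (t - y)"
          using True by (metis ex_less_of_nat_mult diff_gt_0_iff_gt less_imp_le)
        have "eventually (\<lambda>n. ennreal (f n y) = 1) sequentially"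
          using eventually_ge_at_top[of m]
        proof eventually_elim
          case (elim n)
          then have "real m * (t - y) \<le> real n * (t - y)" using True by (intro mult_right_mono) auto
          then have "1 \<le> real n * (t - y)" using m by linarith
          then show ?case using True by (simp add: f_def)
        qed
        then show ?thesis using True by (simp add: tendsto_eventually)
      qed (simp add: f_def)
    qed
    have "(\<Sum>n. indicator {..<t} (x n) :: ennreal) = (SUP m. \<Sum>n. ennreal (f m (x n)))" for x
      unfolding fSUP[symmetric] nn_integral_count_space_nat[symmetric] using finc
      by (intro nn_integral_monotone_convergence_SUP) (auto simp: incseq_def le_fun_def)
    then show ?thesis by simp
  qed
  have id: "(\<lambda>x. x) \<in> measurable (restrict_space \<Sigma> S) real_seq"
  proof (rule measurable_PiM_single')
    fix n :: nat
    show "(\<lambda>x. x n) \<in> borel_measurable (restrict_space \<Sigma> S)"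
      unfolding borel_measurable_iff_less
    proof
      fix t :: real
      define N where "N x = (\<Sum>n. indicator {..<t} (x n) :: ennreal)" for x :: "nat \<Rightarrow> real"
      have iff: "x n < t \<longleftrightarrow> of_nat (Suc n) \<le> N x" if "x \<in> S" for x
      proof
        assume "x n < t"
        then have "x i < t" if "i \<le> n" for i
          using \<open>x \<in> S\<close> that strict_mono_less_eq[of x i n] by (simp add: S_def)
        then have "of_nat (Suc n) = (\<Sum>i<Suc n. indicator {..<t} (x i) :: ennreal)" by simp
        also have "\<dots> \<le> N x" unfolding N_def by (rule sum_le_suminf) auto
        finally show "of_nat (Suc n) \<le> N x" .
      next
        assume N: "of_nat (Suc n) \<le> N x"
        show "x n < t"
        proof (rule ccontr)
          assume "\<not> x n < t"
          then have "\<not> x i < t" if "n \<le> i" for i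
            using \<open>x \<in> S\<close> that strict_mono_less_eq[of x n i] by (simp add: S_def)
          then have "N x = (\<Sum>i<n. indicator {..<t} (x i))"
            unfolding N_def by (intro suminf_finite) (auto simp: not_less)
          also have "\<dots> \<le> (\<Sum>i<n. 1)" by (intro sum_mono) (simp add: indicator_def)
          finally have "N x \<le> of_nat n" by simp
          with N have "(of_nat (Suc n) :: ennreal) \<le> of_nat n" by (rule order.trans)
          then show False by (simp only: of_nat_le_iff)
        qed
      qed
      have "{x \<in> space \<Sigma>. of_nat (Suc n) \<le> N x} \<in> sets \<Sigma>"
        using cnt[of t] unfolding N_def by measurable
      moreover have "{x \<in> space (restrict_space \<Sigma> S). x n < t} = {x \<in> space \<Sigma>. of_nat (Suc n) \<le> N x} \<inter> S"
        using iff by (auto simp: space_restrict_space s\<Sigma>)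
      ultimately show "{x \<in> space (restrict_space \<Sigma> S). x n < t} \<in> sets (restrict_space \<Sigma> S)"
        by (auto simp: sets_restrict_space)
    qed
  qed auto
  have "Q = R"
  proof (rule measure_eqI)
    show "sets Q = sets R" by (simp add: sQ sR)
    fix A assume A: "A \<in> sets Q"
    then have [measurable]: "A \<in> sets real_seq" by (simp add: sQ)
    have "(\<lambda>x. x) -` A \<inter> space (restrict_space \<Sigma> S) \<in> sets (restrict_space \<Sigma> S)"
      by (rule measurable_sets[OF id]) fact
    \<comment> \<open>Replaces \<open>A\<close> by a set of \<open>\<Sigma>\<close> with the same
      trace on \<open>S\<close>; on \<open>\<Sigma>\<close> the two laws agree.\<close>
    then obtain B where B: "B \<in> sets \<Sigma>" "A \<inter> S = B \<inter> S"
      by (auto simp: sets_restrict_space space_restrict_space s\<Sigma>)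
    have "sigma_sets (space Q) G \<subseteq> sets Q"
    proof (rule sets.sigma_sets_subset, safe)
      fix Z assume "Z \<in> G"
      then obtain f a where "f \<in> D" "Z = (\<lambda>x. exp_neg (\<Sum>n. ennreal (f (x n)))) -` {a<..} \<inter> space Q"
        by (auto simp: G_def C_def)
      then show "Z \<in> sets Q" using Dm[OF \<open>f \<in> D\<close>] by simp
    qed
    then have Bm: "B \<in> sets Q" using B(1) by (auto simp: s\<Sigma> spQ)
    have "emeasure Q A = emeasure Q B"
      using QS A Bm by (intro emeasure_eq_AE) (use B(2) in auto)
    also have "\<dots> = emeasure R B" using B by (intro agree) (simp add: s\<Sigma> spQ)
    also have "\<dots> = emeasure R A"
      using RS A Bm by (intro emeasure_eq_AE) (use B(2) sQ sR in auto)
    finally show "emeasure Q A = emeasure R A" .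
  qed
  then show ?thesis by (simp add: R_def X_def g_def)
qed

section \<open>Ratios to the largest jump, and the tilting\<close>

lemma AE_stable_intensity_pos: "AE x in stable_intensity \<sigma>. 0 < x"
  unfolding stable_intensity_def by (subst AE_density) (auto simp: indicator_def)

text \<open>If the first point is \<open>e\<close> and a later one is \<open>e + v\<close>, then
  \<open>u = (e + v) / e\<close> exceeds \<open>1\<close> and \<open>dv = e du\<close>. The inverse
  power sends \<open>u > 1\<close> to ratios in \<open>{0<..<1}\<close> with stable intensity; the
  factor \<open>e\<close> is the Jacobian and makes the ratio intensity proportional to the first
  point.\<close>

lemma scaled_jump_integral:
  assumes \<sigma>: "0 < \<sigma>" and e: "0 < e" and [measurable]: "k \<in> borel_measurable borel"
  shows "(\<integral>\<^sup>+v. k (((e + v) / e) powr (- (1 / \<sigma>))) * indicator {0<..} v \<partial>lborel) =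
    ennreal e * (\<integral>\<^sup>+x. k x * indicator {0<..<1} x \<partial>stable_intensity \<sigma>)"
proof -
  define g where "g u = k (u powr (- (1 / \<sigma>))) * indicator {1<..} u" for u
  have [measurable]: "g \<in> borel_measurable borel" unfolding g_def by measurable
  have "(\<integral>\<^sup>+x. k x * indicator {0<..<1} x \<partial>stable_intensity \<sigma>) = (\<integral>\<^sup>+x. g (x powr (- \<sigma>)) \<partial>stable_intensity \<sigma>)"
  proof (intro nn_integral_cong_AE eventually_mono[OF AE_stable_intensity_pos])
    fix x :: real assume x: "0 < x"
    have "1 < x powr (- \<sigma>) \<longleftrightarrow> x < 1"
      using powr_neg_le_iff[OF \<sigma> x, of 1] by (simp add: not_le[symmetric])
    then show "k x * indicator {0<..<1} x = g (x powr (- \<sigma>))"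
      using x \<sigma> by (simp add: g_def powr_powr indicator_def)
  qed
  also have "\<dots> = (\<integral>\<^sup>+u. g u * indicator {0<..} u \<partial>lborel)"
    by (rule nn_integral_stable_subst[OF \<sigma>]) measurable
  also have "\<dots> = (\<integral>\<^sup>+u. g u \<partial>lborel)"
    by (intro nn_integral_cong) (auto simp: g_def indicator_def)
  also have "\<dots> = \<bar>1 / e\<bar> * (\<integral>\<^sup>+v. g (1 + 1 / e * v) \<partial>lborel)"
    using e by (intro nn_integral_real_affine) auto
  also have "(\<integral>\<^sup>+v. g (1 + 1 / e * v) \<partial>lborel) =
      (\<integral>\<^sup>+v. k (((e + v) / e) powr (- (1 / \<sigma>))) * indicator {0<..} v \<partial>lborel)"
    using e by (intro nn_integral_cong) (auto simp: g_def indicator_def add_divide_distrib zero_less_divide_iff)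
  finally show ?thesis
    using e by (simp add: mult.assoc[symmetric] ennreal_mult'[symmetric])
qed

text \<open>In the coordinates \<open>y n = \<Delta> n powr (-\<sigma>)\<close> the ratios are \<open>((y 0 + v n) / y 0) powr (-1/\<sigma>)\<close>,
  where by the renewal property \<open>v\<close> is a copy of \<open>y\<close> that is independent of \<open>y 0\<close>.\<close>

lemma ranked_stable_ratio_integral:
  fixes f :: "real \<Rightarrow> ennreal"
  assumes L: "ranked_stable_law \<sigma> L" and \<sigma>: "0 < \<sigma>"
    and [measurable]: "f \<in> borel_measurable borel" and h[measurable]: "h \<in> borel_measurable borel"
  defines "\<Lambda> \<equiv> (\<integral>\<^sup>+x. ennreal (1 - exp_neg (f x)) * indicator {0<..<1} x \<partial>stable_intensity \<sigma>)"
  shows "(\<integral>\<^sup>+\<Delta>. h (\<Delta> 0) * ennreal (exp_neg (\<Sum>n. f (\<Delta> (Suc n) / \<Delta> 0))) \<partial>L) =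
    (\<integral>\<^sup>+y. ennreal (exp (- y)) * h (y powr (- (1 / \<sigma>))) * ennreal (exp_neg (ennreal y * \<Lambda>)) * indicator {0<..} y \<partial>lborel)"
proof -
  note LD = ranked_stable_lawD[OF L]
  interpret prob_space L by (rule LD)
  note [measurable_cong] = LD(2)
  have Ym[measurable]: "(\<lambda>\<Delta> n. \<Delta> n powr (- \<sigma>)) \<in> measurable L real_seq"
    by (rule measurable_PiM_single') auto
  define Q where "Q = unit_rate_law \<sigma> L"
  define X where "X = density lborel (exponential_density 1)"
  interpret Q: prob_space Q unfolding Q_def by (rule prob_space_unit_rate_law[OF L \<sigma>])
  have sQ[measurable_cong]: "sets Q = sets real_seq" unfolding Q_def by (rule sets_unit_rate_law[OF L \<sigma>])
  have sX[measurable_cong]: "sets X = sets borel" by (simp add: X_def)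
  define \<tau> where "\<tau> y = y powr (- (1 / \<sigma>))" for y :: real
  have [measurable]: "\<tau> \<in> borel_measurable borel" unfolding \<tau>_def by measurable
  define H where "H y = h (\<tau> (y 0)) * ennreal (exp_neg (\<Sum>n. f (\<tau> (y (Suc n) / y 0))))" for y :: "nat \<Rightarrow> real"
  have [measurable]: "H \<in> borel_measurable real_seq" unfolding H_def by measurable
  define g where "g = (\<lambda>(e::real, y::nat \<Rightarrow> real). case_nat e (\<lambda>n. e + y n))"
  have gm[measurable]: "g \<in> measurable (X \<Otimes>\<^sub>M Q) real_seq"
    unfolding g_def split_beta
  proof (rule measurable_case_nat')
    show "(\<lambda>x n. fst x + snd x n) \<in> measurable (X \<Otimes>\<^sub>M Q) real_seq"
      by (rule measurable_PiM_single') auto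
  qed measurable
  have "(\<integral>\<^sup>+\<Delta>. h (\<Delta> 0) * ennreal (exp_neg (\<Sum>n. f (\<Delta> (Suc n) / \<Delta> 0))) \<partial>L) = (\<integral>\<^sup>+\<Delta>. H (\<lambda>n. \<Delta> n powr (- \<sigma>)) \<partial>L)"
  proof (intro nn_integral_cong_AE eventually_mono[OF LD(4)])
    fix \<Delta> :: "nat \<Rightarrow> real" assume p: "\<forall>n. 0 < \<Delta> n"
    have "\<tau> (\<Delta> 0 powr (- \<sigma>)) = \<Delta> 0" using p[rule_format, of 0] \<sigma> by (simp add: \<tau>_def powr_powr)
    moreover have "\<tau> (\<Delta> (Suc n) powr (- \<sigma>) / \<Delta> 0 powr (- \<sigma>)) = \<Delta> (Suc n) / \<Delta> 0" for n
      using p[rule_format, of 0] p[rule_format, of "Suc n"] \<sigma>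
      by (simp add: \<tau>_def powr_divide[symmetric] powr_powr)
    ultimately show "h (\<Delta> 0) * ennreal (exp_neg (\<Sum>n. f (\<Delta> (Suc n) / \<Delta> 0))) = H (\<lambda>n. \<Delta> n powr (- \<sigma>))"
      by (simp add: H_def)
  qed
  also have "\<dots> = (\<integral>\<^sup>+y. H y \<partial>Q)"
    unfolding Q_def unit_rate_law_def by (rule nn_integral_distr[symmetric]) measurable
  also have "\<dots> = (\<integral>\<^sup>+y. H y \<partial>distr (X \<Otimes>\<^sub>M Q) real_seq g)"
    using unit_rate_law_renewal[OF L \<sigma>] by (simp add: Q_def X_def g_def)
  also have "\<dots> = (\<integral>\<^sup>+p. H (g p) \<partial>(X \<Otimes>\<^sub>M Q))"
    by (rule nn_integral_distr) measurable
  also have "\<dots> = (\<integral>\<^sup>+e. \<integral>\<^sup>+y. H (g (e, y)) \<partial>Q \<partial>X)"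
    by (rule Q.nn_integral_fst[symmetric]) measurable
  also have "\<dots> = (\<integral>\<^sup>+e. h (\<tau> e) * ennreal (exp_neg (ennreal e * \<Lambda>)) * indicator {0<..} e \<partial>X)"
  proof (rule nn_integral_cong_AE)
    have "AE e in X. 0 < e"
      unfolding X_def by (subst AE_density)
        (auto simp: exponential_density_def intro!: eventually_mono[OF AE_lborel_singleton[of 0]])
    then show "AE e in X. (\<integral>\<^sup>+y. H (g (e, y)) \<partial>Q) = h (\<tau> e) * ennreal (exp_neg (ennreal e * \<Lambda>)) * indicator {0<..} e"
    proof eventually_elim
      case (elim e)
      have "(\<integral>\<^sup>+y. H (g (e, y)) \<partial>Q) = h (\<tau> e) * (\<integral>\<^sup>+y. ennreal (exp_neg (\<Sum>n. f (\<tau> ((e + y n) / e)))) \<partial>Q)"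
        unfolding H_def g_def by (subst nn_integral_cmult[symmetric]) auto
      also have "(\<integral>\<^sup>+y. ennreal (exp_neg (\<Sum>n. f (\<tau> ((e + y n) / e)))) \<partial>Q) =
          ennreal (\<integral>y. exp_neg (\<Sum>n. f (\<tau> ((e + y n) / e))) \<partial>Q)"
        by (rule nn_integral_eq_integral) (auto intro!: Q.integrable_const_bound[where B=1])
      also have "(\<integral>y. exp_neg (\<Sum>n. f (\<tau> ((e + y n) / e))) \<partial>Q) =
          exp_neg (\<integral>\<^sup>+v. ennreal (1 - exp_neg (f (\<tau> ((e + v) / e)))) * indicator {0<..} v \<partial>lborel)"
        unfolding Q_def by (rule unit_rate_law_laplace[OF L \<sigma>, where f="\<lambda>v. f (\<tau> ((e + v) / e))"]) measurable
      also have "(\<integral>\<^sup>+v. ennreal (1 - exp_neg (f (\<tau> ((e + v) / e)))) * indicator {0<..} v \<partial>lborel) = ennreal e * \<Lambda>"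
        unfolding \<tau>_def \<Lambda>_def
        by (rule scaled_jump_integral[OF \<sigma> elim, where k="\<lambda>x. ennreal (1 - exp_neg (f x))"]) measurable
      finally show ?case using elim by simp
    qed
  qed
  also have "\<dots> = (\<integral>\<^sup>+y. ennreal (exp (- y)) * h (\<tau> y) * ennreal (exp_neg (ennreal y * \<Lambda>)) * indicator {0<..} y \<partial>lborel)"
    unfolding X_def by (subst nn_integral_density)
      (auto intro!: nn_integral_cong simp: exponential_density_def indicator_def mult.assoc)
  finally show ?thesis by (simp add: \<tau>_def)
qed

text \<open>Under \<open>y = t powr (-\<sigma>)\<close> the largest jump becomes a standard
  exponential variable, the first arrival time at unit rate.\<close>

lemma nn_integral_largest_jump:
  assumes \<sigma>: "0 < \<sigma>" and [measurable]: "k \<in> borel_measurable borel"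
  shows "(\<integral>\<^sup>+t. ennreal (largest_jump_density \<sigma> t) * k t \<partial>lborel) =
    (\<integral>\<^sup>+y. ennreal (exp (- y)) * k (y powr (- (1 / \<sigma>))) * indicator {0<..} y \<partial>lborel)"
proof -
  have "(\<integral>\<^sup>+t. ennreal (largest_jump_density \<sigma> t) * k t \<partial>lborel) =
      (\<integral>\<^sup>+t. ennreal (exp (- (t powr (- \<sigma>)))) * k t \<partial>stable_intensity \<sigma>)"
    unfolding stable_intensity_def using \<sigma>
    by (subst nn_integral_density)
      (auto intro!: nn_integral_cong simp: largest_jump_density_def indicator_def ennreal_mult' mult.assoc)
  also have "\<dots> = (\<integral>\<^sup>+t. ennreal (exp (- (t powr (- \<sigma>)))) * k ((t powr (- \<sigma>)) powr (- (1 / \<sigma>))) \<partial>stable_intensity \<sigma>)"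
    using \<sigma> by (intro nn_integral_cong_AE eventually_mono[OF AE_stable_intensity_pos]) (simp add: powr_powr)
  also have "\<dots> = (\<integral>\<^sup>+y. ennreal (exp (- y)) * k (y powr (- (1 / \<sigma>))) * indicator {0<..} y \<partial>lborel)"
    by (rule nn_integral_stable_subst[OF \<sigma>, where f="\<lambda>y. ennreal (exp (- y)) * k (y powr (- (1 / \<sigma>)))"]) measurable
  finally show ?thesis .
qed

text \<open>The Laplace transform at \<open>l\<close> of the gamma law with shape
  \<open>c + 1\<close> and rate \<open>\<beta>\<close>, by the substitution
  \<open>t = (\<beta> + l) * y\<close> in Euler's integral.\<close>

lemma gamma_mixture_laplace:
  fixes \<beta> c l :: real
  assumes "0 < \<beta>" "0 < c" "0 \<le> l"
  shows "(\<integral>\<^sup>+y. ennreal (\<beta> powr (c + 1) / Gamma (c + 1) * y powr c * exp (- (\<beta> * y))) * ennreal (exp (- (y * l))) * indicator {0<..} y \<partial>lborel)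
    = ennreal ((\<beta> / (\<beta> + l)) powr (c + 1))"
proof -
  define B where "B = \<beta> + l"
  have B: "0 < B" using assms by (simp add: B_def)
  have G: "0 < Gamma (c + 1)" using assms by (intro Gamma_real_pos) simp
  have "ennreal (Gamma (c + 1)) = (\<integral>\<^sup>+t. ennreal (indicator {0..} t * t powr c / exp t) \<partial>lborel)"
    using Gamma_conv_nn_integral_real[of "c + 1"] assms by simp
  also have "\<dots> = \<bar>B\<bar> * (\<integral>\<^sup>+y. ennreal (indicator {0..} (0 + B * y) * (0 + B * y) powr c / exp (0 + B * y)) \<partial>lborel)"
    using B by (intro nn_integral_real_affine) auto
  also have "\<dots> = (\<integral>\<^sup>+y. ennreal (B powr (c + 1)) * (ennreal (y powr c * exp (- (B * y))) * indicator {0<..} y) \<partial>lborel)"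
    using B assms by (subst nn_integral_cmult[symmetric])
      (auto intro!: nn_integral_cong simp: indicator_def zero_le_mult_iff powr_mult powr_add exp_minus
        ennreal_mult'[symmetric] field_simps)
  also have "\<dots> = ennreal (B powr (c + 1)) * (\<integral>\<^sup>+y. ennreal (y powr c * exp (- (B * y))) * indicator {0<..} y \<partial>lborel)"
    by (rule nn_integral_cmult) measurable
  finally have *: "ennreal (B powr (c + 1)) * (\<integral>\<^sup>+y. ennreal (y powr c * exp (- (B * y))) * indicator {0<..} y \<partial>lborel) = ennreal (Gamma (c + 1))" ..
  have "(\<integral>\<^sup>+y. ennreal (\<beta> powr (c + 1) / Gamma (c + 1) * y powr c * exp (- (\<beta> * y))) * ennreal (exp (- (y * l))) * indicator {0<..} y \<partial>lborel)
    = (\<integral>\<^sup>+y. ennreal (\<beta> powr (c + 1) / Gamma (c + 1)) * (ennreal (y powr c * exp (- (B * y))) * indicator {0<..} y) \<partial>lborel)"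
    using G assms by (intro nn_integral_cong)
      (auto simp: indicator_def ennreal_mult'[symmetric] B_def exp_add[symmetric] algebra_simps)
  also have "\<dots> = ennreal (\<beta> powr (c + 1) / Gamma (c + 1)) * (\<integral>\<^sup>+y. ennreal (y powr c * exp (- (B * y))) * indicator {0<..} y \<partial>lborel)"
    by (rule nn_integral_cmult) measurable
  also have "ennreal (\<beta> powr (c + 1) / Gamma (c + 1)) =
      ennreal (\<beta> powr (c + 1) / (Gamma (c + 1) * B powr (c + 1))) * ennreal (B powr (c + 1))"
    using B G by (subst ennreal_mult[symmetric]) auto
  also have "\<dots> * (\<integral>\<^sup>+y. ennreal (y powr c * exp (- (B * y))) * indicator {0<..} y \<partial>lborel) =
      ennreal (\<beta> powr (c + 1) / (Gamma (c + 1) * B powr (c + 1))) * ennreal (Gamma (c + 1))"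
    by (simp add: mult.assoc *)
  also have "\<dots> = ennreal ((\<beta> / (\<beta> + l)) powr (c + 1))"
  proof -
    have "\<beta> powr (c + 1) / (\<gamma> * B powr (c + 1)) * \<gamma> = (\<beta> / (\<beta> + l)) powr (c + 1)" if "0 < \<gamma>" for \<gamma>
      using that B assms by (simp add: powr_divide B_def)
    from this[OF G] show ?thesis
      using G by (simp add: ennreal_mult''[symmetric] less_imp_le)
  qed
  finally show ?thesis .
qed

text \<open>The kernel \<open>G\<close> is known only through its mixture with the law of
  \<open>\<Delta> 0\<close>. The tilt is a function of \<open>\<Delta> 0\<close> alone, so it can be
  pulled back to the law \<open>L\<close> as the weight \<open>h (\<Delta> 0)\<close>, where the
  ratio formula applies; the remaining integral over \<open>y\<close> is the gamma
  transform.\<close>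

lemma SBSP_weights_laplace:
  fixes f :: "real \<Rightarrow> ennreal"
  assumes G: "jump_ratio_kernel \<sigma> G" and \<sigma>: "0 < \<sigma>" and \<beta>: "0 < \<beta>" and c: "0 < c"
    and [measurable]: "f \<in> borel_measurable borel"
    and l: "(\<integral>\<^sup>+x. ennreal (1 - exp_neg (f x)) * indicator {0<..<1} x \<partial>stable_intensity \<sigma>) = ennreal l" "0 \<le> l"
  shows "(\<integral>\<^sup>+\<theta>. ennreal (exp_neg (\<Sum>n. f (\<theta> n))) \<partial>(tilted_largest_jump \<beta> \<sigma> c \<bind> G)) =
    ennreal ((\<beta> / (\<beta> + l)) powr (c + 1))"
proof -
  obtain L where Gm: "G \<in> measurable borel (prob_algebra real_seq)"
    and L: "ranked_stable_law \<sigma> L"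
    and dis: "distr L (borel \<Otimes>\<^sub>M real_seq) (\<lambda>\<Delta>. (\<Delta> 0, \<lambda>n. \<Delta> (Suc n) / \<Delta> 0)) =
        distr L borel (\<lambda>\<Delta>. \<Delta> 0) \<bind> (\<lambda>t. distr (G t) (borel \<Otimes>\<^sub>M real_seq) (\<lambda>\<theta>. (t, \<theta>)))"
    using G by (auto simp: jump_ratio_kernel_def)
  note LD = ranked_stable_lawD[OF L]
  interpret prob_space L by (rule LD)
  note [measurable_cong] = LD(2)
  have rm[measurable]: "(\<lambda>\<Delta>. (\<Delta> 0, \<lambda>n. \<Delta> (Suc n) / \<Delta> 0)) \<in> measurable L (borel \<Otimes>\<^sub>M real_seq)"
  proof (rule measurable_Pair)
    show "(\<lambda>\<Delta>. \<lambda>n. \<Delta> (Suc n) / \<Delta> 0) \<in> measurable L real_seq"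
      by (rule measurable_PiM_single') auto
  qed measurable
  have Gs[measurable]: "G \<in> measurable borel (subprob_algebra real_seq)"
    by (rule measurable_prob_algebraD) fact
  have sG: "sets (G t) = sets real_seq" for t
    using measurable_space[OF Gm, of t] by (simp add: space_prob_algebra)
  define \<phi> where "\<phi> \<theta> = ennreal (exp_neg (\<Sum>n. f (\<theta> n)))" for \<theta> :: "nat \<Rightarrow> real"
  have \<phi>m[measurable]: "\<phi> \<in> borel_measurable real_seq" unfolding \<phi>_def by measurable
  define \<Phi> where "\<Phi> t = (\<integral>\<^sup>+\<theta>. \<phi> \<theta> \<partial>G t)" for t
  have [measurable]: "\<Phi> \<in> borel_measurable borel" unfolding \<Phi>_def by measurable
  define \<Lambda> where "\<Lambda> = (\<integral>\<^sup>+x. ennreal (1 - exp_neg (f x)) * indicator {0<..<1} x \<partial>stable_intensity \<sigma>)"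
  define h where "h t = ennreal (jump_tilt \<beta> \<sigma> c t)" for t
  have [measurable]: "jump_tilt \<beta> \<sigma> c \<in> borel_measurable borel"
    unfolding jump_tilt_def[abs_def] by measurable
  have [measurable]: "largest_jump_density \<sigma> \<in> borel_measurable borel"
    unfolding largest_jump_density_def[abs_def] by measurable
  have [measurable]: "h \<in> borel_measurable borel" unfolding h_def by measurable
  have tilt0: "0 \<le> jump_tilt \<beta> \<sigma> c t" for t
    using c by (auto simp: jump_tilt_def intro!: mult_nonneg_nonneg divide_nonneg_nonneg Gamma_real_nonneg)
  have pm: "(\<lambda>\<theta>. (t, \<theta>)) \<in> measurable (G t) (borel \<Otimes>\<^sub>M real_seq)" for t
  proof -
    have [measurable_cong]: "sets (G t) = sets real_seq" by (rule sG)
    show ?thesis by measurable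
  qed
  have km[measurable]: "(\<lambda>t. distr (G t) (borel \<Otimes>\<^sub>M real_seq) (\<lambda>\<theta>. (t, \<theta>))) \<in>
      measurable borel (subprob_algebra (borel \<Otimes>\<^sub>M real_seq))"
    by (rule measurable_distr2[OF _ Gs]) simp
  have L_formula: "(\<integral>\<^sup>+t. k t * \<Phi> t \<partial>distr L borel (\<lambda>\<Delta>. \<Delta> 0)) = (\<integral>\<^sup>+\<Delta>. k (\<Delta> 0) * \<phi> (\<lambda>n. \<Delta> (Suc n) / \<Delta> 0) \<partial>L)"
    if [measurable]: "k \<in> borel_measurable borel" for k :: "real \<Rightarrow> ennreal"
  proof -
    have "(\<integral>\<^sup>+\<Delta>. k (\<Delta> 0) * \<phi> (\<lambda>n. \<Delta> (Suc n) / \<Delta> 0) \<partial>L) =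
      (\<integral>\<^sup>+p. k (fst p) * \<phi> (snd p) \<partial>distr L (borel \<Otimes>\<^sub>M real_seq) (\<lambda>\<Delta>. (\<Delta> 0, \<lambda>n. \<Delta> (Suc n) / \<Delta> 0)))"
      by (subst nn_integral_distr) auto
    also have "\<dots> = (\<integral>\<^sup>+t. \<integral>\<^sup>+p. k (fst p) * \<phi> (snd p) \<partial>distr (G t) (borel \<Otimes>\<^sub>M real_seq) (\<lambda>\<theta>. (t, \<theta>)) \<partial>distr L borel (\<lambda>\<Delta>. \<Delta> 0))"
      unfolding dis
    proof (rule nn_integral_bind[where B="borel \<Otimes>\<^sub>M real_seq"])
      show "(\<lambda>t. distr (G t) (borel \<Otimes>\<^sub>M real_seq) (\<lambda>\<theta>. (t, \<theta>))) \<in>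
          measurable (distr L borel (\<lambda>\<Delta>. \<Delta> 0)) (subprob_algebra (borel \<Otimes>\<^sub>M real_seq))"
        using km by (simp cong: measurable_cong_sets)
    qed measurable
    also have "\<dots> = (\<integral>\<^sup>+t. k t * \<Phi> t \<partial>distr L borel (\<lambda>\<Delta>. \<Delta> 0))"
    proof (rule nn_integral_cong)
      fix t :: real
      have [measurable_cong]: "sets (G t) = sets real_seq" by (rule sG)
      show "(\<integral>\<^sup>+p. k (fst p) * \<phi> (snd p) \<partial>distr (G t) (borel \<Otimes>\<^sub>M real_seq) (\<lambda>\<theta>. (t, \<theta>))) = k t * \<Phi> t"
        unfolding \<Phi>_def by (subst nn_integral_distr[OF pm]) (auto simp: nn_integral_cmult)
    qed
    finally show ?thesis ..
  qed
  \<comment> \<open>The ratio formula with \<open>f = 0\<close> shows that \<open>\<Delta> 0\<close>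
    has density \<open>largest_jump_density \<sigma>\<close>.\<close>
  have law0: "(\<integral>\<^sup>+t. k t \<partial>distr L borel (\<lambda>\<Delta>. \<Delta> 0)) = (\<integral>\<^sup>+t. ennreal (largest_jump_density \<sigma> t) * k t \<partial>lborel)"
    if [measurable]: "k \<in> borel_measurable borel" for k :: "real \<Rightarrow> ennreal"
  proof -
    have "(\<integral>\<^sup>+t. k t \<partial>distr L borel (\<lambda>\<Delta>. \<Delta> 0)) = (\<integral>\<^sup>+\<Delta>. k (\<Delta> 0) \<partial>L)"
      by (rule nn_integral_distr) auto
    also have "\<dots> = (\<integral>\<^sup>+y. ennreal (exp (- y)) * k (y powr (- (1 / \<sigma>))) * indicator {0<..} y \<partial>lborel)"
      using ranked_stable_ratio_integral[OF L \<sigma>, of "\<lambda>_. 0" k] by simp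
    finally show ?thesis by (simp add: nn_integral_largest_jump[OF \<sigma>])
  qed
  have "(\<integral>\<^sup>+\<theta>. \<phi> \<theta> \<partial>(tilted_largest_jump \<beta> \<sigma> c \<bind> G)) = (\<integral>\<^sup>+t. \<Phi> t \<partial>tilted_largest_jump \<beta> \<sigma> c)"
    unfolding \<Phi>_def by (rule nn_integral_bind[where B=real_seq]) (auto simp: tilted_largest_jump_def)
  also have "\<dots> = (\<integral>\<^sup>+t. ennreal (largest_jump_density \<sigma> t) * (h t * \<Phi> t) \<partial>lborel)"
    unfolding tilted_largest_jump_def h_def
    by (subst nn_integral_density) (auto intro!: nn_integral_cong simp: ennreal_mult'' tilt0 mult_ac)
  also have "\<dots> = (\<integral>\<^sup>+t. h t * \<Phi> t \<partial>distr L borel (\<lambda>\<Delta>. \<Delta> 0))"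
    by (rule law0[symmetric]) measurable
  also have "\<dots> = (\<integral>\<^sup>+\<Delta>. h (\<Delta> 0) * ennreal (exp_neg (\<Sum>n. f (\<Delta> (Suc n) / \<Delta> 0))) \<partial>L)"
    unfolding \<phi>_def[symmetric] by (rule L_formula) measurable
  also have "\<dots> = (\<integral>\<^sup>+y. ennreal (exp (- y)) * h (y powr (- (1 / \<sigma>))) * ennreal (exp_neg (ennreal y * \<Lambda>)) * indicator {0<..} y \<partial>lborel)"
    unfolding \<Lambda>_def by (rule ranked_stable_ratio_integral[OF L \<sigma>]) measurable
  also have "\<dots> = (\<integral>\<^sup>+y. ennreal (\<beta> powr (c + 1) / Gamma (c + 1) * y powr c * exp (- (\<beta> * y))) * ennreal (exp (- (y * l))) * indicator {0<..} y \<partial>lborel)"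
  proof (rule nn_integral_cong)
    fix y :: real
    show "ennreal (exp (- y)) * h (y powr (- (1 / \<sigma>))) * ennreal (exp_neg (ennreal y * \<Lambda>)) * indicator {0<..} y =
      ennreal (\<beta> powr (c + 1) / Gamma (c + 1) * y powr c * exp (- (\<beta> * y))) * ennreal (exp (- (y * l))) * indicator {0<..} y"
    proof (cases "0 < y")
      case True
      \<comment> \<open>In the coordinate \<open>y\<close>, the power
        \<open>s powr (- c * \<sigma>)\<close> becomes \<open>y powr c\<close>, and
        \<open>exp (- (\<beta> - 1) * y)\<close> completes \<open>exp (- y)\<close> to
        \<open>exp (- (\<beta> * y))\<close>: this is how the tilt makes \<open>y\<close> gamma
        distributed.\<close>
      have "exp (- y) * jump_tilt \<beta> \<sigma> c (y powr (- (1 / \<sigma>))) =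
          \<beta> powr (c + 1) / Gamma (c + 1) * y powr c * (exp (- y) * exp (- (\<beta> - 1) * y))"
        using True \<sigma> by (simp add: jump_tilt_def powr_powr mult_ac)
      also have "exp (- y) * exp (- (\<beta> - 1) * y) = exp (- (\<beta> * y))"
        by (simp add: exp_add[symmetric] algebra_simps)
      finally have "ennreal (exp (- y)) * h (y powr (- (1 / \<sigma>))) =
          ennreal (\<beta> powr (c + 1) / Gamma (c + 1) * y powr c * exp (- (\<beta> * y)))"
        by (simp add: h_def ennreal_mult'[symmetric])
      moreover have "exp_neg (ennreal y * \<Lambda>) = exp (- (y * l))"
        using True l by (simp add: \<Lambda>_def ennreal_mult'[symmetric] exp_neg_ennreal)
      ultimately show ?thesis by simp
    qed simp
  qed
  also have "\<dots> = ennreal ((\<beta> / (\<beta> + l)) powr (c + 1))"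
    by (rule gamma_mixture_laplace[OF \<beta> c l(2)])
  finally show ?thesis by (simp add: \<phi>_def)
qed

subsection \<open>Negative binomial counts given the weights\<close>

abbreviation count_col :: "(nat \<Rightarrow> nat) measure" where
  "count_col \<equiv> \<Pi>\<^sub>M d\<in>UNIV. count_space UNIV"

definition col_law :: "real \<Rightarrow> real \<Rightarrow> (nat \<Rightarrow> nat) measure" where
  "col_law r p = (\<Pi>\<^sub>M d\<in>UNIV. measure_pmf (negbin_pmf r p))"

definition array_law :: "real \<Rightarrow> (nat \<Rightarrow> real) \<Rightarrow> (nat \<times> nat \<Rightarrow> nat) measure" where
  "array_law r x = (\<Pi>\<^sub>M (d, n)\<in>UNIV. measure_pmf (negbin_pmf r (x n)))"

abbreviation label_law :: "real measure" where
  "label_law \<equiv> uniform_measure lborel {0..1}"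

lemma prob_space_label_law: "prob_space label_law"
  by (rule prob_space_uniform_measure) auto

lemma prob_space_col_law: "prob_space (col_law r p)"
  unfolding col_law_def by (intro prob_space_PiM prob_space_measure_pmf)

lemma sets_col_law[measurable_cong, simp]: "sets (col_law r p) = sets count_col"
  unfolding col_law_def by (intro sets_PiM_cong) auto

lemma sets_array_law[measurable_cong, simp]: "sets (array_law r x) = sets count_array"
  unfolding array_law_def by (intro sets_PiM_cong) auto

lemma pmf_negbin_measurable[measurable]: "(\<lambda>p. pmf (negbin_pmf r p) k) \<in> borel_measurable borel"
proof -
  have "pmf (negbin_pmf r p) k =
     (if 0 < r \<and> 0 < p \<and> p < 1 then ((real k + r - 1) gchoose k) * p ^ k * (1 - p) powr r
      else indicator {0} k)" for p
    using pmf_negbin[of r p k] by (auto simp: negbin_pmf_def indicator_def)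
  then show ?thesis by simp
qed

lemma negbin_kernel[measurable]:
  "(\<lambda>p. measure_pmf (negbin_pmf r p)) \<in> measurable borel (prob_algebra (count_space UNIV))"
proof (rule measurable_prob_algebra_generated[where \<Omega>=UNIV and G=UNIV])
  show "sets (count_space UNIV) = sigma_sets UNIV (UNIV :: nat set set)"
    by (auto intro: sigma_sets.Basic)
  show "(\<lambda>p. emeasure (measure_pmf (negbin_pmf r p)) A) \<in> borel_measurable borel" for A
  proof -
    have "emeasure (measure_pmf (negbin_pmf r p)) A = (\<Sum>k. ennreal (pmf (negbin_pmf r p) k) * indicator A k)" for p
      by (simp add: nn_integral_indicator[symmetric] nn_integral_measure_pmf nn_integral_count_space_nat
          del: nn_integral_indicator)
    then show ?thesis by simp
  qed
qed (auto simp: Int_stable_def prob_space_measure_pmf)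

text \<open>Cylinders generate the product algebra and are stable under intersection; on a cylinder
  the measure is a finite product of measurable functions.\<close>

lemma PiM_pmf_kernel:
  fixes K :: "'a \<Rightarrow> 'i \<Rightarrow> nat pmf"
  assumes K: "\<And>i. (\<lambda>x. measure_pmf (K x i)) \<in> measurable M (prob_algebra (count_space UNIV))"
  shows "(\<lambda>x. \<Pi>\<^sub>M i\<in>I. measure_pmf (K x i)) \<in> measurable M (prob_algebra (\<Pi>\<^sub>M i\<in>I. count_space UNIV))"
proof (rule measurable_prob_algebra_generated[OF sets_PiM Int_stable_prod_algebra prod_algebra_sets_into_space])
  fix A assume "A \<in> prod_algebra I (\<lambda>_. count_space (UNIV :: nat set))"
  from prod_algebraE[OF this] obtain J E where A:
    "A = prod_emb I (\<lambda>_. count_space UNIV) J (Pi\<^sub>E J E)" "finite J" "J \<subseteq> I" by metis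
  have "emeasure (\<Pi>\<^sub>M i\<in>I. measure_pmf (K x i)) A = (\<Prod>i\<in>J. emeasure (measure_pmf (K x i)) (E i))" for x
  proof -
    interpret product_prob_space "\<lambda>i. measure_pmf (K x i)" I
      by (simp add: product_prob_space_def product_prob_space_axioms_def product_sigma_finite_def
          prob_space_measure_pmf prob_space_imp_sigma_finite)
    have "A = prod_emb I (\<lambda>i. measure_pmf (K x i)) J (Pi\<^sub>E J E)"
      unfolding A by (simp add: prod_emb_def)
    then show ?thesis using A by (simp add: emeasure_PiM_emb)
  qed
  moreover have "(\<lambda>x. emeasure (measure_pmf (K x i)) (E i)) \<in> borel_measurable M" for i
    by (rule measurable_compose[OF measurable_prob_algebraD[OF K] measurable_emeasure_subprob_algebra]) simp
  ultimately show "(\<lambda>x. emeasure (\<Pi>\<^sub>M i\<in>I. measure_pmf (K x i)) A) \<in> borel_measurable M" by simp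
qed (auto intro!: prob_space_PiM prob_space_measure_pmf sets_PiM_cong)

lemma col_law_kernel[measurable]: "col_law r \<in> measurable borel (prob_algebra count_col)"
  unfolding col_law_def[abs_def] by (rule PiM_pmf_kernel) measurable

lemma array_law_kernel[measurable]: "array_law r \<in> measurable real_seq (prob_algebra count_array)"
proof -
  have "array_law r = (\<lambda>x. \<Pi>\<^sub>M i\<in>UNIV. measure_pmf (negbin_pmf r (x (snd i))))"
    by (simp add: array_law_def fun_eq_iff split_beta')
  then show ?thesis by (simp add: PiM_pmf_kernel)
qed

lemma PiM_prod_nn_integral:
  assumes M: "\<And>i. i \<in> I \<Longrightarrow> prob_space (M i)" and J: "finite J" "J \<subseteq> I"
    and f: "\<And>i. i \<in> J \<Longrightarrow> f i \<in> borel_measurable (M i)"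
  shows "(\<integral>\<^sup>+\<omega>. (\<Prod>i\<in>J. f i (\<omega> i)) \<partial>PiM I M) = (\<Prod>i\<in>J. \<integral>\<^sup>+x. f i x \<partial>M i)"
proof -
  \<comment> \<open>\<open>product_prob_space\<close> asks for a probability space at every index,
    also outside \<open>I\<close>; a one-point space fills the gap.\<close>
  let ?M = "\<lambda>i. if i \<in> I then M i else count_space {undefined}"
  interpret M': prob_space "?M i" for i
    using M by (cases "i \<in> I") (auto intro!: prob_spaceI)
  interpret product_prob_space ?M I by unfold_locales
  have [measurable]: "f i \<in> borel_measurable (?M i)" if "i \<in> J" for i using f J that by auto
  have I: "PiM I M = PiM I ?M" by (intro PiM_cong) auto
  have "(\<integral>\<^sup>+\<omega>. (\<Prod>i\<in>J. f i (\<omega> i)) \<partial>PiM I ?M) = (\<integral>\<^sup>+\<omega>. (\<Prod>i\<in>J. f i (restrict \<omega> J i)) \<partial>PiM I ?M)"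
    by (intro nn_integral_cong prod.cong) auto
  also have "\<dots> = (\<integral>\<^sup>+\<omega>. (\<Prod>i\<in>J. f i (\<omega> i)) \<partial>distr (PiM I ?M) (PiM J ?M) (\<lambda>x. restrict x J))"
    using J by (subst nn_integral_distr) (auto intro!: measurable_restrict_subset borel_measurable_prod)
  also have "\<dots> = (\<integral>\<^sup>+\<omega>. (\<Prod>i\<in>J. f i (\<omega> i)) \<partial>PiM J ?M)"
    using J by (simp add: distr_PiM_restrict_finite)
  also have "\<dots> = (\<Prod>i\<in>J. \<integral>\<^sup>+x. f i x \<partial>?M i)"
    using J by (intro product_nn_integral_prod) auto
  also have "\<dots> = (\<Prod>i\<in>J. \<integral>\<^sup>+x. f i x \<partial>M i)"
    using J by (intro prod.cong) auto
  finally show ?thesis unfolding I .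
qed

text \<open>Regroups the independent entries of the array by units, so that each unit carries its
  own independent column. The two laws agree on finite cylinders, where the product over pairs is
  arranged by columns.\<close>

lemma array_law_columns:
  "array_law r x = distr (\<Pi>\<^sub>M n\<in>UNIV. col_law r (x n)) count_array (\<lambda>z (d, n). z n d)"
proof -
  define B where "B = (\<lambda>i :: nat \<times> nat. measure_pmf (negbin_pmf r (x (snd i))))"
  interpret B: product_prob_space B UNIV
    by (simp add: B_def product_prob_space_def product_prob_space_axioms_def product_sigma_finite_def
        prob_space_measure_pmf prob_space_imp_sigma_finite)
  interpret C: product_prob_space "\<lambda>n. col_law r (x n)" UNIV
    by (simp add: product_prob_space_def product_prob_space_axioms_def product_sigma_finite_def
        prob_space_col_law prob_space_imp_sigma_finite)
  have arr: "array_law r x = PiM UNIV B" by (simp add: array_law_def B_def split_beta')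
  have sB: "sets (PiM UNIV B) = sets count_array" unfolding B_def by (intro sets_PiM_cong) auto
  have m: "(\<lambda>z (d, n). z n d) \<in> measurable (\<Pi>\<^sub>M n\<in>UNIV. col_law r (x n)) count_array"
  proof (rule measurable_PiM_single')
    fix i :: "nat \<times> nat"
    have "(\<lambda>z. z (snd i)) \<in> measurable (\<Pi>\<^sub>M n\<in>UNIV. col_law r (x n)) (col_law r (x (snd i)))"
      by (rule measurable_component_singleton) simp
    then have "(\<lambda>z. z (snd i)) \<in> measurable (\<Pi>\<^sub>M n\<in>UNIV. col_law r (x n)) count_col"
      by (simp cong: measurable_cong_sets)
    then show "(\<lambda>z. case i of (d, n) \<Rightarrow> z n d) \<in> measurable (\<Pi>\<^sub>M n\<in>UNIV. col_law r (x n)) (count_space UNIV)"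
      unfolding split_beta by (rule measurable_compose[OF _ measurable_component_singleton]) simp
  qed (auto simp: space_PiM)
  have "distr (\<Pi>\<^sub>M n\<in>UNIV. col_law r (x n)) count_array (\<lambda>z (d, n). z n d) = PiM UNIV B"
  proof (rule B.PiM_eq)
    fix J :: "(nat \<times> nat) set" and F assume J: "finite J"
    define N where "N = snd ` J"
    define D where "D n = {d. (d, n) \<in> J}" for n
    have fD: "finite (D n)" for n using finite_vimageI[OF J, of "\<lambda>d. (d, n)"] by (simp add: D_def inj_on_def vimage_def)
    have fN: "finite N" using J by (simp add: N_def)
    define E where "E n = {b \<in> space (col_law r (x n)). \<forall>d\<in>D n. b d \<in> F (d, n)}" for n
    have Es: "E n \<in> sets (col_law r (x n))" for n
      unfolding E_def col_law_def using fD[of n] by measurable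
    have "emeasure (distr (\<Pi>\<^sub>M n\<in>UNIV. col_law r (x n)) count_array (\<lambda>z (d, n). z n d)) (prod_emb UNIV B J (Pi\<^sub>E J F))
      = emeasure (\<Pi>\<^sub>M n\<in>UNIV. col_law r (x n)) {z \<in> space (\<Pi>\<^sub>M n\<in>UNIV. col_law r (x n)). \<forall>n\<in>N. z n \<in> E n}"
    proof (subst emeasure_distr[OF m])
      show "prod_emb UNIV B J (Pi\<^sub>E J F) \<in> sets count_array"
        unfolding sB[symmetric] using J by (intro sets_PiM_I) (auto simp: B_def)
      have "(\<lambda>z (d, n). z n d) -` prod_emb UNIV B J (Pi\<^sub>E J F) \<inter> space (\<Pi>\<^sub>M n\<in>UNIV. col_law r (x n)) =
          {z \<in> space (\<Pi>\<^sub>M n\<in>UNIV. col_law r (x n)). \<forall>n\<in>N. z n \<in> E n}"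
        by (auto simp: prod_emb_def space_PiM B_def E_def N_def D_def col_law_def PiE_iff restrict_def extensional_def
            split: prod.splits) force+
      then show "emeasure (\<Pi>\<^sub>M n\<in>UNIV. col_law r (x n)) ((\<lambda>z (d, n). z n d) -` prod_emb UNIV B J (Pi\<^sub>E J F) \<inter> space (\<Pi>\<^sub>M n\<in>UNIV. col_law r (x n))) =
          emeasure (\<Pi>\<^sub>M n\<in>UNIV. col_law r (x n)) {z \<in> space (\<Pi>\<^sub>M n\<in>UNIV. col_law r (x n)). \<forall>n\<in>N. z n \<in> E n}" by simp
    qed
    also have "\<dots> = (\<Prod>n\<in>N. emeasure (col_law r (x n)) (E n))"
      using fN Es by (intro C.emeasure_PiM_Collect) auto
    also have "\<dots> = (\<Prod>n\<in>N. \<Prod>d\<in>D n. emeasure (measure_pmf (negbin_pmf r (x n))) (F (d, n)))"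
    proof (rule prod.cong[OF refl])
      fix n
      interpret P: product_prob_space "\<lambda>d::nat. measure_pmf (negbin_pmf r (x n))" UNIV
        by (simp add: product_prob_space_def product_prob_space_axioms_def product_sigma_finite_def
            prob_space_measure_pmf prob_space_imp_sigma_finite)
      show "emeasure (col_law r (x n)) (E n) = (\<Prod>d\<in>D n. emeasure (measure_pmf (negbin_pmf r (x n))) (F (d, n)))"
        unfolding E_def col_law_def using fD by (intro P.emeasure_PiM_Collect) auto
    qed
    also have "\<dots> = (\<Prod>(n, d)\<in>Sigma N D. emeasure (B (d, n)) (F (d, n)))"
      using fN fD by (subst prod.Sigma) (auto simp: B_def)
    also have "\<dots> = (\<Prod>j\<in>J. emeasure (B j) (F j))"
      by (rule prod.reindex_bij_witness[of _ "\<lambda>(d, n). (n, d)" "\<lambda>(n, d). (d, n)"])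
        (auto simp: N_def D_def image_iff, force+)
    finally show "emeasure (distr (\<Pi>\<^sub>M n\<in>UNIV. col_law r (x n)) count_array (\<lambda>z (d, n). z n d)) (prod_emb UNIV B J (Pi\<^sub>E J F))
      = (\<Prod>j\<in>J. emeasure (B j) (F j))" .
  qed (simp add: sB)
  then show ?thesis by (simp add: arr)
qed

text \<open>\<open>levy_integral\<close> integrates against the intensity, at unit mixing rate, of the marks
  (label, column of daily counts) of the units.\<close>

definition unit_integral :: "real \<Rightarrow> (real \<times> (nat \<Rightarrow> nat) \<Rightarrow> ennreal) \<Rightarrow> real \<Rightarrow> ennreal" where
  "unit_integral r k p = (\<integral>\<^sup>+u. \<integral>\<^sup>+b. k (u, b) \<partial>col_law r p \<partial>label_law)"

definition levy_integral :: "real \<Rightarrow> real \<Rightarrow> (real \<times> (nat \<Rightarrow> nat) \<Rightarrow> ennreal) \<Rightarrow> ennreal" where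
  "levy_integral \<sigma> r k = (\<integral>\<^sup>+p. unit_integral r k p * indicator {0<..<1} p \<partial>stable_intensity \<sigma>)"

lemma unit_integral_measurable[measurable]:
  assumes k[measurable]: "k \<in> borel_measurable (borel \<Otimes>\<^sub>M count_col)"
  shows "unit_integral r k \<in> borel_measurable borel"
proof -
  interpret prob_space label_law by (rule prob_space_label_law)
  have [measurable]: "col_law r \<in> measurable borel (subprob_algebra count_col)"
    by (rule measurable_prob_algebraD) measurable
  have "(\<lambda>q :: real \<times> real. \<integral>\<^sup>+b. k (snd q, b) \<partial>col_law r (fst q)) \<in> borel_measurable (borel \<Otimes>\<^sub>M borel)"
    by (rule nn_integral_measurable_subprob_algebra2[where N=count_col]) measurable
  then have "(\<lambda>q :: real \<times> real. \<integral>\<^sup>+b. k (snd q, b) \<partial>col_law r (fst q)) \<in> borel_measurable (borel \<Otimes>\<^sub>M label_law)"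
    by (simp cong: measurable_cong_sets)
  from borel_measurable_nn_integral_fst[OF this] show ?thesis unfolding unit_integral_def[abs_def] by simp
qed

lemma unit_integral_inner_measurable[measurable]:
  assumes k[measurable]: "k \<in> borel_measurable (borel \<Otimes>\<^sub>M count_col)"
  shows "(\<lambda>u. \<integral>\<^sup>+b. k (u, b) \<partial>col_law r p) \<in> borel_measurable borel"
proof -
  interpret prob_space "col_law r p" by (rule prob_space_col_law)
  show ?thesis by measurable
qed

lemma unit_integral_le_1:
  assumes "\<And>z. k z \<le> 1" shows "unit_integral r k p \<le> 1"
proof -
  interpret U: prob_space label_law by (rule prob_space_label_law)
  interpret C: prob_space "col_law r p" by (rule prob_space_col_law)
  have "unit_integral r k p \<le> (\<integral>\<^sup>+u. \<integral>\<^sup>+b. 1 \<partial>col_law r p \<partial>label_law)"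
    unfolding unit_integral_def by (intro nn_integral_mono assms)
  then show ?thesis by (simp add: C.emeasure_space_1 U.emeasure_space_1)
qed

lemma unit_integral_add:
  assumes [measurable]: "k \<in> borel_measurable (borel \<Otimes>\<^sub>M count_col)" "k' \<in> borel_measurable (borel \<Otimes>\<^sub>M count_col)"
  shows "unit_integral r (\<lambda>z. k z + k' z) p = unit_integral r k p + unit_integral r k' p"
proof -
  have "unit_integral r (\<lambda>z. k z + k' z) p = (\<integral>\<^sup>+u. (\<integral>\<^sup>+b. k (u, b) \<partial>col_law r p) + (\<integral>\<^sup>+b. k' (u, b) \<partial>col_law r p) \<partial>label_law)"
    unfolding unit_integral_def by (intro nn_integral_cong nn_integral_add) auto
  also have "\<dots> = unit_integral r k p + unit_integral r k' p"
    unfolding unit_integral_def by (rule nn_integral_add) auto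
  finally show ?thesis .
qed

lemma unit_integral_const: "unit_integral r (\<lambda>_. c) p = c"
proof -
  interpret U: prob_space label_law by (rule prob_space_label_law)
  interpret C: prob_space "col_law r p" by (rule prob_space_col_law)
  show ?thesis by (simp add: unit_integral_def C.emeasure_space_1 U.emeasure_space_1)
qed

text \<open>Given the weights, labels and columns are independent across units, so the expectation
  is an infinite product of unit integrals. It is rewritten as \<open>exp_neg\<close> of a sum over
  the weights, the form in which \<open>SBSP_weights_laplace\<close> applies; \<open>neg_ln\<close>
  also covers vanishing factors.\<close>

lemma columns_integral:
  fixes F :: "real \<times> (nat \<Rightarrow> nat) \<Rightarrow> ennreal"
  assumes F[measurable]: "F \<in> borel_measurable (borel \<Otimes>\<^sub>M count_col)"
  shows "(\<integral>\<^sup>+y. \<integral>\<^sup>+a. ennreal (exp_neg (\<Sum>n. F (y n, \<lambda>d. a (d, n)))) \<partial>array_law r x \<partial>(\<Pi>\<^sub>M n\<in>UNIV. label_law)) =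
    ennreal (exp_neg (\<Sum>n. neg_ln (enn2real (unit_integral r (\<lambda>z. ennreal (exp_neg (F z))) (x n)))))"
proof -
  let ?U = "\<Pi>\<^sub>M n\<in>(UNIV::nat set). label_law" and ?Z = "\<Pi>\<^sub>M n\<in>UNIV. col_law r (x n)"
  interpret U: prob_space ?U by (intro prob_space_PiM prob_space_label_law)
  interpret Z: prob_space ?Z by (intro prob_space_PiM prob_space_col_law)
  interpret UZ: pair_prob_space ?U ?Z ..
  have Um: "(\<lambda>y. y n) \<in> borel_measurable ?U" for n
  proof -
    have "(\<lambda>y. y n) \<in> measurable ?U label_law" by (rule measurable_component_singleton) simp
    then show ?thesis by (simp cong: measurable_cong_sets)
  qed
  have Zm: "(\<lambda>z. z n) \<in> measurable ?Z count_col" for n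
  proof -
    have "(\<lambda>z. z n) \<in> measurable ?Z (col_law r (x n))" by (rule measurable_component_singleton) simp
    then show ?thesis by (simp cong: measurable_cong_sets)
  qed
  define e where "e z = ennreal (exp_neg (F z))" for z
  have [measurable]: "e \<in> borel_measurable (borel \<Otimes>\<^sub>M count_col)" unfolding e_def by measurable
  have em: "(\<lambda>b. e (u, b)) \<in> borel_measurable (col_law r p)" for u p
    by measurable
  have qm: "(\<lambda>q. (fst q n, snd q n)) \<in> measurable (?U \<Otimes>\<^sub>M ?Z) (borel \<Otimes>\<^sub>M count_col)" for n
    by (intro measurable_Pair measurable_compose[OF measurable_fst Um] measurable_compose[OF measurable_snd Zm])
  have pm[measurable]: "(\<lambda>q. e (fst q n, snd q n)) \<in> borel_measurable (?U \<Otimes>\<^sub>M ?Z)"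
    and Fpm[measurable]: "(\<lambda>q. F (fst q n, snd q n)) \<in> borel_measurable (?U \<Otimes>\<^sub>M ?Z)" for n
    by (rule measurable_compose[OF qm], measurable)+
  define g where "g n = unit_integral r e (x n)" for n
  have gle: "g n \<le> 1" for n unfolding g_def by (rule unit_integral_le_1) (simp add: e_def)
  have cm: "(\<lambda>z (d, n). z n d) \<in> measurable ?Z count_array"
  proof (rule measurable_PiM_single')
    fix i :: "nat \<times> nat"
    show "(\<lambda>z. case i of (d, n) \<Rightarrow> z n d) \<in> measurable ?Z (count_space UNIV)"
      unfolding split_beta by (rule measurable_compose[OF Zm measurable_component_singleton]) simp
  qed (auto simp: space_PiM)
  have am: "(\<lambda>a. (\<lambda>d. a (d, n))) \<in> measurable count_array count_col" for n :: nat
    by (rule measurable_PiM_single') auto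
  have fin: "(\<integral>\<^sup>+q. (\<Prod>n<N. e (fst q n, snd q n)) \<partial>(?U \<Otimes>\<^sub>M ?Z)) = (\<Prod>n<N. g n)" for N
  proof -
    have "(\<integral>\<^sup>+q. (\<Prod>n<N. e (fst q n, snd q n)) \<partial>(?U \<Otimes>\<^sub>M ?Z)) =
        (\<integral>\<^sup>+y. \<integral>\<^sup>+z. (\<Prod>n<N. e (y n, z n)) \<partial>?Z \<partial>?U)"
      by (subst Z.nn_integral_fst[symmetric]) auto
    also have "\<dots> = (\<integral>\<^sup>+y. (\<Prod>n<N. \<integral>\<^sup>+b. e (y n, b) \<partial>col_law r (x n)) \<partial>?U)"
      by (intro nn_integral_cong PiM_prod_nn_integral prob_space_col_law em) auto
    also have "\<dots> = (\<Prod>n<N. \<integral>\<^sup>+u. \<integral>\<^sup>+b. e (u, b) \<partial>col_law r (x n) \<partial>label_law)"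
      by (intro PiM_prod_nn_integral prob_space_label_law) auto
    finally show ?thesis by (simp add: g_def unit_integral_def)
  qed
  have "(\<integral>\<^sup>+y. \<integral>\<^sup>+a. ennreal (exp_neg (\<Sum>n. F (y n, \<lambda>d. a (d, n)))) \<partial>array_law r x \<partial>?U) =
    (\<integral>\<^sup>+y. \<integral>\<^sup>+z. ennreal (exp_neg (\<Sum>n. F (y n, z n))) \<partial>?Z \<partial>?U)"
    unfolding array_law_columns
  proof (intro nn_integral_cong)
    fix y
    have "(\<lambda>a. F (y n, \<lambda>d. a (d, n))) \<in> borel_measurable count_array" for n
      using am[of n] by measurable
    then show "(\<integral>\<^sup>+a. ennreal (exp_neg (\<Sum>n. F (y n, \<lambda>d. a (d, n)))) \<partial>distr ?Z count_array (\<lambda>z (d, n). z n d)) =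
        (\<integral>\<^sup>+z. ennreal (exp_neg (\<Sum>n. F (y n, z n))) \<partial>?Z)"
      by (subst nn_integral_distr[OF cm]) auto
  qed
  also have "\<dots> = (\<integral>\<^sup>+q. ennreal (exp_neg (\<Sum>n. F (fst q n, snd q n))) \<partial>(?U \<Otimes>\<^sub>M ?Z))"
    by (subst Z.nn_integral_fst[symmetric]) auto
  also have "\<dots> = ennreal (exp_neg (\<Sum>n. neg_ln (enn2real (g n))))"
  proof (rule LIMSEQ_unique)
    show "(\<lambda>N. \<integral>\<^sup>+q. (\<Prod>n<N. e (fst q n, snd q n)) \<partial>(?U \<Otimes>\<^sub>M ?Z)) \<longlonglongrightarrow>
        (\<integral>\<^sup>+q. ennreal (exp_neg (\<Sum>n. F (fst q n, snd q n))) \<partial>(?U \<Otimes>\<^sub>M ?Z))"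
    proof (rule nn_integral_dominated_convergence[where w="\<lambda>_. 1"])
      show "AE q in ?U \<Otimes>\<^sub>M ?Z. (\<lambda>N. \<Prod>n<N. e (fst q n, snd q n)) \<longlonglongrightarrow> ennreal (exp_neg (\<Sum>n. F (fst q n, snd q n)))"
        using exp_neg_suminf by (intro AE_I2) (auto simp: e_def prod_ennreal intro!: tendsto_intros)
      show "AE q in ?U \<Otimes>\<^sub>M ?Z. (\<Prod>n<N. e (fst q n, snd q n)) \<le> 1" for N
        by (intro AE_I2 prod_le_1) (auto simp: e_def)
    qed (auto simp: UZ.emeasure_space_1)
    have gg: "g n = ennreal (exp_neg (neg_ln (enn2real (g n))))" for n
      using gle[of n] by (subst exp_neg_neg_ln) (auto intro: enn2real_leI simp: ennreal_enn2real_if top_unique)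
    have gp: "(\<Prod>n<N. g n) = ennreal (\<Prod>n<N. exp_neg (neg_ln (enn2real (g n))))" for N
      by (subst prod_ennreal[symmetric]) (auto intro!: prod.cong gg)
    have "(\<lambda>N. ennreal (\<Prod>n<N. exp_neg (neg_ln (enn2real (g n))))) \<longlonglongrightarrow> ennreal (exp_neg (\<Sum>n. neg_ln (enn2real (g n))))"
      by (intro tendsto_ennrealI exp_neg_suminf)
    then show "(\<lambda>N. \<integral>\<^sup>+q. (\<Prod>n<N. e (fst q n, snd q n)) \<partial>(?U \<Otimes>\<^sub>M ?Z)) \<longlonglongrightarrow> ennreal (exp_neg (\<Sum>n. neg_ln (enn2real (g n))))"
      unfolding fin gp .
  qed
  finally show ?thesis by (simp add: g_def e_def[abs_def])
qed

text \<open>Two labels coincide with probability \<open>0\<close>, because the uniform law has no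
  atoms. Distinct labels are what allows units to be told apart in the day measures.\<close>

lemma AE_labels_distinct:
  "AE y in (\<Pi>\<^sub>M n\<in>(UNIV::nat set). label_law). inj y \<and> (\<forall>n. 0 \<le> y n \<and> y n \<le> 1)"
proof -
  interpret product_prob_space "\<lambda>n::nat. label_law" UNIV
    by (simp add: product_prob_space_def product_prob_space_axioms_def product_sigma_finite_def
        prob_space_label_law prob_space_imp_sigma_finite)
  let ?U = "\<Pi>\<^sub>M n\<in>(UNIV::nat set). label_law"
  have Um[measurable]: "(\<lambda>y. y n) \<in> borel_measurable (PiM J (\<lambda>_::nat. label_law))" if "n \<in> J" for n J
  proof -
    have "(\<lambda>y. y n) \<in> measurable (PiM J (\<lambda>_::nat. label_law)) label_law"
      by (rule measurable_component_singleton[OF that])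
    then show ?thesis by (simp cong: measurable_cong_sets)
  qed
  have ne: "AE y in ?U. y n \<noteq> y m" if "n \<noteq> m" for n m
  proof -
    let ?J = "{n, m}"
    have [measurable]: "(\<lambda>y. y n) \<in> borel_measurable (PiM ?J (\<lambda>_::nat. label_law))"
      "(\<lambda>y. y m) \<in> borel_measurable (PiM ?J (\<lambda>_::nat. label_law))" by (auto intro!: Um)
    have s: "{z \<in> space (PiM ?J (\<lambda>_. label_law)). z n = z m} \<in> sets (PiM ?J (\<lambda>_. label_law))" by measurable
    have "emeasure (PiM ?J (\<lambda>_. label_law)) {z \<in> space (PiM ?J (\<lambda>_. label_law)). z n = z m} =
      (\<integral>\<^sup>+z. indicator {z. z n = z m} z \<partial>PiM ?J (\<lambda>_. label_law))"
      by (subst nn_integral_indicator[OF s, symmetric], rule nn_integral_cong) (auto simp: indicator_def)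
    also have "\<dots> = (\<integral>\<^sup>+x. \<integral>\<^sup>+y. indicator {z. z n = z m} (x(n := y)) \<partial>label_law \<partial>PiM {m} (\<lambda>_. label_law))"
    proof (rule product_nn_integral_insert)
      show "indicator {z. z n = z m} \<in> borel_measurable (PiM ?J (\<lambda>_. label_law))"
        by (rule measurable_cong[THEN iffD1, OF _ borel_measurable_indicator[OF s]]) (auto simp: indicator_def)
    qed (use that in auto)
    also have "\<dots> = (\<integral>\<^sup>+x. emeasure label_law {x m} \<partial>PiM {m} (\<lambda>_. label_law))"
      using that by (intro nn_integral_cong, subst nn_integral_indicator[symmetric])
        (auto intro!: nn_integral_cong simp: indicator_def simp del: nn_integral_indicator)
    also have "\<dots> = 0"
    proof -
      have "emeasure lborel ({0..1} \<inter> {a}) = 0" for a :: real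
        by (rule emeasure_lborel_countable) auto
      then show ?thesis by (simp add: emeasure_uniform_measure)
    qed
    finally have "emeasure (PiM ?J (\<lambda>_. label_law)) {z \<in> space (PiM ?J (\<lambda>_. label_law)). z n = z m} = 0" .
    then have "AE z in PiM ?J (\<lambda>_. label_law). z n \<noteq> z m"
      by (subst AE_iff_measurable[OF s]) auto
    then have "AE z in distr ?U (PiM ?J (\<lambda>_. label_law)) (\<lambda>x. restrict x ?J). z n \<noteq> z m"
      by (subst distr_PiM_restrict_finite) auto
    then have "AE y in ?U. restrict y ?J n \<noteq> restrict y ?J m"
      by (rule AE_distrD[rotated]) (auto intro!: measurable_restrict_subset)
    then show ?thesis by simp
  qed
  have "AE u in label_law. 0 \<le> u \<and> u \<le> 1"
    by (subst AE_uniform_measure) auto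
  then have "AE y in ?U. 0 \<le> y n \<and> y n \<le> 1" for n by (intro AE_component) auto
  then have 1: "AE y in ?U. \<forall>n. 0 \<le> y n \<and> y n \<le> 1" by (subst AE_all_countable) auto
  have "AE y in ?U. n = m \<or> y n \<noteq> y m" for n m
    using ne[of n m] by (cases "n = m") auto
  then have "AE y in ?U. \<forall>n m. n = m \<or> y n \<noteq> y m" by (simp only: AE_all_countable) simp
  then show ?thesis using 1 by eventually_elim (auto simp: inj_def)
qed

lemma pred_labels: "Measurable.pred real_seq (\<lambda>y. inj y \<and> (\<forall>n. 0 \<le> y n \<and> y n \<le> 1))"
proof -
  have "{y \<in> space real_seq. (\<forall>n m. n = m \<or> y n < y m \<or> y m < y n) \<and> (\<forall>n. 0 \<le> y n \<and> y n \<le> 1)} \<in> sets real_seq"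
    by measurable
  moreover have "inj y \<longleftrightarrow> (\<forall>n m. n = m \<or> y n < y m \<or> y m < y n)" for y :: "nat \<Rightarrow> real"
    by (auto simp: inj_def) (metis linorder_neqE_linordered_idom less_irrefl)+
  ultimately show ?thesis by (simp add: pred_def)
qed

section \<open>The model and the Laplace functional of its unit marks\<close>

locale sbsp_nbp = prob_space M for M :: "'a measure" +
  fixes \<sigma> \<beta> c r :: real and \<theta> w :: "nat \<Rightarrow> 'a \<Rightarrow> real" and A :: "nat \<Rightarrow> nat \<Rightarrow> 'a \<Rightarrow> nat"
  assumes \<sigma>: "0 < \<sigma>" "\<sigma> < 1" and \<beta>: "0 < \<beta>" and c: "0 < c" and r: "0 < r"
    and \<theta>_meas[measurable]: "\<And>n. \<theta> n \<in> borel_measurable M"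
    and w_meas[measurable]: "\<And>n. w n \<in> borel_measurable M"
    and A_meas: "\<And>d n. 1 \<le> d \<Longrightarrow> A d n \<in> measurable M (count_space UNIV)"
    and SBSP: "SBSP_atoms \<beta> \<sigma> c (distr M (real_seq \<Otimes>\<^sub>M real_seq) (\<lambda>\<omega>. (\<lambda>n. \<theta> n \<omega>, \<lambda>n. w n \<omega>)))"
    and NBP: "NBP_counts M r \<theta> w A"
begin

lemma A_Suc_meas[measurable]: "A (Suc d) n \<in> measurable M (count_space UNIV)"
  by (rule A_meas) simp

text \<open>Entry \<open>d\<close> of the column is the count of day \<open>d + 1\<close>.\<close>

definition unit_mark :: "'a \<Rightarrow> nat \<Rightarrow> real \<times> (nat \<Rightarrow> nat)" where
  "unit_mark \<omega> n = (w n \<omega>, \<lambda>d. A (Suc d) n \<omega>)"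

lemma unit_mark_meas[measurable]: "(\<lambda>\<omega>. unit_mark \<omega> n) \<in> measurable M (borel \<Otimes>\<^sub>M count_col)"
  unfolding unit_mark_def by (intro measurable_Pair measurable_PiM_single') auto

lemma atoms_meas: "(\<lambda>\<omega>. (\<lambda>n. \<theta> n \<omega>, \<lambda>n. w n \<omega>)) \<in> measurable M (real_seq \<Otimes>\<^sub>M real_seq)"
  by (intro measurable_Pair measurable_PiM_single') auto

lemma atoms_law:
  obtains G where "jump_ratio_kernel \<sigma> G"
    "distr M (real_seq \<Otimes>\<^sub>M real_seq) (\<lambda>\<omega>. (\<lambda>n. \<theta> n \<omega>, \<lambda>n. w n \<omega>)) =
      (tilted_largest_jump \<beta> \<sigma> c \<bind> G) \<Otimes>\<^sub>M (\<Pi>\<^sub>M n\<in>UNIV. label_law)"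
    "prob_space (tilted_largest_jump \<beta> \<sigma> c \<bind> G)" "sets (tilted_largest_jump \<beta> \<sigma> c \<bind> G) = sets real_seq"
proof -
  obtain G where G: "jump_ratio_kernel \<sigma> G"
    "distr M (real_seq \<Otimes>\<^sub>M real_seq) (\<lambda>\<omega>. (\<lambda>n. \<theta> n \<omega>, \<lambda>n. w n \<omega>)) =
      (tilted_largest_jump \<beta> \<sigma> c \<bind> G) \<Otimes>\<^sub>M (\<Pi>\<^sub>M n\<in>UNIV. label_law)"
    using SBSP by (auto simp: SBSP_atoms_def)
  have Gm: "G \<in> measurable borel (prob_algebra real_seq)" using G by (simp add: jump_ratio_kernel_def)
  have "sets (G t) = sets real_seq" for t
    using measurable_space[OF Gm, of t] by (simp add: space_prob_algebra)
  then have s: "sets (tilted_largest_jump \<beta> \<sigma> c \<bind> G) = sets real_seq"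
    by (intro sets_bind) (auto simp: tilted_largest_jump_def)
  have "(\<integral>\<^sup>+\<theta>. ennreal (exp_neg (\<Sum>n. 0)) \<partial>(tilted_largest_jump \<beta> \<sigma> c \<bind> G)) = ennreal ((\<beta> / (\<beta> + 0)) powr (c + 1))"
    by (rule SBSP_weights_laplace[OF G(1) \<sigma>(1) \<beta> c, where f="\<lambda>_. 0"]) auto
  \<comment> \<open>The Laplace formula with \<open>f = 0\<close> gives total mass \<open>1\<close>,
    which shows that the tilted density is normalised.\<close>
  then have "emeasure (tilted_largest_jump \<beta> \<sigma> c \<bind> G) (space (tilted_largest_jump \<beta> \<sigma> c \<bind> G)) = 1"
    using \<beta> by simp
  then have "prob_space (tilted_largest_jump \<beta> \<sigma> c \<bind> G)" by (rule prob_spaceI)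
  with G s show ?thesis using that by blast
qed

text \<open>The key formula of the overview. Integrating out columns and labels given the weights
  leaves a function of the weights alone, to which \<open>SBSP_weights_laplace\<close>
  applies.\<close>

lemma NBP_laplace:
  assumes F[measurable]: "F \<in> borel_measurable (borel \<Otimes>\<^sub>M count_col)"
    and l: "levy_integral \<sigma> r (\<lambda>z. ennreal (1 - exp_neg (F z))) = ennreal l" "0 \<le> l"
  shows "(\<integral>\<omega>. exp_neg (\<Sum>n. F (unit_mark \<omega> n)) \<partial>M) = (\<beta> / (\<beta> + l)) powr (c + 1)"
proof -
  obtain G where G: "jump_ratio_kernel \<sigma> G"
    and P: "distr M (real_seq \<Otimes>\<^sub>M real_seq) (\<lambda>\<omega>. (\<lambda>n. \<theta> n \<omega>, \<lambda>n. w n \<omega>)) =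
      (tilted_largest_jump \<beta> \<sigma> c \<bind> G) \<Otimes>\<^sub>M (\<Pi>\<^sub>M n\<in>UNIV. label_law)"
    and "prob_space (tilted_largest_jump \<beta> \<sigma> c \<bind> G)"
    and sT: "sets (tilted_largest_jump \<beta> \<sigma> c \<bind> G) = sets real_seq" by (rule atoms_law)
  define T where "T = tilted_largest_jump \<beta> \<sigma> c \<bind> G"
  have sT[measurable_cong]: "sets T = sets real_seq" using sT by (simp add: T_def)
  let ?U = "\<Pi>\<^sub>M n\<in>(UNIV::nat set). label_law"
  have sU[measurable_cong]: "sets ?U = sets real_seq" by (intro sets_PiM_cong) auto
  interpret U: prob_space ?U by (intro prob_space_PiM prob_space_label_law)
  define S where "S = ((real_seq \<Otimes>\<^sub>M real_seq) \<Otimes>\<^sub>M count_array)"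
  define \<Psi> where "\<Psi> q = ennreal (exp_neg (\<Sum>n. F (snd (fst q) n, \<lambda>d. snd q (d, n))))"
    for q :: "((nat \<Rightarrow> real) \<times> (nat \<Rightarrow> real)) \<times> (nat \<times> nat \<Rightarrow> nat)"
  have am: "(\<lambda>a. (\<lambda>d. a (d, n))) \<in> measurable count_array count_col" for n :: nat
    by (rule measurable_PiM_single') auto
  have qm: "(\<lambda>q. (snd (fst q) n, \<lambda>d. snd q (d, n))) \<in> measurable S (borel \<Otimes>\<^sub>M count_col)" for n
    unfolding S_def
    by (intro measurable_Pair measurable_compose[OF measurable_snd am]
        measurable_compose[OF measurable_compose[OF measurable_fst measurable_snd] measurable_component_singleton]) auto
  have [measurable]: "(\<lambda>q. F (snd (fst q) n, \<lambda>d. snd q (d, n))) \<in> borel_measurable S" for n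
    by (rule measurable_compose[OF qm]) measurable
  have \<Psi>m[measurable]: "\<Psi> \<in> borel_measurable S" unfolding \<Psi>_def by measurable
  have arrm: "(\<lambda>\<omega>. (\<lambda>(d, n). A (Suc d) n \<omega>)) \<in> measurable M count_array"
    by (rule measurable_PiM_single') (auto simp: split_beta')
  have jm: "(\<lambda>\<omega>. ((\<lambda>n. \<theta> n \<omega>, \<lambda>n. w n \<omega>), \<lambda>(d, n). A (Suc d) n \<omega>)) \<in> measurable M S"
    unfolding S_def by (intro measurable_Pair atoms_meas[unfolded measurable_pair_iff comp_def, THEN conjunct1]
        atoms_meas[unfolded measurable_pair_iff comp_def, THEN conjunct2] atoms_meas arrm)
  define \<kappa> where "\<kappa> = (\<lambda>(x, y). distr (array_law r x) S (\<lambda>a. ((x, y :: nat \<Rightarrow> real), a)))"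
  have J: "distr M S (\<lambda>\<omega>. ((\<lambda>n. \<theta> n \<omega>, \<lambda>n. w n \<omega>), \<lambda>(d, n). A (Suc d) n \<omega>)) = (T \<Otimes>\<^sub>M ?U) \<bind> \<kappa>"
    using NBP unfolding NBP_counts_def P S_def \<kappa>_def array_law_def T_def .
  have sTU[measurable_cong]: "sets (T \<Otimes>\<^sub>M ?U) = sets (real_seq \<Otimes>\<^sub>M real_seq)"
    by (rule sets_pair_measure_cong[OF sT sU])
  have \<kappa>m: "\<kappa> \<in> measurable (T \<Otimes>\<^sub>M ?U) (subprob_algebra S)"
  proof -
    have "(\<lambda>p. distr (array_law r (fst p)) S (\<lambda>a. (p, a))) \<in> measurable (real_seq \<Otimes>\<^sub>M real_seq) (subprob_algebra S)"
    proof (rule measurable_distr2)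
      show "(\<lambda>p. array_law r (fst p)) \<in> measurable (real_seq \<Otimes>\<^sub>M real_seq) (subprob_algebra count_array)"
        by (rule measurable_compose[OF measurable_fst measurable_prob_algebraD[OF array_law_kernel]])
    qed (simp add: S_def)
    then show ?thesis using sTU by (simp add: \<kappa>_def split_beta' cong: measurable_cong_sets)
  qed
  have "(\<integral>\<^sup>+\<omega>. ennreal (exp_neg (\<Sum>n. F (unit_mark \<omega> n))) \<partial>M) =
      (\<integral>\<^sup>+q. \<Psi> q \<partial>distr M S (\<lambda>\<omega>. ((\<lambda>n. \<theta> n \<omega>, \<lambda>n. w n \<omega>), \<lambda>(d, n). A (Suc d) n \<omega>)))"
    by (subst nn_integral_distr[OF jm]) (simp_all add: \<Psi>m, simp add: \<Psi>_def unit_mark_def)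
  also have "\<dots> = (\<integral>\<^sup>+p. \<integral>\<^sup>+q. \<Psi> q \<partial>\<kappa> p \<partial>(T \<Otimes>\<^sub>M ?U))"
    unfolding J by (rule nn_integral_bind[OF \<Psi>m \<kappa>m])
  also have "\<dots> = (\<integral>\<^sup>+x. \<integral>\<^sup>+y. \<integral>\<^sup>+q. \<Psi> q \<partial>\<kappa> (x, y) \<partial>?U \<partial>T)"
    by (rule U.nn_integral_fst[symmetric]) (rule nn_integral_measurable_subprob_algebra2[OF _ \<kappa>m], measurable)
  also have "\<dots> = (\<integral>\<^sup>+x. \<integral>\<^sup>+y. \<integral>\<^sup>+a. ennreal (exp_neg (\<Sum>n. F (y n, \<lambda>d. a (d, n)))) \<partial>array_law r x \<partial>?U \<partial>T)"
  proof (intro nn_integral_cong)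
    fix x y
    have "(\<lambda>a. ((x, y), a)) \<in> measurable (array_law r x) S" by (simp add: S_def space_pair_measure space_PiM)
    then show "(\<integral>\<^sup>+q. \<Psi> q \<partial>\<kappa> (x, y)) = (\<integral>\<^sup>+a. ennreal (exp_neg (\<Sum>n. F (y n, \<lambda>d. a (d, n)))) \<partial>array_law r x)"
      unfolding \<kappa>_def prod.case by (subst nn_integral_distr) (auto simp: \<Psi>_def)
  qed
  also have "\<dots> = (\<integral>\<^sup>+x. ennreal (exp_neg (\<Sum>n. neg_ln (enn2real (unit_integral r (\<lambda>z. ennreal (exp_neg (F z))) (x n))))) \<partial>T)"
    by (simp add: columns_integral)
  also have "\<dots> = ennreal ((\<beta> / (\<beta> + l)) powr (c + 1))"
    unfolding T_def
  proof (rule SBSP_weights_laplace[OF G \<sigma>(1) \<beta> c _ _ l(2)])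
    \<comment> \<open>The function of the weight is \<open>- ln\<close> of the unit integral of
      \<open>exp (- F)\<close>. As the mark laws are probability measures, one minus this unit
      integral is the unit integral of \<open>1 - exp (- F)\<close>, the integrand of
      \<open>levy_integral\<close>.\<close>
    have 1: "unit_integral r (\<lambda>z. ennreal (1 - exp_neg (F z))) p =
        ennreal (1 - exp_neg (neg_ln (enn2real (unit_integral r (\<lambda>z. ennreal (exp_neg (F z))) p))))" for p
    proof -
      let ?g = "unit_integral r (\<lambda>z. ennreal (exp_neg (F z))) p"
      have g: "?g \<le> 1" by (rule unit_integral_le_1) simp
      have "unit_integral r (\<lambda>z. ennreal (1 - exp_neg (F z)) + ennreal (exp_neg (F z))) p =
          unit_integral r (\<lambda>z. ennreal (1 - exp_neg (F z))) p + ?g"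
        by (rule unit_integral_add) measurable
      moreover have "ennreal (1 - exp_neg (F z)) + ennreal (exp_neg (F z)) = 1" for z
        by (subst ennreal_plus[symmetric]) auto
      ultimately have "unit_integral r (\<lambda>z. ennreal (1 - exp_neg (F z))) p + ?g = 1"
        by (simp add: unit_integral_const)
      moreover obtain a where a: "?g = ennreal a" "0 \<le> a" "a \<le> 1"
        using g by (cases ?g) (auto simp: top_unique)
      ultimately have "unit_integral r (\<lambda>z. ennreal (1 - exp_neg (F z))) p = 1 - ennreal a"
        by (metis ennreal_add_diff_cancel_right ennreal_neq_top)
      then show ?thesis using a by (simp add: exp_neg_neg_ln ennreal_minus[symmetric])
    qed
    show "(\<integral>\<^sup>+p. ennreal (1 - exp_neg (neg_ln (enn2real (unit_integral r (\<lambda>z. ennreal (exp_neg (F z))) p)))) * indicator {0<..<1} p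
        \<partial>stable_intensity \<sigma>) = ennreal l"
      using l(1) unfolding levy_integral_def 1 .
  qed measurable
  finally show ?thesis by (subst integral_eq_nn_integral) auto
qed

lemma AE_labels: "AE \<omega> in M. inj (\<lambda>n. w n \<omega>) \<and> (\<forall>n. 0 \<le> w n \<omega> \<and> w n \<omega> \<le> 1)"
proof -
  obtain G where P: "distr M (real_seq \<Otimes>\<^sub>M real_seq) (\<lambda>\<omega>. (\<lambda>n. \<theta> n \<omega>, \<lambda>n. w n \<omega>)) =
      (tilted_largest_jump \<beta> \<sigma> c \<bind> G) \<Otimes>\<^sub>M (\<Pi>\<^sub>M n\<in>UNIV. label_law)"
    and T: "prob_space (tilted_largest_jump \<beta> \<sigma> c \<bind> G)"
    and sT: "sets (tilted_largest_jump \<beta> \<sigma> c \<bind> G) = sets real_seq" by (rule atoms_law)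
  let ?T = "tilted_largest_jump \<beta> \<sigma> c \<bind> G" and ?U = "\<Pi>\<^sub>M n\<in>(UNIV::nat set). label_law"
  interpret T: prob_space ?T by (rule T)
  interpret U: prob_space ?U by (intro prob_space_PiM prob_space_label_law)
  interpret TU: pair_prob_space ?T ?U ..
  have sU[measurable_cong]: "sets ?U = sets real_seq" by (intro sets_PiM_cong) auto
  let ?Q = "\<lambda>y::nat \<Rightarrow> real. inj y \<and> (\<forall>n. 0 \<le> y n \<and> y n \<le> 1)"
  have Qm: "Measurable.pred real_seq ?Q" by (rule pred_labels)
  have "AE p in ?T \<Otimes>\<^sub>M ?U. ?Q (snd p)"
  proof (rule TU.AE_pair_measure)
    have "Measurable.pred (?T \<Otimes>\<^sub>M ?U) (\<lambda>p. ?Q (snd p))"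
      by (rule measurable_compose[OF _ Qm]) (use sU in \<open>simp cong: measurable_cong_sets\<close>)
    then show "{p \<in> space (?T \<Otimes>\<^sub>M ?U). ?Q (snd p)} \<in> sets (?T \<Otimes>\<^sub>M ?U)" by (simp add: pred_def)
  qed (use AE_labels_distinct in simp)
  then have "AE p in distr M (real_seq \<Otimes>\<^sub>M real_seq) (\<lambda>\<omega>. (\<lambda>n. \<theta> n \<omega>, \<lambda>n. w n \<omega>)). ?Q (snd p)"
    by (simp only: P)
  from AE_distrD[OF atoms_meas this] show ?thesis by simp
qed

end

subsection \<open>The intensity of unit marks\<close>

lemma exp_neg_strict: "exp_neg y < exp_neg x \<longleftrightarrow> x < y"
proof
  show "x < y" if "exp_neg y < exp_neg x"
    using exp_neg_antimono[of y x] that by (auto simp: not_le[symmetric])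
  show "exp_neg y < exp_neg x" if xy: "x < y"
  proof (cases y)
    case (real b)
    then obtain a where "x = ennreal a" "0 \<le> a" using xy real by (cases x) auto
    then show ?thesis using xy real by (simp add: exp_neg_ennreal ennreal_less_iff)
  next
    case top then show ?thesis using that by (cases x) (auto simp: exp_neg_ennreal)
  qed
qed

text \<open>The exponentials \<open>exp_neg (l * x)\<close> are closed under products, and the one
  with \<open>l = 1\<close> is strictly decreasing up to \<open>\<top>\<close>, so it alone
  generates the Borel sets. The case \<open>l = 0\<close> compares total masses and thereby accounts
  for mass at \<open>\<top>\<close>.\<close>

lemma laplace_unique:
  fixes M1 M2 :: "ennreal measure"
  assumes fin: "finite_measure M1" "finite_measure M2" and s: "sets M1 = sets borel" "sets M2 = sets borel"
    and eq: "\<And>l. 0 \<le> l \<Longrightarrow> (\<integral>x. exp_neg (ennreal l * x) \<partial>M1) = (\<integral>x. exp_neg (ennreal l * x) \<partial>M2)"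
  shows "M1 = M2"
proof (rule measure_eqI)
  show "sets M1 = sets M2" by (simp add: s)
  have sp: "space M1 = UNIV" using sets_eq_imp_space_eq[OF s(1)] by simp
  note [measurable_cong] = s(1)
  define C where "C = (\<lambda>l x. exp_neg (ennreal l * x)) ` {0..}"
  fix A assume "A \<in> sets M1"
  then have A: "A \<in> sigma_sets UNIV (range lessThan)"
    by (simp add: s borel_Iio)
  show "emeasure M1 A = emeasure M2 A"
  proof (rule multiplicative_class_eq[OF fin, where C=C])
    show "sets M1 = sets M2" by (simp add: s)
    show "f \<in> borel_measurable M1" if "f \<in> C" for f using that by (auto simp: C_def)
    show "0 \<le> f x \<and> f x \<le> 1" if "f \<in> C" for f x using that by (auto simp: C_def)
    show "(\<lambda>_. 1) \<in> C" unfolding C_def by (rule image_eqI[where x=0]) auto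
    show "(\<lambda>x. f x * g x) \<in> C" if fg: "f \<in> C" "g \<in> C" for f g
    proof -
      obtain l m where lm: "0 \<le> l" "0 \<le> m" "f = (\<lambda>x. exp_neg (ennreal l * x))" "g = (\<lambda>x. exp_neg (ennreal m * x))"
        using fg unfolding C_def by auto
      have "(\<lambda>x. f x * g x) = (\<lambda>x. exp_neg (ennreal (l + m) * x))"
        using lm by (simp add: exp_neg_add[symmetric] distrib_right[symmetric] ennreal_plus[symmetric] del: ennreal_plus)
      then show ?thesis unfolding C_def using lm by (intro image_eqI[where x="l + m"]) auto
    qed
    show "integral\<^sup>L M1 f = integral\<^sup>L M2 f" if "f \<in> C" for f using that eq by (auto simp: C_def)
    have sub: "range lessThan \<subseteq> {f -` {a<..} \<inter> space M1 | f a. f \<in> C}"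
    proof safe
      fix t :: ennreal
      have "{..<t} = (\<lambda>x. exp_neg (ennreal 1 * x)) -` {exp_neg t<..} \<inter> space M1"
        by (auto simp: sp exp_neg_strict)
      moreover have "(\<lambda>x. exp_neg (ennreal 1 * x)) \<in> C" unfolding C_def by (rule image_eqI[where x=1]) auto
      ultimately show "\<exists>f a. {..<t} = f -` {a<..} \<inter> space M1 \<and> f \<in> C" by blast
    qed
    show "A \<in> sigma_sets (space M1) {f -` {a<..} \<inter> space M1 | f a. f \<in> C}"
      using sigma_sets_mono'[OF sub, of UNIV] A sp by auto
  qed
qed

text \<open>The generating function at \<open>exp (- l)\<close> of the negative binomial law with
  shape \<open>a\<close> and parameter \<open>p\<close>.\<close>

definition nb_pgf :: "real \<Rightarrow> real \<Rightarrow> real \<Rightarrow> real" where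
  "nb_pgf a l p = ((1 - p) / (1 - p * exp (- l))) powr a"

lemma nb_pgf_measurable[measurable]: "nb_pgf a l \<in> borel_measurable borel"
  unfolding nb_pgf_def[abs_def] by measurable

lemma nb_pgf_nonneg[simp]: "0 \<le> nb_pgf a l p" by (simp add: nb_pgf_def)

lemma nb_pgf_pos:
  assumes "0 < p" "p < 1" "0 \<le> l" shows "0 < nb_pgf a l p"
proof -
  have "p * exp (- l) \<le> p * 1" using assms by (intro mult_left_mono) auto
  with assms have "p * exp (- l) < 1" by linarith
  then show ?thesis using assms by (simp add: nb_pgf_def)
qed

lemma nb_pgf_0: "p < 1 \<Longrightarrow> nb_pgf a 0 p = 1" by (simp add: nb_pgf_def)

text \<open>An exponential family argument: \<open>exp (- (l * x))\<close> times the probability of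
  \<open>x\<close> under \<open>p\<close> is a constant multiple of its probability under
  \<open>q = p * exp (- l)\<close>, and the latter probabilities sum to \<open>1\<close>.\<close>

lemma negbin_laplace:
  assumes a: "0 < a" and p: "0 < p" "p < 1" and l: "0 \<le> l"
  shows "(\<integral>\<^sup>+x. ennreal (exp (- (l * real x))) \<partial>measure_pmf (negbin_pmf a p)) = ennreal (nb_pgf a l p)"
proof -
  define q where "q = p * exp (- l)"
  have "q \<le> p * 1" unfolding q_def using p l by (intro mult_left_mono) auto
  with p have "q < 1" by linarith
  moreover have "0 < q" using p by (simp add: q_def)
  ultimately have q: "0 < q" "q < 1" by auto
  have *: "exp (- (l * real x)) * pmf (negbin_pmf a p) x = nb_pgf a l p * pmf (negbin_pmf a q) x" for x
  proof -
    have "q ^ x = p ^ x * exp (- (l * real x))"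
      by (simp add: q_def power_mult_distrib exp_of_nat_mult[symmetric] mult_ac)
    then show ?thesis
      using p q by (simp add: pmf_negbin[OF a p] pmf_negbin[OF a q] nb_pgf_def q_def[symmetric] powr_divide)
  qed
  have "(\<integral>\<^sup>+x. ennreal (exp (- (l * real x))) \<partial>measure_pmf (negbin_pmf a p)) =
      (\<integral>\<^sup>+x. ennreal (nb_pgf a l p) * ennreal (pmf (negbin_pmf a q) x) \<partial>count_space UNIV)"
    by (subst nn_integral_measure_pmf)
      (auto intro!: nn_integral_cong simp: ennreal_mult'[symmetric] * mult.commute[of "pmf _ _"])
  also have "\<dots> = ennreal (nb_pgf a l p)"
    by (simp add: nn_integral_cmult nn_integral_pmf measure_pmf.emeasure_space_1[simplified])
  finally show ?thesis .
qed

text \<open>Columns start with day \<open>1\<close> at entry \<open>0\<close>: the entries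
  \<open>d < D0\<close> are the days \<open>1\<close> to \<open>D0\<close>, the entries
  \<open>D0 + d\<close> with \<open>d < D1\<close> the days \<open>D0 + 1\<close> to
  \<open>D0 + D1\<close>.\<close>

definition past :: "nat \<Rightarrow> (nat \<Rightarrow> nat) \<Rightarrow> nat" where "past D0 b = (\<Sum>d<D0. b d)"
definition future :: "nat \<Rightarrow> nat \<Rightarrow> (nat \<Rightarrow> nat) \<Rightarrow> nat" where "future D0 D1 b = (\<Sum>d<D1. b (D0 + d))"

lemma past_measurable[measurable]: "past D0 \<in> measurable count_col (count_space UNIV)"
  unfolding past_def[abs_def] by measurable

lemma future_measurable[measurable]: "future D0 D1 \<in> measurable count_col (count_space UNIV)"
  unfolding future_def[abs_def] by measurable

lemma col_law_prod:
  assumes "finite J"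
  shows "(\<integral>\<^sup>+b. (\<Prod>d\<in>J. f d (b d)) \<partial>col_law r p) = (\<Prod>d\<in>J. \<integral>\<^sup>+x. f d x \<partial>measure_pmf (negbin_pmf r p))"
  unfolding col_law_def using assms by (intro PiM_prod_nn_integral prob_space_measure_pmf) auto

lemma exp_future:
  "ennreal (exp (- (l * real (future D0 D1 b)))) = (\<Prod>d<D1. ennreal (exp (- (l * real (b (D0 + d))))))"
  by (subst prod_ennreal) (auto simp: future_def sum_distrib_left exp_sum[symmetric] sum_negf)

lemma col_law_past_future:
  assumes r: "0 < r" and p: "0 < p" "p < 1" and l: "0 \<le> l"
  shows "(\<integral>\<^sup>+b. of_bool (\<forall>d<D0. b d = a d) * ennreal (exp (- (l * real (future D0 D1 b)))) \<partial>col_law r p) =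
    ennreal ((\<Prod>d<D0. pmf (negbin_pmf r p) (a d)) * nb_pgf (r * real D1) l p)"
proof -
  define f where "f d x = (if d < D0 then of_bool (x = a d) else ennreal (exp (- (l * real x))))" for d x :: nat
  have split: "(\<Prod>d<D0 + D1. g d) = (\<Prod>d<D0. g d) * (\<Prod>d<D1. g (D0 + d))" for g :: "nat \<Rightarrow> ennreal"
    by (induction D1) (auto simp: mult.assoc)
  have "of_bool (\<forall>d<D0. b d = a d) = (\<Prod>d<D0. f d (b d))" for b
    by (cases "\<forall>d<D0. b d = a d") (auto simp: f_def)
  then have "of_bool (\<forall>d<D0. b d = a d) * ennreal (exp (- (l * real (future D0 D1 b)))) = (\<Prod>d<D0 + D1. f d (b d))" for b
    by (simp add: split exp_future) (simp add: f_def)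
  then have "(\<integral>\<^sup>+b. of_bool (\<forall>d<D0. b d = a d) * ennreal (exp (- (l * real (future D0 D1 b)))) \<partial>col_law r p) =
      (\<Prod>d<D0 + D1. \<integral>\<^sup>+x. f d x \<partial>measure_pmf (negbin_pmf r p))"
    by (simp add: col_law_prod)
  also have "\<dots> = (\<Prod>d<D0. ennreal (pmf (negbin_pmf r p) (a d))) * (\<Prod>d<D1. ennreal (nb_pgf r l p))"
    unfolding split
  proof (intro arg_cong2[where f="(*)"] prod.cong refl)
    fix d assume "d \<in> {..<D0}"
    then have "(\<integral>\<^sup>+x. f d x \<partial>measure_pmf (negbin_pmf r p)) = (\<integral>\<^sup>+x. indicator {a d} x \<partial>measure_pmf (negbin_pmf r p))"
      by (intro nn_integral_cong) (simp add: f_def indicator_def)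
    then show "(\<integral>\<^sup>+x. f d x \<partial>measure_pmf (negbin_pmf r p)) = ennreal (pmf (negbin_pmf r p) (a d))"
      by (simp add: emeasure_pmf_single)
  next
    fix d
    show "(\<integral>\<^sup>+x. f (D0 + d) x \<partial>measure_pmf (negbin_pmf r p)) = ennreal (nb_pgf r l p)"
      using negbin_laplace[OF r p l] by (simp add: f_def)
  qed
  also have "\<dots> = ennreal ((\<Prod>d<D0. pmf (negbin_pmf r p) (a d)) * nb_pgf r l p ^ D1)"
    by (simp add: prod_ennreal ennreal_power ennreal_mult prod_nonneg)
  also have "nb_pgf r l p ^ D1 = nb_pgf (r * real D1) l p"
    using powr_realpow[OF nb_pgf_pos[OF p l, of r], of D1] by (simp add: nb_pgf_def powr_powr)
  finally show ?thesis .
qed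

text \<open>The part of the likelihood of a history that does not involve the weight
  \<open>p\<close>; the rest depends on the history only through its total.\<close>

definition past_weight :: "real \<Rightarrow> nat \<Rightarrow> (nat \<Rightarrow> nat) \<Rightarrow> real" where
  "past_weight r D0 a = (\<Prod>d<D0. (real (a d) + r - 1) gchoose (a d))"

lemma past_weight_nonneg:
  assumes "0 < r" shows "0 \<le> past_weight r D0 a"
  unfolding past_weight_def
proof (rule prod_nonneg)
  fix d
  \<comment> \<open>The sign is read off from a negative binomial probability at
    \<open>p = 1 / 2\<close>, whose other factors are positive.\<close>
  have "0 \<le> pmf (negbin_pmf r (1/2)) (a d)" by simp
  then have "0 \<le> ((real (a d) + r - 1) gchoose (a d)) * ((1 / 2) ^ a d * (1 / 2) powr r)"
    using assms by (simp add: pmf_negbin mult.assoc)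
  moreover have "0 < (1 / 2 :: real) ^ a d * (1 / 2) powr r" by simp
  ultimately show "0 \<le> (real (a d) + r - 1) gchoose (a d)" by (meson mult_neg_pos not_le)
qed

lemma past_prob:
  assumes "0 < r" "0 < p" "p < 1"
  shows "(\<Prod>d<D0. pmf (negbin_pmf r p) (a d)) = past_weight r D0 a * p ^ past D0 a * (1 - p) powr (r * real D0)"
proof (induction D0)
  case (Suc D)
  then show ?case
    using assms by (simp add: past_weight_def past_def pmf_negbin power_add powr_add[symmetric] algebra_simps)
qed (use assms in \<open>simp add: past_weight_def past_def\<close>)

lemma stable_beta_integral:
  assumes \<sigma>: "0 < \<sigma>" and m: "0 < m - \<sigma>" and b: "0 < b + 1"
  shows "(\<integral>\<^sup>+p. ennreal (p powr m * (1 - p) powr b) * indicator {0<..<1} p \<partial>stable_intensity \<sigma>) =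
    ennreal (\<sigma> * Beta (m - \<sigma>) (b + 1))"
proof -
  have "(\<integral>\<^sup>+p. ennreal (p powr m * (1 - p) powr b) * indicator {0<..<1} p \<partial>stable_intensity \<sigma>) =
      (\<integral>\<^sup>+p. ennreal \<sigma> * (ennreal (p powr (m - \<sigma> - 1) * (1 - p) powr (b + 1 - 1)) * indicator {0..1} p) \<partial>lborel)"
    unfolding stable_intensity_def
    by (subst nn_integral_density)
      (use \<sigma> m b in \<open>auto intro!: nn_integral_cong_AE eventually_mono[OF AE_conjI[OF AE_lborel_singleton[of 0] AE_lborel_singleton[of 1]]]
        simp: indicator_def ennreal_mult'[symmetric] powr_add[symmetric] algebra_simps\<close>)
  also have "\<dots> = ennreal \<sigma> * (\<integral>\<^sup>+p. ennreal (p powr (m - \<sigma> - 1) * (1 - p) powr (b + 1 - 1)) * indicator {0..1} p \<partial>lborel)"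
    by (rule nn_integral_cmult) measurable
  also have "(\<integral>\<^sup>+p. ennreal (p powr (m - \<sigma> - 1) * (1 - p) powr (b + 1 - 1)) * indicator {0..1} p \<partial>lborel) = ennreal (Beta (m - \<sigma>) (b + 1))"
    by (rule nn_integral_has_integral_lebesgue'[OF _ has_integral_Beta_real[OF m b]]) auto
  finally show ?thesis using \<sigma> by (simp add: ennreal_mult')
qed

text \<open>Neither \<open>1\<close> nor \<open>(1 - p) powr R\<close> with
  \<open>R = r * D0\<close> is integrable near \<open>0\<close> against the intensity. Their
  difference is written as the integral of \<open>R * (1 - t) powr (R - 1)\<close> over
  \<open>t \<le> p\<close>; exchanging the integrals replaces the intensity by its mass
  \<open>t powr (-\<sigma>) - 1\<close> on \<open>{t..<1}\<close>, and two beta integrals remain,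
  which converge as \<open>\<sigma> < 1\<close>.\<close>

lemma psi_integral:
  assumes \<sigma>: "0 < \<sigma>" "\<sigma> < 1" and r: "0 < r" and D0: "1 \<le> D0"
  shows "(\<integral>\<^sup>+p. ennreal (1 - (1 - p) powr (r * real D0)) * indicator {0<..<1} p \<partial>stable_intensity \<sigma>) =
      ennreal (psi \<sigma> r 0 (real D0))"
    and "0 \<le> psi \<sigma> r 0 (real D0)"
proof -
  define R where "R = r * real D0"
  have R: "0 < R" using r D0 by (simp add: R_def)
  interpret S: sigma_finite_measure "stable_intensity \<sigma>" by (rule sigma_finite_stable_intensity)
  interpret SL: pair_sigma_finite "stable_intensity \<sigma>" lborel ..
  define g where "g t = R * (1 - t) powr (R - 1)" for t :: real
  have g0: "0 \<le> g t" for t using R by (simp add: g_def)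
  have [measurable]: "g \<in> borel_measurable borel" unfolding g_def[abs_def] by measurable
  have 1: "ennreal (1 - (1 - p) powr R) = (\<integral>\<^sup>+t. ennreal (g t) * indicator {0..p} t \<partial>lborel)" if p: "0 < p" "p < 1" for p
  proof -
    have "(\<integral>\<^sup>+t. ennreal (g t) * indicator {0..p} t \<partial>lborel) = ennreal (- ((1 - p) powr R) - (- ((1 - 0) powr R)))"
      by (rule nn_integral_FTC_Icc) (use p R g0 in \<open>auto intro!: derivative_eq_intros simp: g_def\<close>)
    then show ?thesis by simp
  qed
  have 2: "emeasure (stable_intensity \<sigma>) {t..<1} = ennreal (t powr (- \<sigma>) - 1)" if t: "0 < t" "t < 1" for t
  proof -
    have "{t..<1} = {t..} - {1..}" by auto
    then have "emeasure (stable_intensity \<sigma>) {t..<1} = emeasure (stable_intensity \<sigma>) {t..} - emeasure (stable_intensity \<sigma>) {1..}"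
      using t \<sigma> by (simp add: emeasure_Diff emeasure_stable_tail)
    then show ?thesis using t \<sigma> by (simp add: emeasure_stable_tail ennreal_minus[symmetric])
  qed
  have hi: "((\<lambda>t. R * (t powr (1 - \<sigma> - 1) * (1 - t) powr (R - 1) - t powr (1 - 1) * (1 - t) powr (R - 1))) has_integral R * (Beta (1 - \<sigma>) R - Beta 1 R)) {0..1}"
    using \<sigma> R by (intro has_integral_mult_right has_integral_diff has_integral_Beta_real) auto
  have nn: "0 \<le> R * (t powr (1 - \<sigma> - 1) * (1 - t) powr (R - 1) - t powr (1 - 1) * (1 - t) powr (R - 1))"
    if t: "t \<in> {0..1}" for t
  proof (cases "t = 0")
    case False
    then have "t powr 0 \<le> t powr (- \<sigma>)" using t \<sigma> by (intro powr_mono') auto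
    then have "1 * (1 - t) powr (R - 1) \<le> t powr (- \<sigma>) * (1 - t) powr (R - 1)" using False by (intro mult_right_mono) auto
    then show ?thesis using R False by simp
  qed simp
  \<comment> \<open>Passage to negative arguments by the recurrence of \<open>Gamma\<close>:
    \<open>- \<sigma>\<close> is not a pole, \<open>\<sigma> * Beta 1 (- \<sigma>) = - 1\<close>,
    \<open>\<sigma> * Beta (R + 1) (- \<sigma>) = - R * Beta (1 - \<sigma>) R\<close> and
    \<open>R * Beta 1 R = 1\<close>.\<close>
  have psi: "R * (Beta (1 - \<sigma>) R - Beta 1 R) = psi \<sigma> r 0 (real D0)"
  proof -
    have "- \<sigma> \<notin> \<int>\<^sub>\<le>\<^sub>0"
    proof
      assume "- \<sigma> \<in> \<int>\<^sub>\<le>\<^sub>0"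
      then obtain n where n: "- \<sigma> = - of_nat n" by (auto elim: nonpos_Ints_cases')
      then have "0 < real n" "real n < 1" using \<sigma> by auto
      then show False by simp
    qed
    then have G: "Gamma (1 - \<sigma>) = - \<sigma> * Gamma (- \<sigma>)" using Gamma_plus1[of "- \<sigma>"] by simp
    have GR: "Gamma (R + 1) = R * Gamma R" using R by (intro Gamma_plus1) (auto elim!: nonpos_Ints_cases)
    have pos: "0 < Gamma (1 - \<sigma>)" "0 < Gamma R" "0 < Gamma (R + 1 - \<sigma>)"
      using \<sigma> R by (auto intro!: Gamma_real_pos)
    have "Gamma (- \<sigma>) \<noteq> 0" using pos(1) unfolding G by (metis mult_zero_right less_irrefl)
    then have b1: "\<sigma> * Beta 1 (- \<sigma>) = - 1"
      using pos G \<sigma> by (simp add: Beta_def)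
    have b2: "\<sigma> * Beta (R + 1) (- \<sigma>) = - R * Beta (1 - \<sigma>) R"
    proof -
      have "\<sigma> * Beta (R + 1) (- \<sigma>) = R * Gamma R * (\<sigma> * Gamma (- \<sigma>)) / Gamma (R + 1 - \<sigma>)"
        by (simp add: Beta_def GR)
      also have "\<dots> = - R * Beta (1 - \<sigma>) R"
      proof -
        have e: "R + 1 - \<sigma> = 1 - \<sigma> + R" by simp
        show ?thesis unfolding e Beta_def G by (simp add: mult_ac)
      qed
      finally show ?thesis .
    qed
    have "Gamma R \<noteq> 0" using pos(2) by (metis less_irrefl)
    then have b3: "R * Beta 1 R = 1" using R GR by (simp add: Beta_def add.commute)
    show ?thesis
      using b1 b2 b3 by (simp add: psi_def R_def[symmetric] right_diff_distrib)
  qed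
  have "(\<integral>\<^sup>+p. ennreal (1 - (1 - p) powr R) * indicator {0<..<1} p \<partial>stable_intensity \<sigma>) =
      (\<integral>\<^sup>+p. \<integral>\<^sup>+t. ennreal (g t) * (indicator {0..p} t * indicator {0<..<1} p) \<partial>lborel \<partial>stable_intensity \<sigma>)"
    by (intro nn_integral_cong) (auto simp: indicator_def 1)
  also have "\<dots> = (\<integral>\<^sup>+t. \<integral>\<^sup>+p. ennreal (g t) * (indicator {0..p} t * indicator {0<..<1} p) \<partial>stable_intensity \<sigma> \<partial>lborel)"
    by (rule SL.Fubini'[symmetric]) (unfold indicator_def atLeastAtMost_iff greaterThanLessThan_iff split_beta', measurable)
  also have "\<dots> = (\<integral>\<^sup>+t. ennreal (R * (t powr (1 - \<sigma> - 1) * (1 - t) powr (R - 1) - t powr (1 - 1) * (1 - t) powr (R - 1))) * indicator {0..1} t \<partial>lborel)"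
  proof (intro nn_integral_cong_AE eventually_mono[OF AE_conjI[OF AE_lborel_singleton[of 0] AE_lborel_singleton[of 1]]])
    fix t :: real assume t: "t \<noteq> 0 \<and> t \<noteq> 1"
    have "(\<integral>\<^sup>+p. ennreal (g t) * (indicator {0..p} t * indicator {0<..<1} p) \<partial>stable_intensity \<sigma>) =
        (\<integral>\<^sup>+p. ennreal (g t * indicator {0..1} t) * indicator {t..<1} p \<partial>stable_intensity \<sigma>)"
      using t by (intro nn_integral_cong) (auto simp: indicator_def)
    also have "\<dots> = ennreal (g t * indicator {0..1} t) * emeasure (stable_intensity \<sigma>) {t..<1}"
      by (rule nn_integral_cmult_indicator) simp
    also have "\<dots> = ennreal (g t * (t powr (- \<sigma>) - 1)) * indicator {0..1} t"
      using t g0 by (auto simp: indicator_def 2 ennreal_mult'[symmetric])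
    also have "g t * (t powr (- \<sigma>) - 1) = R * (t powr (1 - \<sigma> - 1) * (1 - t) powr (R - 1) - t powr (1 - 1) * (1 - t) powr (R - 1))"
      using t by (simp add: g_def algebra_simps)
    finally show "(\<integral>\<^sup>+p. ennreal (g t) * (indicator {0..p} t * indicator {0<..<1} p) \<partial>stable_intensity \<sigma>) = ennreal (R * (t powr (1 - \<sigma> - 1) * (1 - t) powr (R - 1) - t powr (1 - 1) * (1 - t) powr (R - 1))) * indicator {0..1} t" .
  qed
  also have "\<dots> = ennreal (R * (Beta (1 - \<sigma>) R - Beta 1 R))"
    by (rule nn_integral_has_integral_lebesgue'[OF nn hi])
  also note psi
  finally show "(\<integral>\<^sup>+p. ennreal (1 - (1 - p) powr (r * real D0)) * indicator {0<..<1} p \<partial>stable_intensity \<sigma>) =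
      ennreal (psi \<sigma> r 0 (real D0))" by (simp add: R_def)
  show "0 \<le> psi \<sigma> r 0 (real D0)"
    using has_integral_nonneg[OF hi nn] psi by simp
qed

lemma col_law_unseen:
  assumes "0 < r" "0 < p" "p < 1" "0 \<le> l"
  shows "(\<integral>\<^sup>+b. of_bool (past D0 b = 0) * ennreal (exp (- (l * real (future D0 D1 b)))) \<partial>col_law r p) =
    ennreal ((1 - p) powr (r * real D0) * nb_pgf (r * real D1) l p)"
proof -
  have "past D0 b = 0 \<longleftrightarrow> (\<forall>d<D0. b d = (\<lambda>_. 0) d)" for b by (auto simp: past_def)
  then have "(\<integral>\<^sup>+b. of_bool (past D0 b = 0) * ennreal (exp (- (l * real (future D0 D1 b)))) \<partial>col_law r p) =
    (\<integral>\<^sup>+b. of_bool (\<forall>d<D0. b d = (\<lambda>_. 0) d) * ennreal (exp (- (l * real (future D0 D1 b)))) \<partial>col_law r p)" by simp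
  also have "\<dots> = ennreal ((\<Prod>d<D0. pmf (negbin_pmf r p) ((\<lambda>_. 0) d)) * nb_pgf (r * real D1) l p)"
    by (rule col_law_past_future[OF assms])
  also have "(\<Prod>d<D0. pmf (negbin_pmf r p) ((\<lambda>_. 0) d)) = (1 - p) powr (r * real D0)"
    using past_prob[OF assms(1-3), of "\<lambda>_. 0" D0] by (simp add: past_weight_def past_def)
  finally show ?thesis .
qed

text \<open>Given its weight \<open>p\<close>, a unit stays unseen in the observed days with
  probability \<open>(1 - p) powr (r * D0)\<close>. This identifies \<open>psi\<close> as the
  intensity of the seen marks.\<close>

lemma levy_seen:
  assumes \<sigma>: "0 < \<sigma>" "\<sigma> < 1" and r: "0 < r" and D0: "1 \<le> D0"
  shows "levy_integral \<sigma> r (\<lambda>z. of_bool (0 < past D0 (snd z))) = ennreal (psi \<sigma> r 0 (real D0))"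
proof -
  interpret U: prob_space label_law by (rule prob_space_label_law)
  have "unit_integral r (\<lambda>z. of_bool (0 < past D0 (snd z))) p = ennreal (1 - (1 - p) powr (r * real D0))"
    if p: "0 < p" "p < 1" for p
  proof -
    interpret C: prob_space "col_law r p" by (rule prob_space_col_law)
    \<comment> \<open>With \<open>l = 0\<close> and no later days the exponential is trivial, so
      that \<open>col_law_unseen\<close> yields the probability of an empty past.\<close>
    have "1 = (\<integral>\<^sup>+b. of_bool (0 < past D0 b) + of_bool (past D0 b = 0) * ennreal (exp (- (0 * real (future D0 0 b)))) \<partial>col_law r p)"
      using C.emeasure_space_1 by (subst nn_integral_cong[where v="\<lambda>_. 1"]) auto
    also have "\<dots> = (\<integral>\<^sup>+b. of_bool (0 < past D0 b) \<partial>col_law r p) + (\<integral>\<^sup>+b. of_bool (past D0 b = 0) * ennreal (exp (- (0 * real (future D0 0 b)))) \<partial>col_law r p)"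
      by (rule nn_integral_add) measurable
    also have "(\<integral>\<^sup>+b. of_bool (past D0 b = 0) * ennreal (exp (- (0 * real (future D0 0 b)))) \<partial>col_law r p) = ennreal ((1 - p) powr (r * real D0))"
      using col_law_unseen[OF r p order_refl, of D0 0] p by (simp add: nb_pgf_def)
    finally have "(\<integral>\<^sup>+b. of_bool (0 < past D0 b) \<partial>col_law r p) = 1 - ennreal ((1 - p) powr (r * real D0))"
      by (metis ennreal_add_diff_cancel_right ennreal_neq_top)
    also have "\<dots> = ennreal (1 - (1 - p) powr (r * real D0))" by (simp add: ennreal_minus[symmetric])
    finally show ?thesis by (simp add: unit_integral_def U.emeasure_space_1)
  qed
  then have "levy_integral \<sigma> r (\<lambda>z. of_bool (0 < past D0 (snd z))) =
      (\<integral>\<^sup>+p. ennreal (1 - (1 - p) powr (r * real D0)) * indicator {0<..<1} p \<partial>stable_intensity \<sigma>)"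
    unfolding levy_integral_def by (intro nn_integral_cong) (auto simp: indicator_def)
  then show ?thesis using psi_integral[OF assms] by simp
qed

lemma exp_neg_of_nat: "0 \<le> l \<Longrightarrow> exp_neg (ennreal l * of_nat k) = exp (- (l * real k))"
  by (simp add: ennreal_of_nat_eq_real_of_nat ennreal_mult'[symmetric] exp_neg_ennreal)

text \<open>The sum of \<open>D1\<close> independent counts of shape \<open>r\<close> has shape
  \<open>r * D1\<close>. No convolution is computed: two measures with the same Laplace transform
  are compared, where the empty past enters as a density in one and as the factor
  \<open>(1 - p) powr (r * D0)\<close> in the other.\<close>

lemma col_law_unseen_future:
  assumes r: "0 < r" and p: "0 < p" "p < 1" and D1: "1 \<le> D1"
  shows "(\<integral>\<^sup>+b. of_bool (past D0 b = 0 \<and> future D0 D1 b = j) \<partial>col_law r p) =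
    ennreal ((1 - p) powr (r * real D0) * pmf (negbin_pmf (r * real D1) p) j)"
proof -
  interpret C: prob_space "col_law r p" by (rule prob_space_col_law)
  define q where "q = (1 - p) powr (r * real D0)"
  define N where "N = measure_pmf (negbin_pmf (r * real D1) p)"
  have rD: "0 < r * real D1" using r D1 by simp
  define M1 where "M1 = distr (density (col_law r p) (\<lambda>b. of_bool (past D0 b = 0))) borel (\<lambda>b. of_nat (future D0 D1 b) :: ennreal)"
  define M2 where "M2 = distr (density N (\<lambda>_. ennreal q)) borel (of_nat :: nat \<Rightarrow> ennreal)"
  have i1: "(\<integral>\<^sup>+x. f x \<partial>M1) = (\<integral>\<^sup>+b. of_bool (past D0 b = 0) * f (of_nat (future D0 D1 b)) \<partial>col_law r p)"
    if [measurable]: "f \<in> borel_measurable borel" for f :: "ennreal \<Rightarrow> ennreal"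
    unfolding M1_def by (simp add: nn_integral_distr nn_integral_density)
  have i2: "(\<integral>\<^sup>+x. f x \<partial>M2) = ennreal q * (\<integral>\<^sup>+k. f (of_nat k) \<partial>N)"
    if [measurable]: "f \<in> borel_measurable borel" for f :: "ennreal \<Rightarrow> ennreal"
    unfolding M2_def by (simp add: nn_integral_distr nn_integral_density nn_integral_cmult N_def)
  have lap: "(\<integral>\<^sup>+x. ennreal (exp_neg (ennreal l * x)) \<partial>M1) = ennreal (q * nb_pgf (r * real D1) l p)"
    "(\<integral>\<^sup>+x. ennreal (exp_neg (ennreal l * x)) \<partial>M2) = ennreal (q * nb_pgf (r * real D1) l p)" if l: "0 \<le> l" for l
    using col_law_unseen[OF r p l, of D0 D1] negbin_laplace[OF rD p l]
    by (simp_all add: i1 i2 exp_neg_of_nat l q_def N_def ennreal_mult')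
  have sets: "sets M1 = sets borel" "sets M2 = sets borel" by (auto simp: M1_def M2_def)
  note [measurable_cong] = sets
  have "M1 = M2"
  proof (rule laplace_unique)
    have "emeasure M1 (space M1) = ennreal (q * nb_pgf (r * real D1) 0 p)"
      "emeasure M2 (space M2) = ennreal (q * nb_pgf (r * real D1) 0 p)"
      using lap[of 0] by auto
    then show "finite_measure M1" "finite_measure M2" by (auto intro!: finite_measureI)
    show "(\<integral>x. exp_neg (ennreal l * x) \<partial>M1) = (\<integral>x. exp_neg (ennreal l * x) \<partial>M2)" if "0 \<le> l" for l
      using lap[OF that] by (simp add: integral_eq_nn_integral)
  qed (auto simp: sets)
  then have "(\<integral>\<^sup>+x. indicator {of_nat j} x \<partial>M1) = (\<integral>\<^sup>+x. indicator {of_nat j} x \<partial>M2)" by simp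
  then have "(\<integral>\<^sup>+b. of_bool (past D0 b = 0) * indicator {of_nat j :: ennreal} (of_nat (future D0 D1 b)) \<partial>col_law r p) =
      ennreal q * (\<integral>\<^sup>+k. indicator {of_nat j :: ennreal} (of_nat k) \<partial>N)"
    by (simp only: i1 i2 borel_measurable_indicator borel_singleton sets.empty_sets)
  also have "(\<integral>\<^sup>+k. indicator {of_nat j :: ennreal} (of_nat k) \<partial>N) = (\<integral>\<^sup>+k. indicator {j} k \<partial>N)"
    by (intro nn_integral_cong) (simp add: indicator_def)
  also have "\<dots> = ennreal (pmf (negbin_pmf (r * real D1) p) j)"
    by (simp add: N_def emeasure_pmf_single)
  also have "(\<integral>\<^sup>+b. of_bool (past D0 b = 0) * indicator {of_nat j :: ennreal} (of_nat (future D0 D1 b)) \<partial>col_law r p) =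
    (\<integral>\<^sup>+b. of_bool (past D0 b = 0 \<and> future D0 D1 b = j) \<partial>col_law r p)"
    by (intro nn_integral_cong) (simp add: indicator_def)
  finally show ?thesis by (simp add: q_def ennreal_mult')
qed

text \<open>Identifies \<open>rho\<close> as the intensity of new units with \<open>j\<close> later
  counts. The probabilities combine to a multiple of
  \<open>p ^ j * (1 - p) powr (r * (D0 + D1))\<close>, and the resulting beta integral converges
  because \<open>j \<ge> 1 > \<sigma>\<close>.\<close>

lemma levy_unseen_future:
  assumes \<sigma>: "0 < \<sigma>" "\<sigma> < 1" and r: "0 < r" and D1: "1 \<le> D1" and j: "1 \<le> j"
  shows "levy_integral \<sigma> r (\<lambda>z. of_bool (past D0 (snd z) = 0 \<and> future D0 D1 (snd z) = j)) = ennreal (rho \<sigma> r D0 D1 j)"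
    and "0 < rho \<sigma> r D0 D1 j"
proof -
  interpret U: prob_space label_law by (rule prob_space_label_law)
  have rD: "0 < r * real D1" using r D1 by simp
  define C where "C = ((real j + r * real D1 - 1) gchoose j)"
  define b where "b = r * (real D0 + real D1)"
  have b: "0 < b" using r D1 by (simp add: b_def)
  have C: "0 < C"
    unfolding C_def gbinomial_prod_rev using rD
    by (intro divide_pos_pos prod_pos) auto
  have rho: "rho \<sigma> r D0 D1 j = C * (\<sigma> * Beta (real j - \<sigma>) (b + 1))"
    by (simp add: rho_def C_def b_def Beta_commute[of "real j - \<sigma>"])
  have "0 < Beta (real j - \<sigma>) (b + 1)"
    unfolding Beta_def using \<sigma> j b by (intro divide_pos_pos mult_pos_pos Gamma_real_pos) auto
  then show "0 < rho \<sigma> r D0 D1 j" using C \<sigma> by (simp add: rho)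
  have "levy_integral \<sigma> r (\<lambda>z. of_bool (past D0 (snd z) = 0 \<and> future D0 D1 (snd z) = j)) =
      (\<integral>\<^sup>+p. ennreal C * (ennreal (p powr (real j) * (1 - p) powr b) * indicator {0<..<1} p) \<partial>stable_intensity \<sigma>)"
    unfolding levy_integral_def
  proof (intro nn_integral_cong)
    fix p :: real
    show "unit_integral r (\<lambda>z. of_bool (past D0 (snd z) = 0 \<and> future D0 D1 (snd z) = j)) p * indicator {0<..<1} p =
        ennreal C * (ennreal (p powr (real j) * (1 - p) powr b) * indicator {0<..<1} p)"
    proof (cases "0 < p \<and> p < 1")
      case True
      then have p: "0 < p" "p < 1" by auto
      have "unit_integral r (\<lambda>z. of_bool (past D0 (snd z) = 0 \<and> future D0 D1 (snd z) = j)) p =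
          ennreal ((1 - p) powr (r * real D0) * pmf (negbin_pmf (r * real D1) p) j)"
        unfolding unit_integral_def snd_conv col_law_unseen_future[OF r p D1] using U.emeasure_space_1 by simp
      also have "(1 - p) powr (r * real D0) * pmf (negbin_pmf (r * real D1) p) j = C * (p powr (real j) * (1 - p) powr b)"
        using p by (simp add: pmf_negbin[OF rD p] C_def b_def powr_add distrib_left powr_realpow)
      finally show ?thesis using p C by (simp add: ennreal_mult')
    qed (auto simp: indicator_def)
  qed
  also have "\<dots> = ennreal C * (\<integral>\<^sup>+p. ennreal (p powr (real j) * (1 - p) powr b) * indicator {0<..<1} p \<partial>stable_intensity \<sigma>)"
    by (rule nn_integral_cmult) measurable
  also have "\<dots> = ennreal C * ennreal (\<sigma> * Beta (real j - \<sigma>) (b + 1))"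
    using \<sigma> j b by (subst stable_beta_integral) auto
  also have "\<dots> = ennreal (rho \<sigma> r D0 D1 j)" using C by (simp add: rho ennreal_mult')
  finally show "levy_integral \<sigma> r (\<lambda>z. of_bool (past D0 (snd z) = 0 \<and> future D0 D1 (snd z) = j)) = ennreal (rho \<sigma> r D0 D1 j)" .
qed

text \<open>The histories of the first \<open>D0\<close> days, padded by zeros so that they form a countable set.\<close>

definition hist :: "nat \<Rightarrow> (nat \<Rightarrow> nat) set" where
  "hist D0 = {a. \<forall>d\<ge>D0. a d = 0}"

lemma countable_hist: "countable (hist D0)"
proof -
  have "hist D0 \<subseteq> (\<lambda>xs d. if d < length xs then xs ! d else 0) ` (UNIV :: nat list set)"
  proof
    fix a assume "a \<in> hist D0"
    then have "a = (\<lambda>d. if d < length (map a [0..<D0]) then map a [0..<D0] ! d else 0)"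
      by (auto simp: hist_def)
    then show "a \<in> (\<lambda>xs d. if d < length xs then xs ! d else 0) ` UNIV" by blast
  qed
  then show ?thesis by (rule countable_subset) simp
qed

text \<open>Only the first \<open>D0\<close> entries matter to \<open>g\<close>, so the integral
  becomes a sum over the countably many histories, while the later days integrate to the generating
  function.\<close>

lemma col_law_hist:
  fixes g :: "(nat \<Rightarrow> nat) \<Rightarrow> ennreal"
  assumes r: "0 < r" and p: "0 < p" "p < 1" and l: "0 \<le> l"
    and g: "g \<in> borel_measurable count_col"
    and cyl: "\<And>b. g b = g (\<lambda>d. if d < D0 then b d else 0)"
  shows "(\<integral>\<^sup>+b. g b * ennreal (exp (- (l * real (future D0 D1 b)))) \<partial>col_law r p) =
    (\<integral>\<^sup>+a. g a * (ennreal (past_weight r D0 a) * ennreal (p powr real (past D0 a) * (1 - p) powr (r * real D0) * nb_pgf (r * real D1) l p))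
      \<partial>count_space (hist D0))"
proof -
  let ?E = "\<lambda>b. ennreal (exp (- (l * real (future D0 D1 b))))"
  let ?tr = "\<lambda>b d. if d < D0 then b d else (0::nat)"
  have "g b * ?E b = (\<integral>\<^sup>+a. g a * (of_bool (\<forall>d<D0. b d = a d) * ?E b) \<partial>count_space (hist D0))" for b
  proof -
    have tr: "?tr b \<in> hist D0" by (simp add: hist_def)
    have "(\<integral>\<^sup>+a. g a * (of_bool (\<forall>d<D0. b d = a d) * ?E b) \<partial>count_space (hist D0)) =
        (\<integral>\<^sup>+a. (g a * ?E b) * indicator {?tr b} a \<partial>count_space (hist D0))"
    proof (rule nn_integral_cong)
      fix a assume "a \<in> space (count_space (hist D0))"
      then have "(\<forall>d<D0. b d = a d) \<longleftrightarrow> a = ?tr b" by (auto simp: hist_def fun_eq_iff)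
      then show "g a * (of_bool (\<forall>d<D0. b d = a d) * ?E b) = (g a * ?E b) * indicator {?tr b} a"
        by (simp add: indicator_def)
    qed
    also have "\<dots> = g (?tr b) * ?E b"
      using tr by (subst nn_integral_indicator_singleton) auto
    finally show ?thesis using cyl[of b] by simp
  qed
  then have "(\<integral>\<^sup>+b. g b * ?E b \<partial>col_law r p) =
      (\<integral>\<^sup>+b. \<integral>\<^sup>+a. g a * (of_bool (\<forall>d<D0. b d = a d) * ?E b) \<partial>count_space (hist D0) \<partial>col_law r p)"
    by simp
  also have "\<dots> = (\<integral>\<^sup>+a. \<integral>\<^sup>+b. g a * (of_bool (\<forall>d<D0. b d = a d) * ?E b) \<partial>col_law r p \<partial>count_space (hist D0))"
    by (rule nn_integral_count_space_nn_integral[OF countable_hist]) measurable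
  also have "\<dots> = (\<integral>\<^sup>+a. g a * (ennreal (past_weight r D0 a) * ennreal (p powr real (past D0 a) * (1 - p) powr (r * real D0) * nb_pgf (r * real D1) l p))
      \<partial>count_space (hist D0))"
  proof (rule nn_integral_cong)
    fix a
    have "(\<integral>\<^sup>+b. g a * (of_bool (\<forall>d<D0. b d = a d) * ?E b) \<partial>col_law r p) =
        g a * ennreal ((\<Prod>d<D0. pmf (negbin_pmf r p) (a d)) * nb_pgf (r * real D1) l p)"
      by (subst nn_integral_cmult) (auto simp: col_law_past_future[OF r p l])
    then show "(\<integral>\<^sup>+b. g a * (of_bool (\<forall>d<D0. b d = a d) * ?E b) \<partial>col_law r p) =
        g a * (ennreal (past_weight r D0 a) * ennreal (p powr real (past D0 a) * (1 - p) powr (r * real D0) * nb_pgf (r * real D1) l p))"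
      using p past_weight_nonneg[OF r] by (simp add: past_prob[OF r p] powr_realpow ennreal_mult'[symmetric] mult.assoc)
  qed
  finally show ?thesis .
qed

text \<open>Against the stable intensity, the factor in front of \<open>nb_pgf\<close> is an
  unnormalised beta density with parameters \<open>m - \<sigma>\<close> and
  \<open>r * D0 + 1\<close>. For \<open>m = 0\<close> and \<open>\<sigma> > 0\<close> the integral
  diverges at \<open>0\<close>, whence the care about unseen marks below.\<close>

definition jump_moment :: "real \<Rightarrow> real \<Rightarrow> nat \<Rightarrow> nat \<Rightarrow> real \<Rightarrow> nat \<Rightarrow> ennreal" where
  "jump_moment \<sigma> r D0 D1 l m = (\<integral>\<^sup>+p. ennreal (p powr real m * (1 - p) powr (r * real D0) * nb_pgf (r * real D1) l p)
     * indicator {0<..<1} p \<partial>stable_intensity \<sigma>)"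

text \<open>Splits a mark into label, history and weight, with the integral over the weight
  innermost; that integral depends on the history through its total only. The exchange is Tonelli's
  theorem, with infinite values allowed, and countability of the histories makes the integrand
  jointly measurable.\<close>

lemma levy_disintegration:
  fixes \<phi> :: "real \<times> (nat \<Rightarrow> nat) \<Rightarrow> ennreal"
  assumes r: "0 < r" and l: "0 \<le> l"
    and \<phi>[measurable]: "\<phi> \<in> borel_measurable (borel \<Otimes>\<^sub>M count_col)"
    and cyl: "\<And>u b. \<phi> (u, b) = \<phi> (u, \<lambda>d. if d < D0 then b d else 0)"
  shows "levy_integral \<sigma> r (\<lambda>z. \<phi> z * ennreal (exp (- (l * real (future D0 D1 (snd z)))))) =
    (\<integral>\<^sup>+u. \<integral>\<^sup>+a. \<phi> (u, a) * (ennreal (past_weight r D0 a) * jump_moment \<sigma> r D0 D1 l (past D0 a)) \<partial>count_space (hist D0) \<partial>label_law)"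
proof -
  interpret S: sigma_finite_measure "stable_intensity \<sigma>" by (rule sigma_finite_stable_intensity)
  interpret U: prob_space label_law by (rule prob_space_label_law)
  interpret SU: pair_sigma_finite "stable_intensity \<sigma>" label_law ..
  interpret V: sigma_finite_measure "count_space (hist D0)"
    by (rule sigma_finite_measure_count_space_countable[OF countable_hist])
  define W where "W a p = ennreal (p powr real (past D0 a) * (1 - p) powr (r * real D0) * nb_pgf (r * real D1) l p)" for a p
  have [measurable]: "W a \<in> borel_measurable borel" for a unfolding W_def by measurable
  have \<phi>a[measurable]: "(\<lambda>u. \<phi> (u, a)) \<in> borel_measurable borel" for a
    by (rule measurable_compose[OF _ \<phi>]) (simp add: space_PiM)
  define H where "H p u = (\<integral>\<^sup>+a. \<phi> (u, a) * (ennreal (past_weight r D0 a) * (W a p * indicator {0<..<1} p)) \<partial>count_space (hist D0))" for p u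
  have Hm: "case_prod H \<in> borel_measurable (stable_intensity \<sigma> \<Otimes>\<^sub>M label_law)"
  proof -
    have "(\<lambda>(q, a). \<phi> (snd q, a) * (ennreal (past_weight r D0 a) * (W a (fst q) * indicator {0<..<1} (fst q))))
        \<in> borel_measurable ((stable_intensity \<sigma> \<Otimes>\<^sub>M label_law) \<Otimes>\<^sub>M count_space (hist D0))"
      unfolding split_beta'
    proof (rule measurable_compose_countable'[OF _ measurable_snd countable_hist])
      fix a
      have "(\<lambda>x. \<phi> (snd (fst x), a)) \<in> borel_measurable ((stable_intensity \<sigma> \<Otimes>\<^sub>M label_law) \<Otimes>\<^sub>M count_space (hist D0))"
        by (rule measurable_compose[OF _ \<phi>a]) (simp cong: measurable_cong_sets)
      then show "(\<lambda>x. \<phi> (snd (fst x), a) * (ennreal (past_weight r D0 a) * (W a (fst (fst x)) * indicator {0<..<1} (fst (fst x)))))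
          \<in> borel_measurable ((stable_intensity \<sigma> \<Otimes>\<^sub>M label_law) \<Otimes>\<^sub>M count_space (hist D0))"
        by measurable
    qed
    from V.borel_measurable_nn_integral_fst[OF this] show ?thesis
      by (simp add: H_def split_beta')
  qed
  have "levy_integral \<sigma> r (\<lambda>z. \<phi> z * ennreal (exp (- (l * real (future D0 D1 (snd z)))))) =
      (\<integral>\<^sup>+p. \<integral>\<^sup>+u. H p u \<partial>label_law \<partial>stable_intensity \<sigma>)"
    unfolding levy_integral_def
  proof (rule nn_integral_cong)
    fix p :: real
    show "unit_integral r (\<lambda>z. \<phi> z * ennreal (exp (- (l * real (future D0 D1 (snd z)))))) p * indicator {0<..<1} p =
        (\<integral>\<^sup>+u. H p u \<partial>label_law)"
    proof (cases "0 < p \<and> p < 1")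
      case True
      then show ?thesis
        unfolding unit_integral_def H_def W_def
        using col_law_hist[OF r _ _ l, of p "\<lambda>b. \<phi> (_, b)", OF _ _ _ cyl]
        by (simp add: measurable_compose[OF _ \<phi>])
    qed (auto simp: H_def indicator_def)
  qed
  also have "\<dots> = (\<integral>\<^sup>+u. \<integral>\<^sup>+p. H p u \<partial>stable_intensity \<sigma> \<partial>label_law)"
    by (rule SU.Fubini'[OF Hm, symmetric])
  also have "\<dots> = (\<integral>\<^sup>+u. \<integral>\<^sup>+a. \<phi> (u, a) * (ennreal (past_weight r D0 a) * jump_moment \<sigma> r D0 D1 l (past D0 a)) \<partial>count_space (hist D0) \<partial>label_law)"
  proof (rule nn_integral_cong)
    fix u
    have "(\<integral>\<^sup>+p. H p u \<partial>stable_intensity \<sigma>) =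
        (\<integral>\<^sup>+a. \<integral>\<^sup>+p. \<phi> (u, a) * (ennreal (past_weight r D0 a) * (W a p * indicator {0<..<1} p)) \<partial>stable_intensity \<sigma> \<partial>count_space (hist D0))"
      unfolding H_def by (rule nn_integral_count_space_nn_integral[OF countable_hist]) measurable
    also have "\<dots> = (\<integral>\<^sup>+a. \<phi> (u, a) * (ennreal (past_weight r D0 a) * jump_moment \<sigma> r D0 D1 l (past D0 a)) \<partial>count_space (hist D0))"
      by (intro nn_integral_cong) (simp add: nn_integral_cmult jump_moment_def W_def)
    finally show "(\<integral>\<^sup>+p. H p u \<partial>stable_intensity \<sigma>) = \<dots>" .
  qed
  finally show ?thesis .
qed

section \<open>Conjugacy of the beta and the negative binomial law\<close>

definition bnb_laplace :: "real \<Rightarrow> real \<Rightarrow> nat \<Rightarrow> nat \<Rightarrow> real \<Rightarrow> nat \<Rightarrow> ennreal" where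
  "bnb_laplace \<sigma> r D0 D1 l m = (\<integral>\<^sup>+z. ennreal (exp (- (l * real (snd z))))
     \<partial>beta_negbin_law (real m - \<sigma>) (r * real D0 + 1) (r * real D1))"

lemma sets_beta_law[measurable_cong, simp]: "sets (beta_law a b) = sets borel"
  by (simp add: beta_law_def)

lemma prob_space_beta_law:
  assumes "0 < a" "0 < b"
  shows "prob_space (beta_law a b)"
proof (rule prob_spaceI)
  have B: "0 < Beta a b" using assms by (simp add: Beta_def Gamma_real_pos)
  have "emeasure (beta_law a b) (space (beta_law a b)) =
      (\<integral>\<^sup>+x. ennreal (1 / Beta a b) * (ennreal (x powr (a - 1) * (1 - x) powr (b - 1)) * indicator {0..1} x) \<partial>lborel)"
    unfolding beta_law_def using B
    by (subst emeasure_density)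
      (auto intro!: nn_integral_cong_AE eventually_mono[OF AE_conjI[OF AE_lborel_singleton[of 0] AE_lborel_singleton[of 1]]]
        simp: indicator_def ennreal_mult'[symmetric])
  also have "\<dots> = ennreal (1 / Beta a b) * (\<integral>\<^sup>+x. ennreal (x powr (a - 1) * (1 - x) powr (b - 1)) * indicator {0..1} x \<partial>lborel)"
    by (rule nn_integral_cmult) measurable
  also have "(\<integral>\<^sup>+x. ennreal (x powr (a - 1) * (1 - x) powr (b - 1)) * indicator {0..1} x \<partial>lborel) = ennreal (Beta a b)"
    by (rule nn_integral_has_integral_lebesgue'[OF _ has_integral_Beta_real[OF assms]]) auto
  finally show "emeasure (beta_law a b) (space (beta_law a b)) = 1"
    using B by (simp add: ennreal_mult'[symmetric])
qed

lemma beta_negbin_kernel: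
  "(\<lambda>J. distr (measure_pmf (negbin_pmf s J)) (borel \<Otimes>\<^sub>M count_space UNIV) (\<lambda>x. (J, x)))
    \<in> measurable borel (prob_algebra (borel \<Otimes>\<^sub>M count_space UNIV))"
  by (rule measurable_distr_prob_space2[OF negbin_kernel]) simp

lemma
  assumes ab: "0 < a" "0 < b"
  shows prob_space_beta_negbin_law: "prob_space (beta_negbin_law a b s)"
    and sets_beta_negbin_law: "sets (beta_negbin_law a b s) = sets (borel \<Otimes>\<^sub>M count_space UNIV)"
proof -
  have "beta_law a b \<in> space (prob_algebra borel)"
    using prob_space_beta_law[OF ab] by (simp add: space_prob_algebra)
  from measurable_space[OF measurable_bind_prob_space[OF measurable_const[OF this, of "count_space {undefined}"] beta_negbin_kernel], of undefined]
  show "prob_space (beta_negbin_law a b s)" "sets (beta_negbin_law a b s) = sets (borel \<Otimes>\<^sub>M count_space UNIV)"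
    by (simp_all add: space_prob_algebra beta_negbin_law_def)
qed

text \<open>Normalised by its value at \<open>l = 0\<close>, the weight in
  \<open>jump_moment\<close> is the beta density, and averaging \<open>nb_pgf\<close> over it gives
  the transform of the beta mixture. The condition \<open>m \<ge> 1\<close> keeps
  \<open>m - \<sigma>\<close> positive.\<close>

lemma bnb_laplace_moment:
  assumes \<sigma>: "0 < \<sigma>" "\<sigma> < 1" and r: "0 < r" and D1: "1 \<le> D1" and m: "1 \<le> m" and l: "0 \<le> l"
  shows "jump_moment \<sigma> r D0 D1 l m = jump_moment \<sigma> r D0 D1 0 m * bnb_laplace \<sigma> r D0 D1 l m"
proof -
  define a b s where "a = real m - \<sigma>" and "b = r * real D0 + 1" and "s = r * real D1"
  have s: "0 < s" using r D1 by (simp add: s_def)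
  have ab: "0 < a" "0 < b" using \<sigma> m r by (auto simp: a_def b_def add_nonneg_pos)
  have B: "0 < Beta a b" using ab by (simp add: Beta_def Gamma_real_pos)
  have K: "(\<lambda>J. distr (measure_pmf (negbin_pmf s J)) (borel \<Otimes>\<^sub>M count_space UNIV) (\<lambda>x. (J, x)))
    \<in> measurable (beta_law a b) (subprob_algebra (borel \<Otimes>\<^sub>M count_space UNIV))"
    using measurable_prob_algebraD[OF beta_negbin_kernel] by (simp cong: measurable_cong_sets)
  have "bnb_laplace \<sigma> r D0 D1 l m = (\<integral>\<^sup>+z. ennreal (exp (- (l * real (snd z)))) \<partial>beta_negbin_law a b s)"
    by (simp add: bnb_laplace_def a_def b_def s_def)
  also have "\<dots> = (\<integral>\<^sup>+J. \<integral>\<^sup>+z. ennreal (exp (- (l * real (snd z)))) \<partial>distr (measure_pmf (negbin_pmf s J)) (borel \<Otimes>\<^sub>M count_space UNIV) (\<lambda>x. (J, x)) \<partial>beta_law a b)"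
    unfolding beta_negbin_law_def by (rule nn_integral_bind[OF _ K]) measurable
  also have "\<dots> = (\<integral>\<^sup>+J. \<integral>\<^sup>+x. ennreal (exp (- (l * real x))) \<partial>measure_pmf (negbin_pmf s J) \<partial>beta_law a b)"
    by (intro nn_integral_cong, subst nn_integral_distr) (auto simp: space_pair_measure)
  also have "\<dots> = (\<integral>\<^sup>+J. ennreal (indicator {0<..<1} J * J powr (a - 1) * (1 - J) powr (b - 1) / Beta a b) *
      (\<integral>\<^sup>+x. ennreal (exp (- (l * real x))) \<partial>measure_pmf (negbin_pmf s J)) \<partial>lborel)"
    unfolding beta_law_def
  proof (rule nn_integral_density)
    show "(\<lambda>J. \<integral>\<^sup>+x. ennreal (exp (- (l * real x))) \<partial>measure_pmf (negbin_pmf s J)) \<in> borel_measurable lborel"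
      using measurable_compose[OF measurable_prob_algebraD[OF negbin_kernel] nn_integral_measurable_subprob_algebra, of "\<lambda>x. ennreal (exp (- (l * real x)))" s]
      by simp
  qed measurable
  also have "\<dots> = (\<integral>\<^sup>+J. ennreal (J powr (a - 1) * (1 - J) powr (b - 1) / Beta a b * nb_pgf s l J) * indicator {0<..<1} J \<partial>lborel)"
    using B by (intro nn_integral_cong) (auto simp: indicator_def negbin_laplace[OF s _ _ l] ennreal_mult'[symmetric] ennreal_mult''[symmetric])
  finally have bl: "bnb_laplace \<sigma> r D0 D1 l m = \<dots>" .
  have mom: "jump_moment \<sigma> r D0 D1 l' m = (\<integral>\<^sup>+p. ennreal (\<sigma> * (p powr (a - 1) * (1 - p) powr (b - 1)) * nb_pgf s l' p) * indicator {0<..<1} p \<partial>lborel)" for l'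
    unfolding jump_moment_def stable_intensity_def using \<sigma>
    by (subst nn_integral_density)
      (auto intro!: nn_integral_cong simp: indicator_def ennreal_mult'[symmetric] powr_add[symmetric] a_def b_def s_def algebra_simps)
  have "jump_moment \<sigma> r D0 D1 0 m = (\<integral>\<^sup>+p. ennreal (p powr real m * (1 - p) powr (r * real D0)) * indicator {0<..<1} p \<partial>stable_intensity \<sigma>)"
    unfolding jump_moment_def by (intro nn_integral_cong) (auto simp: indicator_def nb_pgf_0)
  also have "\<dots> = ennreal (\<sigma> * Beta a b)"
    unfolding a_def b_def using ab \<sigma> by (intro stable_beta_integral) (auto simp: a_def b_def)
  finally have "jump_moment \<sigma> r D0 D1 0 m * bnb_laplace \<sigma> r D0 D1 l m =
      (\<integral>\<^sup>+J. ennreal (\<sigma> * Beta a b) * (ennreal (J powr (a - 1) * (1 - J) powr (b - 1) / Beta a b * nb_pgf s l J) * indicator {0<..<1} J) \<partial>lborel)"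
    unfolding bl by (subst nn_integral_cmult) auto
  also have "\<dots> = jump_moment \<sigma> r D0 D1 l m"
    unfolding mom using B \<sigma> by (intro nn_integral_cong) (auto simp: indicator_def ennreal_mult'[symmetric])
  finally show ?thesis ..
qed

text \<open>Under the intensity, the later counts of a seen unit may be replaced by the beta mixture
  transform that belongs to its past total. After disintegration this is
  \<open>bnb_laplace_moment\<close> history by history; disintegrating backwards with
  \<open>l = 0\<close> removes the later days.\<close>

lemma levy_future:
  fixes \<phi> :: "real \<times> (nat \<Rightarrow> nat) \<Rightarrow> ennreal"
  assumes \<sigma>: "0 < \<sigma>" "\<sigma> < 1" and r: "0 < r" and D1: "1 \<le> D1" and l: "0 \<le> l"
    and \<phi>[measurable]: "\<phi> \<in> borel_measurable (borel \<Otimes>\<^sub>M count_col)"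
    and cyl: "\<And>u b. \<phi> (u, b) = \<phi> (u, \<lambda>d. if d < D0 then b d else 0)"
    and seen: "\<And>u b. past D0 b = 0 \<Longrightarrow> \<phi> (u, b) = 0"
  shows "levy_integral \<sigma> r (\<lambda>z. \<phi> z * ennreal (exp (- (l * real (future D0 D1 (snd z)))))) =
    levy_integral \<sigma> r (\<lambda>z. \<phi> z * bnb_laplace \<sigma> r D0 D1 l (past D0 (snd z)))"
proof -
  define \<phi>' where "\<phi>' z = \<phi> z * bnb_laplace \<sigma> r D0 D1 l (past D0 (snd z))" for z
  have [measurable]: "\<phi>' \<in> borel_measurable (borel \<Otimes>\<^sub>M count_col)" unfolding \<phi>'_def by measurable
  have cyl': "\<phi>' (u, b) = \<phi>' (u, \<lambda>d. if d < D0 then b d else 0)" for u b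
    using cyl[of u b] by (simp add: \<phi>'_def past_def)
  have "levy_integral \<sigma> r (\<lambda>z. \<phi> z * ennreal (exp (- (l * real (future D0 D1 (snd z)))))) =
      (\<integral>\<^sup>+u. \<integral>\<^sup>+a. \<phi> (u, a) * (ennreal (past_weight r D0 a) * jump_moment \<sigma> r D0 D1 l (past D0 a)) \<partial>count_space (hist D0) \<partial>label_law)"
    by (rule levy_disintegration[OF r l \<phi> cyl])
  also have "\<dots> = (\<integral>\<^sup>+u. \<integral>\<^sup>+a. \<phi>' (u, a) * (ennreal (past_weight r D0 a) * jump_moment \<sigma> r D0 D1 0 (past D0 a)) \<partial>count_space (hist D0) \<partial>label_law)"
  proof (intro nn_integral_cong)
    fix u a
    show "\<phi> (u, a) * (ennreal (past_weight r D0 a) * jump_moment \<sigma> r D0 D1 l (past D0 a)) =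
        \<phi>' (u, a) * (ennreal (past_weight r D0 a) * jump_moment \<sigma> r D0 D1 0 (past D0 a))"
    proof (cases "past D0 a = 0")
      case True then show ?thesis using seen by (simp add: \<phi>'_def)
    next
      case False
      then have "1 \<le> past D0 a" by simp
      from bnb_laplace_moment[OF \<sigma> r D1 this l, of D0] show ?thesis
        by (simp add: \<phi>'_def mult_ac)
    qed
  qed
  also have "\<dots> = levy_integral \<sigma> r (\<lambda>z. \<phi>' z * ennreal (exp (- (0 * real (future D0 D1 (snd z))))))"
    by (rule levy_disintegration[OF r order_refl _ cyl', symmetric]) measurable
  finally show ?thesis by (simp add: \<phi>'_def)
qed

subsection \<open>Laplace functionals jointly with the observed days\<close>

lemma levy_integral_add:
  assumes [measurable]: "k \<in> borel_measurable (borel \<Otimes>\<^sub>M count_col)" "k' \<in> borel_measurable (borel \<Otimes>\<^sub>M count_col)"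
  shows "levy_integral \<sigma> r (\<lambda>z. k z + k' z) = levy_integral \<sigma> r k + levy_integral \<sigma> r k'"
  unfolding levy_integral_def unit_integral_add[OF assms] distrib_right
  by (rule nn_integral_add) measurable

lemma unit_integral_cmult:
  assumes [measurable]: "k \<in> borel_measurable (borel \<Otimes>\<^sub>M count_col)"
  shows "unit_integral r (\<lambda>z. a * k z) p = a * unit_integral r k p"
proof -
  have "(\<lambda>b. k (u, b)) \<in> borel_measurable (col_law r p)" for u by measurable
  then show ?thesis by (simp add: unit_integral_def nn_integral_cmult)
qed

lemma levy_integral_cmult:
  assumes [measurable]: "k \<in> borel_measurable (borel \<Otimes>\<^sub>M count_col)"
  shows "levy_integral \<sigma> r (\<lambda>z. a * k z) = a * levy_integral \<sigma> r k"
  unfolding levy_integral_def unit_integral_cmult[OF assms] mult.assoc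
  by (rule nn_integral_cmult) measurable

lemma levy_integral_mono: "(\<And>z. k z \<le> k' z) \<Longrightarrow> levy_integral \<sigma> r k \<le> levy_integral \<sigma> r k'"
  unfolding levy_integral_def unit_integral_def
  by (intro nn_integral_mono mult_right_mono) auto

text \<open>A list stands for the sum of the counts that the listed days put into the listed sets.
  Repetitions act as multiplicities and concatenation adds, so the exponentials of such sums are
  closed under products. Days count from \<open>1\<close>, columns from \<open>0\<close>, hence
  \<open>d - 1\<close>.\<close>

definition mark_sum :: "(nat \<times> real set) list \<Rightarrow> real \<times> (nat \<Rightarrow> nat) \<Rightarrow> ennreal" where
  "mark_sum xs z = (\<Sum>(d, B)\<leftarrow>xs. of_nat (snd z (d - 1)) * indicator B (fst z))"

definition valid_days :: "nat \<Rightarrow> (nat \<times> real set) list \<Rightarrow> bool" where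
  "valid_days D xs \<longleftrightarrow> (\<forall>(d, B)\<in>set xs. d \<in> {1..D} \<and> B \<in> sets borel)"

lemma mark_sum_measurable[measurable]:
  assumes "valid_days D xs"
  shows "mark_sum xs \<in> borel_measurable (borel \<Otimes>\<^sub>M count_col)"
  using assms
proof (induction xs)
  case Nil
  then show ?case by (simp add: mark_sum_def[abs_def])
next
  case (Cons x xs)
  obtain d B where x: "x = (d, B)" by (cases x)
  have [measurable]: "B \<in> sets borel" using Cons.prems by (auto simp: valid_days_def x)
  have [measurable]: "mark_sum xs \<in> borel_measurable (borel \<Otimes>\<^sub>M count_col)"
    using Cons by (auto simp: valid_days_def)
  have "mark_sum (x # xs) = (\<lambda>z. of_nat (snd z (d - 1)) * indicator B (fst z) + mark_sum xs z)"
    by (simp add: mark_sum_def[abs_def] x)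
  then show ?case by simp
qed

lemma mark_sum_cyl:
  assumes "valid_days D xs"
  shows "mark_sum xs (u, b) = mark_sum xs (u, \<lambda>d. if d < D then b d else 0)"
  using assms unfolding mark_sum_def valid_days_def
  by (intro arg_cong[where f=sum_list] map_cong) auto

lemma mark_sum_unseen:
  assumes "valid_days D xs" "past D (snd z) = 0" shows "mark_sum xs z = 0"
proof -
  have "snd z d = 0" if "d < D" for d using assms(2) that by (simp add: past_def)
  then show ?thesis using assms(1) unfolding mark_sum_def valid_days_def
    by (induction xs) auto
qed

lemma mark_sum_append: "mark_sum (xs @ ys) z = mark_sum xs z + mark_sum ys z"
  by (simp add: mark_sum_def)

lemma bnb_laplace_le_1:
  assumes \<sigma>: "0 < \<sigma>" "\<sigma> < 1" and "0 < r" "1 \<le> m" "0 \<le> l"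
  shows "bnb_laplace \<sigma> r D0 D1 l m \<le> 1"
proof -
  interpret prob_space "beta_negbin_law (real m - \<sigma>) (r * real D0 + 1) (r * real D1)"
    using assms by (intro prob_space_beta_negbin_law) (auto simp: add_nonneg_pos)
  have "bnb_laplace \<sigma> r D0 D1 l m \<le> (\<integral>\<^sup>+z. 1 \<partial>beta_negbin_law (real m - \<sigma>) (r * real D0 + 1) (r * real D1))"
    unfolding bnb_laplace_def using assms by (intro nn_integral_mono) auto
  then show ?thesis by (simp add: emeasure_space_1)
qed

locale sbsp_nbp_days = sbsp_nbp +
  fixes D0 D1 :: nat
  assumes D0: "1 \<le> D0" and D1: "1 \<le> D1"
begin

definition day_sum :: "(nat \<times> real set) list \<Rightarrow> 'a \<Rightarrow> ennreal" where
  "day_sum xs \<omega> = (\<Sum>n. mark_sum xs (unit_mark \<omega> n))"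

definition seen :: "real \<times> (nat \<Rightarrow> nat) \<Rightarrow> bool" where "seen z \<longleftrightarrow> 0 < past D0 (snd z)"

lemma seen_measurable[measurable]: "Measurable.pred (borel \<Otimes>\<^sub>M count_col) seen"
  unfolding seen_def[abs_def] by measurable

abbreviation "\<psi> \<equiv> psi \<sigma> r 0 (real D0)"

lemma psi_nonneg: "0 \<le> \<psi>" by (rule psi_integral(2)[OF \<sigma> r D0])

lemma levy_seen': "levy_integral \<sigma> r (\<lambda>z. of_bool (seen z)) = ennreal \<psi>"
  unfolding seen_def by (rule levy_seen[OF \<sigma> r D0])

lemma exp_neg_add_suminf:
  "exp_neg (\<Sum>n. f n) * exp_neg (\<Sum>n. g n) = exp_neg (\<Sum>n. f n + g n)"
  by (simp add: exp_neg_add[symmetric] suminf_add[symmetric])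

text \<open>The constant \<open>q\<close> is chosen such that \<open>q powr (N + c + 1)\<close> is the generating function at \<open>exp (-l)\<close>
  of the claimed negative binomial law when \<open>N\<close> units have been seen. This makes both sides
  Laplace functionals of the unit marks.\<close>

lemma unseen_future_laplace:
  fixes j :: nat
  assumes j: "1 \<le> j" and xs: "valid_days D0 xs" and l: "0 \<le> l"
  defines "q \<equiv> (\<beta> + \<psi>) / (\<beta> + \<psi> + rho \<sigma> r D0 D1 j * (1 - exp (- l)))"
  shows "(\<integral>\<omega>. exp_neg (day_sum xs \<omega>) * exp_neg (ennreal l * (\<Sum>n. of_bool (past D0 (snd (unit_mark \<omega> n)) = 0 \<and> future D0 D1 (snd (unit_mark \<omega> n)) = j))) \<partial>M)
    = (\<integral>\<omega>. exp_neg (day_sum xs \<omega>) * (q powr (c + 1) * exp_neg (\<Sum>n. neg_ln q * of_bool (seen (unit_mark \<omega> n)))) \<partial>M)"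
proof -
  define \<rho> where "\<rho> = rho \<sigma> r D0 D1 j"
  define k where "k = 1 - exp (- l)"
  have k: "0 \<le> k" using l by (simp add: k_def)
  have \<rho>: "0 < \<rho>" unfolding \<rho>_def by (rule levy_unseen_future(2)[OF \<sigma> r D1 j])
  have qq: "q = (\<beta> + \<psi>) / (\<beta> + \<psi> + \<rho> * k)" by (simp add: q_def \<rho>_def k_def)
  have pos: "0 < \<beta> + \<psi>" using psi_nonneg \<beta> by simp
  have den: "\<beta> + \<psi> \<le> \<beta> + \<psi> + \<rho> * k" using \<rho> k by simp
  have q: "0 < q" "q \<le> 1" unfolding qq using pos den by (auto simp: divide_le_eq_1)
  define V where "V z \<longleftrightarrow> past D0 (snd z) = 0 \<and> future D0 D1 (snd z) = j" for z :: "real \<times> (nat \<Rightarrow> nat)"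
  have [measurable]: "Measurable.pred (borel \<Otimes>\<^sub>M count_col) V" unfolding V_def[abs_def] by measurable
  have [measurable]: "mark_sum xs \<in> borel_measurable (borel \<Otimes>\<^sub>M count_col)" by (rule mark_sum_measurable[OF xs])
  define F1 where "F1 z = mark_sum xs z + ennreal l * of_bool (V z)" for z
  define F2 where "F2 z = mark_sum xs z + neg_ln q * of_bool (seen z)" for z
  have [measurable]: "F1 \<in> borel_measurable (borel \<Otimes>\<^sub>M count_col)" "F2 \<in> borel_measurable (borel \<Otimes>\<^sub>M count_col)"
    unfolding F1_def F2_def by measurable
  \<comment> \<open>Sums over the observed days vanish on unseen marks and \<open>V\<close> holds on
    unseen marks only, so the two exponents in \<open>F1\<close> never meet on one mark.
    \<open>H\<close> is the part that stems from the days; of its integral \<open>h\<close> only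
    finiteness matters.\<close>
  define H where "H z = ennreal (1 - exp_neg (mark_sum xs z)) * of_bool (seen z)" for z
  have [measurable]: "H \<in> borel_measurable (borel \<Otimes>\<^sub>M count_col)" unfolding H_def by measurable
  have "levy_integral \<sigma> r H \<le> ennreal \<psi>"
    unfolding levy_seen'[symmetric] by (rule levy_integral_mono) (simp add: H_def)
  then obtain h where h: "levy_integral \<sigma> r H = ennreal h" "0 \<le> h"
    by (cases "levy_integral \<sigma> r H") (auto simp: top_unique)
  have un: "mark_sum xs z = 0" if "\<not> seen z" for z
    using mark_sum_unseen[OF xs, of z] that by (simp add: seen_def)
  have e1: "ennreal (1 - exp_neg (F1 z)) = H z + ennreal k * of_bool (V z)" for z
  proof (cases "seen z")
    case True
    then have "\<not> V z" by (simp add: seen_def V_def)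
    then show ?thesis using True by (simp add: F1_def H_def)
  next
    case False
    then show ?thesis using l by (simp add: F1_def H_def un exp_neg_ennreal k_def)
  qed
  have e2: "ennreal (1 - exp_neg (F2 z)) = ennreal (1 - q) * of_bool (seen z) + ennreal q * H z" for z
  proof (cases "seen z")
    case True
    have "1 - exp_neg (F2 z) = (1 - q) + q * (1 - exp_neg (mark_sum xs z))"
      using True q by (simp add: F2_def exp_neg_add exp_neg_neg_ln algebra_simps)
    then have "ennreal (1 - exp_neg (F2 z)) = ennreal ((1 - q) + q * (1 - exp_neg (mark_sum xs z)))" by (simp only:)
    also have "\<dots> = ennreal (1 - q) + ennreal (q * (1 - exp_neg (mark_sum xs z)))"
      using q by (intro ennreal_plus) auto
    finally show ?thesis using True q by (simp add: H_def ennreal_mult')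
  next
    case False then show ?thesis by (simp add: F2_def H_def un)
  qed
  have l1: "levy_integral \<sigma> r (\<lambda>z. ennreal (1 - exp_neg (F1 z))) = ennreal (h + k * \<rho>)"
    unfolding e1 using levy_unseen_future(1)[OF \<sigma> r D1 j] h k \<rho>
    by (simp add: levy_integral_add levy_integral_cmult V_def \<rho>_def ennreal_mult')
  have l2: "levy_integral \<sigma> r (\<lambda>z. ennreal (1 - exp_neg (F2 z))) = ennreal ((1 - q) * \<psi> + q * h)"
    unfolding e2 using h q psi_nonneg
    by (simp add: levy_integral_add levy_integral_cmult levy_seen' ennreal_mult' ennreal_plus[symmetric] del: ennreal_plus)
      (simp add: ennreal_mult'[symmetric] ennreal_plus[symmetric] del: ennreal_plus)
  have "(\<integral>\<omega>. exp_neg (day_sum xs \<omega>) * exp_neg (ennreal l * (\<Sum>n. of_bool (V (unit_mark \<omega> n)))) \<partial>M) =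
      (\<integral>\<omega>. exp_neg (\<Sum>n. F1 (unit_mark \<omega> n)) \<partial>M)"
    unfolding day_sum_def ennreal_suminf_cmult[symmetric] exp_neg_add_suminf F1_def ..
  also have "\<dots> = (\<beta> / (\<beta> + (h + k * \<rho>))) powr (c + 1)"
    by (rule NBP_laplace[OF _ l1]) (use h k \<rho> in auto)
  also have "\<beta> / (\<beta> + (h + k * \<rho>)) = q * (\<beta> / (\<beta> + ((1 - q) * \<psi> + q * h)))"
  proof -
    \<comment> \<open>This equation determines \<open>q\<close>: it makes the two denominators
      proportional with ratio \<open>q\<close>, whatever the value of \<open>h\<close>.\<close>
    have "q * (\<beta> + \<psi> + \<rho> * k) = \<beta> + \<psi>" unfolding qq using pos den by simp
    then have e: "\<beta> + ((1 - q) * \<psi> + q * h) = q * (\<beta> + (h + k * \<rho>))" by (simp add: algebra_simps)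
    show ?thesis unfolding e using q by simp
  qed
  also have "\<dots> powr (c + 1) = q powr (c + 1) * (\<beta> / (\<beta> + ((1 - q) * \<psi> + q * h))) powr (c + 1)"
    by (rule powr_mult)
  also have "(\<beta> / (\<beta> + ((1 - q) * \<psi> + q * h))) powr (c + 1) = (\<integral>\<omega>. exp_neg (\<Sum>n. F2 (unit_mark \<omega> n)) \<partial>M)"
    by (rule NBP_laplace[OF _ l2, symmetric]) (use h q psi_nonneg in auto)
  also have "q powr (c + 1) * \<dots> = (\<integral>\<omega>. exp_neg (day_sum xs \<omega>) * (q powr (c + 1) * exp_neg (\<Sum>n. neg_ln q * of_bool (seen (unit_mark \<omega> n)))) \<partial>M)"
    unfolding F2_def exp_neg_add_suminf[symmetric] day_sum_def by (simp add: mult_ac flip: Bochner_Integration.integral_mult_right_zero)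
  finally show ?thesis by (simp add: V_def)
qed

text \<open>Both exponents live on the seen marks, which have finite mass \<open>\<psi>\<close>. So
  it suffices to compare the integrals of \<open>exp (- F1)\<close> and \<open>exp (- F2)\<close>
  over seen marks, and these agree by \<open>levy_future\<close>; over all marks they would be
  infinite.\<close>

lemma seen_future_laplace:
  assumes xs: "valid_days D0 xs" and l: "0 \<le> l"
  shows "(\<integral>\<omega>. exp_neg (day_sum xs \<omega>) * exp_neg (ennreal l * (\<Sum>n. of_nat (future D0 D1 (snd (unit_mark \<omega> n))) * of_bool (seen (unit_mark \<omega> n)))) \<partial>M)
    = (\<integral>\<omega>. exp_neg (day_sum xs \<omega>) * exp_neg (\<Sum>n. neg_ln (enn2real (bnb_laplace \<sigma> r D0 D1 l (past D0 (snd (unit_mark \<omega> n))))) * of_bool (seen (unit_mark \<omega> n))) \<partial>M)"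
proof -
  have [measurable]: "mark_sum xs \<in> borel_measurable (borel \<Otimes>\<^sub>M count_col)" by (rule mark_sum_measurable[OF xs])
  define hl where "hl m = bnb_laplace \<sigma> r D0 D1 l m" for m
  define F1 where "F1 z = mark_sum xs z + ennreal l * (of_nat (future D0 D1 (snd z)) * of_bool (seen z))" for z
  define F2 where "F2 z = mark_sum xs z + neg_ln (enn2real (hl (past D0 (snd z)))) * of_bool (seen z)" for z
  have [measurable]: "F1 \<in> borel_measurable (borel \<Otimes>\<^sub>M count_col)" "F2 \<in> borel_measurable (borel \<Otimes>\<^sub>M count_col)"
    unfolding F1_def F2_def by measurable
  define \<phi> where "\<phi> z = ennreal (exp_neg (mark_sum xs z)) * of_bool (seen z)" for z
  have [measurable]: "\<phi> \<in> borel_measurable (borel \<Otimes>\<^sub>M count_col)" unfolding \<phi>_def by measurable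
  have un: "mark_sum xs z = 0" if "\<not> seen z" for z
    using mark_sum_unseen[OF xs, of z] that by (simp add: seen_def)
  have f1: "ennreal (exp_neg (F1 z)) * of_bool (seen z) = \<phi> z * ennreal (exp (- (l * real (future D0 D1 (snd z)))))" for z
    using l by (simp add: F1_def \<phi>_def exp_neg_add exp_neg_of_nat ennreal_mult')
  have f2: "ennreal (exp_neg (F2 z)) * of_bool (seen z) = \<phi> z * hl (past D0 (snd z))" for z
  proof (cases "seen z")
    case True
    then have "hl (past D0 (snd z)) \<le> 1"
      unfolding hl_def seen_def using \<sigma> r l by (intro bnb_laplace_le_1) auto
    then obtain a where "hl (past D0 (snd z)) = ennreal a" "0 \<le> a" "a \<le> 1"
      by (cases "hl (past D0 (snd z))") (auto simp: top_unique)
    then show ?thesis using True by (simp add: F2_def \<phi>_def exp_neg_add exp_neg_neg_ln ennreal_mult')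
  qed (simp add: \<phi>_def)
  have G: "levy_integral \<sigma> r (\<lambda>z. ennreal (exp_neg (F1 z)) * of_bool (seen z)) = levy_integral \<sigma> r (\<lambda>z. ennreal (exp_neg (F2 z)) * of_bool (seen z))"
    unfolding f1 f2 hl_def
  proof (rule levy_future[OF \<sigma> r D1 l])
    show "\<phi> (u, b) = \<phi> (u, \<lambda>d. if d < D0 then b d else 0)" for u b
      using mark_sum_cyl[OF xs, of u b] by (simp add: \<phi>_def seen_def past_def)
    show "\<phi> (u, b) = 0" if "past D0 b = 0" for u b using that by (simp add: \<phi>_def seen_def)
  qed measurable
  have split: "levy_integral \<sigma> r (\<lambda>z. ennreal (1 - exp_neg (F z))) + levy_integral \<sigma> r (\<lambda>z. ennreal (exp_neg (F z)) * of_bool (seen z)) = ennreal \<psi>"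
    if [measurable]: "F \<in> borel_measurable (borel \<Otimes>\<^sub>M count_col)" and "\<And>z. \<not> seen z \<Longrightarrow> F z = 0" for F
  proof -
    have "levy_integral \<sigma> r (\<lambda>z. ennreal (1 - exp_neg (F z))) + levy_integral \<sigma> r (\<lambda>z. ennreal (exp_neg (F z)) * of_bool (seen z)) =
        levy_integral \<sigma> r (\<lambda>z. ennreal (1 - exp_neg (F z)) + ennreal (exp_neg (F z)) * of_bool (seen z))"
      by (rule levy_integral_add[symmetric]) measurable
    also have "(\<lambda>z. ennreal (1 - exp_neg (F z)) + ennreal (exp_neg (F z)) * of_bool (seen z)) = (\<lambda>z. of_bool (seen z))"
      using that(2) by (auto simp: fun_eq_iff of_bool_def ennreal_plus[symmetric] simp del: ennreal_plus)
    finally show ?thesis by (simp add: levy_seen')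
  qed
  have s1: "levy_integral \<sigma> r (\<lambda>z. ennreal (1 - exp_neg (F1 z))) + levy_integral \<sigma> r (\<lambda>z. ennreal (exp_neg (F1 z)) * of_bool (seen z)) = ennreal \<psi>"
    by (rule split) (auto simp: F1_def un)
  have s2: "levy_integral \<sigma> r (\<lambda>z. ennreal (1 - exp_neg (F2 z))) + levy_integral \<sigma> r (\<lambda>z. ennreal (exp_neg (F1 z)) * of_bool (seen z)) = ennreal \<psi>"
    unfolding G by (rule split) (auto simp: F2_def un)
  \<comment> \<open>Bounded by \<open>\<psi>\<close>, the common summand is finite and may be
    cancelled among extended values.\<close>
  have "levy_integral \<sigma> r (\<lambda>z. ennreal (exp_neg (F1 z)) * of_bool (seen z)) \<noteq> \<top>"
    using s1 by (metis ennreal_add_eq_top ennreal_neq_top)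
  then have eq: "levy_integral \<sigma> r (\<lambda>z. ennreal (1 - exp_neg (F1 z))) = levy_integral \<sigma> r (\<lambda>z. ennreal (1 - exp_neg (F2 z)))"
    using s1 s2 by (metis ennreal_add_diff_cancel_right)
  have "levy_integral \<sigma> r (\<lambda>z. ennreal (1 - exp_neg (F1 z))) \<noteq> \<top>"
    using s1 by (metis ennreal_add_eq_top ennreal_neq_top)
  then obtain h where h: "levy_integral \<sigma> r (\<lambda>z. ennreal (1 - exp_neg (F1 z))) = ennreal h" "0 \<le> h"
    by (cases "levy_integral \<sigma> r (\<lambda>z. ennreal (1 - exp_neg (F1 z)))") auto
  have "(\<integral>\<omega>. exp_neg (\<Sum>n. F1 (unit_mark \<omega> n)) \<partial>M) = (\<integral>\<omega>. exp_neg (\<Sum>n. F2 (unit_mark \<omega> n)) \<partial>M)"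
    using NBP_laplace[OF _ h] NBP_laplace[OF _ h(1)[unfolded eq] h(2)] by simp
  then show ?thesis
    unfolding day_sum_def ennreal_suminf_cmult[symmetric] exp_neg_add_suminf F1_def F2_def hl_def .
qed

text \<open>As \<open>l > 0\<close> tends to \<open>0\<close>, the transform of the number
  \<open>N\<close> of seen units tends to \<open>1\<close> by the explicit formula, while it never
  exceeds the probability that \<open>N\<close> is finite.\<close>

lemma AE_finite_seen: "AE \<omega> in M. finite {n. seen (unit_mark \<omega> n)}"
proof -
  define N where "N \<omega> = (\<Sum>n. of_bool (seen (unit_mark \<omega> n)) :: ennreal)" for \<omega>
  have [measurable]: "N \<in> borel_measurable M" unfolding N_def by measurable
  have N: "N \<omega> = emeasure (count_space UNIV) {n. seen (unit_mark \<omega> n)}" for \<omega>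
    using points_in_suminf[of "\<lambda>n \<omega>. unit_mark \<omega> n" "{z. seen z}" \<omega>]
    by (simp add: N_def points_in_def indicator_def)
  have lap: "(\<integral>\<omega>. exp_neg (ennreal l * N \<omega>) \<partial>M) = (\<beta> / (\<beta> + (1 - exp (- l)) * \<psi>)) powr (c + 1)" if l: "0 \<le> l" for l
  proof -
    have e: "ennreal (1 - exp_neg (ennreal l * of_bool (seen z))) = ennreal (1 - exp (- l)) * of_bool (seen z)" for z
      using l by (simp add: exp_neg_ennreal of_bool_def)
    have "levy_integral \<sigma> r (\<lambda>z. ennreal (1 - exp_neg (ennreal l * of_bool (seen z)))) = ennreal ((1 - exp (- l)) * \<psi>)"
      unfolding e using l by (simp add: levy_integral_cmult levy_seen' ennreal_mult')
    from NBP_laplace[OF _ this] show ?thesis using l psi_nonneg by (simp add: N_def)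
  qed
  have lim0: "(\<lambda>n. 1 / real (Suc n)) \<longlonglongrightarrow> 0" by (rule LIMSEQ_Suc) (rule lim_1_over_n)
  have eq: "(\<integral>\<omega>. exp_neg (ennreal (1 / real (Suc n)) * N \<omega>) \<partial>M) =
      (\<beta> / (\<beta> + (1 - exp (- (1 / real (Suc n)))) * \<psi>)) powr (c + 1)" for n
    by (rule lap) simp
  have "(\<lambda>n. (\<beta> / (\<beta> + (1 - exp (- (1 / real (Suc n)))) * \<psi>)) powr (c + 1)) \<longlonglongrightarrow>
      (\<beta> / (\<beta> + (1 - exp (- 0)) * \<psi>)) powr (c + 1)"
    using \<beta> by (intro tendsto_intros lim0) auto
  then have lim: "(\<lambda>n. \<integral>\<omega>. exp_neg (ennreal (1 / real (Suc n)) * N \<omega>) \<partial>M) \<longlonglongrightarrow> 1"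
    unfolding eq using \<beta> by simp
  have "(\<integral>\<omega>. exp_neg (ennreal (1 / real (Suc n)) * N \<omega>) \<partial>M) \<le> prob {\<omega> \<in> space M. N \<omega> < \<top>}" for n
  proof -
    have "(\<integral>\<omega>. exp_neg (ennreal (1 / real (Suc n)) * N \<omega>) \<partial>M) \<le> (\<integral>\<omega>. indicator {\<omega> \<in> space M. N \<omega> < \<top>} \<omega> \<partial>M)"
      by (rule integral_mono)
        (auto intro!: integrable_const_bound[where B=1] simp: indicator_def ennreal_mult_top not_less top_unique)
    then show ?thesis by simp
  qed
  then have "1 \<le> prob {\<omega> \<in> space M. N \<omega> < \<top>}" using lim by (intro LIMSEQ_le_const2) auto
  then have "prob {\<omega> \<in> space M. N \<omega> < \<top>} = 1" by (simp add: antisym)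
  then have "AE \<omega> in M. N \<omega> < \<top>" by (subst (asm) prob_Collect_eq_1) auto
  then show ?thesis by eventually_elim (auto simp: N emeasure_count_space split: if_splits)
qed

end

subsection \<open>Unit totals as functions of the day measures\<close>

context sbsp_nbp_days
begin

abbreviation "days \<equiv> days_algebra M (day_measure w A) D0"

lemma past_unit_mark: "past D0 (snd (unit_mark \<omega> n)) = unit_total A D0 n \<omega>"
  by (simp add: past_def unit_mark_def unit_total_def sum.atLeast1_atMost_eq)

lemma future_unit_mark: "future D0 D1 (snd (unit_mark \<omega> n)) = (\<Sum>d=1..D1. A (D0 + d) n \<omega>)"
  by (simp add: future_def unit_mark_def sum.atLeast1_atMost_eq)

lemma observed_eq: "observed A D0 \<omega> = {n. seen (unit_mark \<omega> n)}"
proof -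
  have "unit_total A D0 n \<omega> = 0 \<longleftrightarrow> (\<forall>d\<in>{1..D0}. A d n \<omega> = 0)" for n
    by (simp add: unit_total_def)
  then show ?thesis
    by (auto simp: observed_def seen_def past_unit_mark neq0_conv[symmetric] simp del: neq0_conv)
qed

lemma observed_total: "n \<in> observed A D0 \<omega> \<longleftrightarrow> 0 < unit_total A D0 n \<omega>"
  by (simp add: observed_eq seen_def past_unit_mark)

lemma AE_finite_observed: "AE \<omega> in M. finite (observed A D0 \<omega>)"
  using AE_finite_seen by (simp add: observed_eq)

lemma emeasure_day_measure:
  assumes d: "1 \<le> d" and B: "B \<in> sets borel"
  shows "emeasure (day_measure w A d \<omega>) B = day_sum [(d, B)] \<omega>"
proof -
  let ?P = "point_measure UNIV (\<lambda>n. of_nat (A d n \<omega>))"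
  have "emeasure (day_measure w A d \<omega>) B = emeasure ?P ((\<lambda>n. w n \<omega>) -` B)"
    unfolding day_measure_def using B by (subst emeasure_distr) (auto simp: space_point_measure)
  also have "\<dots> = (\<integral>\<^sup>+n. indicator ((\<lambda>n. w n \<omega>) -` B) n \<partial>?P)"
    by (rule nn_integral_indicator[symmetric]) (simp add: sets_point_measure)
  also have "\<dots> = (\<Sum>n. of_nat (A d n \<omega>) * indicator B (w n \<omega>))"
    by (simp add: nn_integral_point_measure nn_integral_count_space_nat[symmetric] indicator_def vimage_def
        point_measure_def nn_integral_density)
  also have "\<dots> = day_sum [(d, B)] \<omega>"
    using d by (simp add: day_sum_def mark_sum_def unit_mark_def)
  finally show ?thesis .
qed

lemma day_sum_measurable: "valid_days D0 xs \<Longrightarrow> day_sum xs \<in> borel_measurable M"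
proof -
  assume "valid_days D0 xs"
  note [measurable] = mark_sum_measurable[OF this]
  show ?thesis unfolding day_sum_def[abs_def] by measurable
qed

lemma day_sum_Cons: "day_sum (x # xs) \<omega> = day_sum [x] \<omega> + day_sum xs \<omega>"
  using mark_sum_append[of "[x]" xs] by (simp add: day_sum_def suminf_add[symmetric])

lemma day_sum_append: "day_sum (xs @ ys) \<omega> = day_sum xs \<omega> + day_sum ys \<omega>"
  by (simp add: day_sum_def mark_sum_append suminf_add[symmetric])

lemma space_days: "space days = space M"
  unfolding days_algebra_def by (rule space_measure_of) auto

lemma sets_days: "sets days = sigma_sets (space M)
  {(\<lambda>\<omega>. emeasure (day_measure w A d \<omega>) B) -` C \<inter> space M | d B C. d \<in> {1..D0} \<and> B \<in> sets borel \<and> C \<in> sets borel}"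
  unfolding days_algebra_def by (rule sets_measure_of) auto

lemma subalgebra_days: "subalgebra M days"
  unfolding subalgebra_def space_days sets_days
proof (intro conjI refl sets.sigma_sets_subset subsetI)
  fix X assume "X \<in> {(\<lambda>\<omega>. emeasure (day_measure w A d \<omega>) B) -` C \<inter> space M | d B C. d \<in> {1..D0} \<and> B \<in> sets borel \<and> C \<in> sets borel}"
  then obtain d B C where X: "X = (\<lambda>\<omega>. emeasure (day_measure w A d \<omega>) B) -` C \<inter> space M"
    and d: "d \<in> {1..D0}" and B: "B \<in> sets borel" and C: "C \<in> sets borel" by blast
  have "X = day_sum [(d, B)] -` C \<inter> space M" using d B by (auto simp: X emeasure_day_measure)
  moreover have "day_sum [(d, B)] \<in> borel_measurable M" using d B by (intro day_sum_measurable) (simp add: valid_days_def)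
  ultimately show "X \<in> sets M" using C by (auto intro: measurable_sets)
qed

lemma day_sum_measurable_days: "valid_days D0 xs \<Longrightarrow> day_sum xs \<in> borel_measurable days"
proof (induction xs)
  case Nil
  have "day_sum [] = (\<lambda>_. 0)" by (simp add: day_sum_def mark_sum_def fun_eq_iff)
  then show ?case by simp
next
  case (Cons x xs)
  obtain d B where x: "x = (d, B)" by (cases x)
  have d: "d \<in> {1..D0}" and B: "B \<in> sets borel" using Cons.prems by (auto simp: valid_days_def x)
  have [measurable]: "day_sum xs \<in> borel_measurable days" using Cons by (auto simp: valid_days_def)
  have [measurable]: "day_sum [x] \<in> borel_measurable days"
  proof (rule measurableI)
    fix C :: "ennreal set" assume C: "C \<in> sets borel"
    have "day_sum [x] -` C \<inter> space days = (\<lambda>\<omega>. emeasure (day_measure w A d \<omega>) B) -` C \<inter> space M"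
      using d B by (auto simp: x emeasure_day_measure space_days)
    then show "day_sum [x] -` C \<inter> space days \<in> sets days"
      unfolding sets_days using d B C by (intro sigma_sets.Basic) blast
  qed simp
  have "day_sum (x # xs) = (\<lambda>\<omega>. day_sum [x] \<omega> + day_sum xs \<omega>)" using day_sum_Cons by blast
  then show ?case by simp
qed

text \<open>The dyadic cells of level \<open>k\<close> eventually separate the finitely many observed labels, so the
  multiset of unit totals is a limit of functions of the day measures.\<close>

definition cell_days :: "nat \<Rightarrow> nat \<Rightarrow> (nat \<times> real set) list" where
  "cell_days k i = map (\<lambda>d. (d, {x. \<lfloor>2 ^ k * x\<rfloor> = int i})) [1..<Suc D0]"

definition cell_count :: "nat \<Rightarrow> nat \<Rightarrow> 'a \<Rightarrow> nat" where
  "cell_count k i \<omega> = nat \<lfloor>enn2real (day_sum (cell_days k i) \<omega>)\<rfloor>"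

text \<open>Cells come in the order of the labels, units in the order of their jumps; sorting
  removes both orders. Labels lie in \<open>{0..1}\<close>, and the cell of index
  \<open>2 ^ k\<close> is there for the label \<open>1\<close>.\<close>

definition cell_totals :: "nat \<Rightarrow> 'a \<Rightarrow> nat list" where
  "cell_totals k \<omega> = sort (filter (\<lambda>m. 0 < m) (map (\<lambda>i. cell_count k i \<omega>) [0..<Suc (2 ^ k)]))"

definition totals :: "'a \<Rightarrow> nat list" where
  "totals \<omega> = sorted_list_of_multiset (image_mset (\<lambda>n. unit_total A D0 n \<omega>) (mset_set (observed A D0 \<omega>)))"

text \<open>Lists are discrete, so a limit is a value taken eventually; \<open>[]\<close> is
  returned where there is none. In contrast to \<open>totals\<close>, this is by construction a
  function of the day measures.\<close>

definition day_totals :: "'a \<Rightarrow> nat list" where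
  "day_totals \<omega> = (if \<exists>x. \<forall>\<^sub>F k in sequentially. cell_totals k \<omega> = x
     then THE x. \<forall>\<^sub>F k in sequentially. cell_totals k \<omega> = x else [])"

lemma day_totals_eq:
  assumes "\<forall>\<^sub>F k in sequentially. cell_totals k \<omega> = x"
  shows "day_totals \<omega> = x"
proof -
  have "y = x" if "\<forall>\<^sub>F k in sequentially. cell_totals k \<omega> = y" for y
  proof -
    have "\<forall>\<^sub>F k in sequentially. y = x" using that assms by eventually_elim simp
    then show ?thesis by simp
  qed
  then have "(THE x. \<forall>\<^sub>F k in sequentially. cell_totals k \<omega> = x) = x" using assms by blast
  then show ?thesis using assms by (auto simp: day_totals_def)
qed

lemma day_totals_measurable: "day_totals \<in> measurable days (count_space UNIV)"
proof -
  have c: "cell_count k i \<in> measurable days (count_space UNIV)" for k i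
  proof -
    have "valid_days D0 (cell_days k i)" by (auto simp: valid_days_def cell_days_def)
    note [measurable] = day_sum_measurable_days[OF this]
    show ?thesis unfolding cell_count_def[abs_def] by measurable
  qed
  have l: "(\<lambda>\<omega>. map (\<lambda>i. cell_count k i \<omega>) is) \<in> measurable days (count_space UNIV)" for k "is"
  proof (induction "is")
    case (Cons i "is")
    have [measurable]: "cell_count k i \<in> measurable days (count_space UNIV)" by (rule c)
    note [measurable] = Cons
    have "(\<lambda>\<omega>. (\<lambda>p. fst p # snd p) (cell_count k i \<omega>, map (\<lambda>i. cell_count k i \<omega>) is)) \<in> measurable days (count_space UNIV)"
      by measurable
    then show ?case by simp
  qed simp
  have ct: "cell_totals k \<in> measurable days (count_space UNIV)" for k
    unfolding cell_totals_def[abs_def] by (rule measurable_compose[OF l]) simp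
  have ev: "{\<omega> \<in> space days. \<forall>\<^sub>F k in sequentially. cell_totals k \<omega> = x} \<in> sets days" for x
  proof -
    note [measurable] = ct
    have "{\<omega> \<in> space days. \<exists>K. \<forall>k. K \<le> k \<longrightarrow> cell_totals k \<omega> = x} \<in> sets days" by measurable
    then show ?thesis by (simp add: eventually_sequentially)
  qed
  have ne: "day_totals -` {x} \<inter> space days = {\<omega> \<in> space days. \<forall>\<^sub>F k in sequentially. cell_totals k \<omega> = x}" if x: "x \<noteq> []" for x
  proof (intro set_eqI iffI)
    fix \<omega> assume w: "\<omega> \<in> day_totals -` {x} \<inter> space days"
    then have "\<exists>y. \<forall>\<^sub>F k in sequentially. cell_totals k \<omega> = y"
      using x by (auto simp: day_totals_def split: if_splits)
    then obtain y where y: "\<forall>\<^sub>F k in sequentially. cell_totals k \<omega> = y" ..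
    with day_totals_eq[OF y] w show "\<omega> \<in> {\<omega> \<in> space days. \<forall>\<^sub>F k in sequentially. cell_totals k \<omega> = x}" by auto
  qed (auto dest: day_totals_eq)
  show ?thesis
  proof (subst measurable_count_space_eq2_countable, intro conjI ballI)
    fix x :: "nat list"
    show "day_totals -` {x} \<inter> space days \<in> sets days"
    proof (cases "x = []")
      case True
      \<comment> \<open>\<open>[]\<close> is also the default value, so its preimage is obtained as
        a complement.\<close>
      have "day_totals -` {[]} \<inter> space days = space days - (\<Union>y\<in>-{[]}. day_totals -` {y} \<inter> space days)" by auto
      also have "\<dots> \<in> sets days" using ne ev by (intro sets.Diff sets.top sets.countable_UN'') auto
      finally show ?thesis using True by simp
    qed (simp add: ne ev)
  qed auto
qed

lemma cell_count_eq:
  assumes fin: "finite (observed A D0 \<omega>)"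
  shows "cell_count k i \<omega> = (\<Sum>n\<in>{n \<in> observed A D0 \<omega>. \<lfloor>2 ^ k * w n \<omega>\<rfloor> = int i}. unit_total A D0 n \<omega>)"
proof -
  have "mark_sum (cell_days k i) (unit_mark \<omega> n) = of_nat (if \<lfloor>2 ^ k * w n \<omega>\<rfloor> = int i then unit_total A D0 n \<omega> else 0)" for n
  proof -
    have "mark_sum (cell_days k i) (unit_mark \<omega> n) =
        (\<Sum>d\<leftarrow>[1..<Suc D0]. of_nat (A (Suc (d - 1)) n \<omega>) * indicator {x. \<lfloor>2 ^ k * x\<rfloor> = int i} (w n \<omega>))"
      by (simp add: mark_sum_def cell_days_def unit_mark_def comp_def del: upt_Suc)
    also have "\<dots> = (\<Sum>d\<in>{1..D0}. of_nat (A (Suc (d - 1)) n \<omega>) * indicator {x. \<lfloor>2 ^ k * x\<rfloor> = int i} (w n \<omega>))"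
      by (simp only: sum_list_distinct_conv_sum_set distinct_upt set_upt atLeastLessThanSuc_atLeastAtMost)
    also have "\<dots> = (\<Sum>d\<in>{1..D0}. of_nat (A d n \<omega>) * indicator {x. \<lfloor>2 ^ k * x\<rfloor> = int i} (w n \<omega>))"
      by (intro sum.cong) auto
    finally show ?thesis by (simp add: unit_total_def sum_distrib_right[symmetric])
  qed
  then have "day_sum (cell_days k i) \<omega> = (\<Sum>n. of_nat (if \<lfloor>2 ^ k * w n \<omega>\<rfloor> = int i then unit_total A D0 n \<omega> else 0))"
    by (simp add: day_sum_def)
  also have "\<dots> = (\<Sum>n\<in>observed A D0 \<omega>. of_nat (if \<lfloor>2 ^ k * w n \<omega>\<rfloor> = int i then unit_total A D0 n \<omega> else 0))"
    by (rule suminf_finite[OF fin]) (simp add: observed_total)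
  also have "\<dots> = of_nat (\<Sum>n\<in>{n \<in> observed A D0 \<omega>. \<lfloor>2 ^ k * w n \<omega>\<rfloor> = int i}. unit_total A D0 n \<omega>)"
    using fin by (simp add: sum.inter_filter)
  finally show ?thesis
    unfolding cell_count_def by (simp add: ennreal_of_nat_eq_real_of_nat del: of_nat_sum)
qed

lemma day_totals_limit:
  assumes fin: "finite (observed A D0 \<omega>)" and inj: "inj (\<lambda>n. w n \<omega>)"
    and w01: "\<And>n. 0 \<le> w n \<omega>" "\<And>n. w n \<omega> \<le> 1"
  shows "day_totals \<omega> = totals \<omega>"
proof (rule day_totals_eq)
  define Ob where "Ob = observed A D0 \<omega>"
  have sep: "\<forall>\<^sub>F k in sequentially. n \<noteq> m \<longrightarrow> \<lfloor>2 ^ k * w n \<omega>\<rfloor> \<noteq> \<lfloor>2 ^ k * w m \<omega>\<rfloor>" for n m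
  proof (cases "n = m")
    case False
    then have d: "0 < \<bar>w n \<omega> - w m \<omega>\<bar>" using inj by (auto simp: inj_def)
    \<comment> \<open>From level \<open>K\<close> on, cells are shorter than the distance of the two
      labels.\<close>
    obtain K :: nat where K: "1 / \<bar>w n \<omega> - w m \<omega>\<bar> < 2 ^ K" using real_arch_pow[of 2] by auto
    show ?thesis using eventually_ge_at_top[of K]
    proof eventually_elim
      case (elim k)
      have "(2::real) ^ K \<le> 2 ^ k" using elim by simp
      with K have "1 / \<bar>w n \<omega> - w m \<omega>\<bar> < 2 ^ k" by linarith
      then have "1 < 2 ^ k * \<bar>w n \<omega> - w m \<omega>\<bar>" using d by (simp add: field_simps)
      also have "\<dots> = \<bar>2 ^ k * w n \<omega> - 2 ^ k * w m \<omega>\<bar>" by (simp add: abs_mult right_diff_distrib[symmetric])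
      finally show ?case by linarith
    qed
  qed simp
  have "\<forall>\<^sub>F k in sequentially. \<forall>n\<in>Ob. \<forall>m\<in>Ob. n \<noteq> m \<longrightarrow> \<lfloor>2 ^ k * w n \<omega>\<rfloor> \<noteq> \<lfloor>2 ^ k * w m \<omega>\<rfloor>"
    using fin sep by (simp add: eventually_ball_finite_distrib Ob_def)
  then show "\<forall>\<^sub>F k in sequentially. cell_totals k \<omega> = totals \<omega>"
  proof eventually_elim
    case (elim k)
    define f where "f n = nat \<lfloor>2 ^ k * w n \<omega>\<rfloor>" for n
    have fi: "\<lfloor>2 ^ k * w n \<omega>\<rfloor> = int i \<longleftrightarrow> f n = i" for n i
      using w01(1)[of n] by (auto simp: f_def)
    have finj: "inj_on f Ob" using elim w01(1) by (auto simp: inj_on_def f_def eq_nat_nat_iff)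
    have fO: "finite Ob" using fin by (simp add: Ob_def)
    have frange: "f n \<in> {0..<Suc (2 ^ k)}" for n
    proof -
      have "2 ^ k * w n \<omega> \<le> 2 ^ k * 1" using w01(2) by (intro mult_left_mono) auto
      then have "2 ^ k * w n \<omega> < 2 ^ k + 1" by linarith
      then have "\<lfloor>2 ^ k * w n \<omega>\<rfloor> \<le> 2 ^ k" by (simp add: floor_le_iff)
      then show ?thesis by (simp add: f_def nat_le_iff less_Suc_eq_le)
    qed
    have cc: "cell_count k (f n) \<omega> = unit_total A D0 n \<omega>" if n: "n \<in> Ob" for n
    proof -
      have "{m \<in> Ob. f m = f n} = {n}" using n finj by (auto simp: inj_on_def)
      then show ?thesis unfolding cell_count_eq[OF fin] fi Ob_def[symmetric] by simp
    qed
    have cc0: "cell_count k i \<omega> = 0" if "i \<notin> f ` Ob" for i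
    proof -
      have "{m \<in> Ob. f m = i} = {}" using that by auto
      then show ?thesis unfolding cell_count_eq[OF fin] fi Ob_def[symmetric] by (simp only: sum.empty)
    qed
    have pos: "{i \<in> {0..<Suc (2 ^ k)}. 0 < cell_count k i \<omega>} = f ` Ob"
    proof (intro set_eqI iffI)
      fix i assume "i \<in> {i \<in> {0..<Suc (2 ^ k)}. 0 < cell_count k i \<omega>}"
      then show "i \<in> f ` Ob" using cc0 by (metis (no_types, lifting) mem_Collect_eq less_irrefl)
    next
      fix i assume "i \<in> f ` Ob"
      then obtain n where "n \<in> Ob" "i = f n" by auto
      then show "i \<in> {i \<in> {0..<Suc (2 ^ k)}. 0 < cell_count k i \<omega>}"
        using frange cc observed_total by (auto simp: Ob_def)
    qed
    have "mset (filter (\<lambda>m. 0 < m) (map (\<lambda>i. cell_count k i \<omega>) [0..<Suc (2 ^ k)])) =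
        image_mset (\<lambda>i. cell_count k i \<omega>) (mset_set {i \<in> {0..<Suc (2 ^ k)}. 0 < cell_count k i \<omega>})"
      by (simp add: filter_map comp_def filter_mset_mset_set del: upt_Suc)
    also have "\<dots> = image_mset (\<lambda>n. cell_count k (f n) \<omega>) (mset_set Ob)"
      unfolding pos image_mset_mset_set[OF finj, symmetric] by (simp add: multiset.map_comp comp_def)
    also have "\<dots> = image_mset (\<lambda>n. unit_total A D0 n \<omega>) (mset_set Ob)"
      using fO cc by (intro image_mset_cong) auto
    finally show ?case
      unfolding cell_totals_def totals_def Ob_def[symmetric] sorted_list_of_multiset_mset[symmetric] by (simp only:)
  qed
qed

lemma AE_day_totals: "AE \<omega> in M. day_totals \<omega> = totals \<omega>"
  using AE_finite_observed AE_labels by eventually_elim (auto intro: day_totals_limit)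

lemma mset_totals: "mset (totals \<omega>) = image_mset (\<lambda>n. unit_total A D0 n \<omega>) (mset_set (observed A D0 \<omega>))"
  by (simp add: totals_def)

lemma length_totals: "length (totals \<omega>) = card (observed A D0 \<omega>)"
  using mset_totals[of \<omega>] by (metis size_image_mset size_mset size_mset_set)

end

subsection \<open>Conditional laws given the observed days\<close>

context sbsp_nbp_days
begin

text \<open>The functions \<open>exp_neg (day_sum xs \<omega>) * exp_neg (l * x)\<close> form a multiplicative class that generates the
  product of the day algebra and the Borel sets. So it suffices to compare, on this class, the joint
  law of \<open>(\<omega>, X \<omega>)\<close> with the mixture of the candidate kernel.\<close>

lemma cond_law_of_laplace:
  fixes X :: "'a \<Rightarrow> ennreal" and K :: "nat list \<Rightarrow> ennreal measure" and R :: "real \<Rightarrow> 'a \<Rightarrow> real"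
  assumes X[measurable]: "X \<in> borel_measurable M"
    and K: "\<And>xs. prob_space (K xs)" "\<And>xs. sets (K xs) = sets borel"
    and lap: "\<And>xs l. valid_days D0 xs \<Longrightarrow> 0 \<le> l \<Longrightarrow>
      (\<integral>\<omega>. exp_neg (day_sum xs \<omega>) * exp_neg (ennreal l * X \<omega>) \<partial>M) =
      (\<integral>\<omega>. exp_neg (day_sum xs \<omega>) * R l \<omega> \<partial>M)"
    and R[measurable]: "\<And>l. 0 \<le> l \<Longrightarrow> R l \<in> borel_measurable M"
    and RK: "\<And>l. 0 \<le> l \<Longrightarrow> AE \<omega> in M. (\<integral>x. exp_neg (ennreal l * x) \<partial>K (totals \<omega>)) = R l \<omega>"
    and K': "\<And>\<omega>. \<omega> \<in> E \<Longrightarrow> K (totals \<omega>) = K' \<omega>"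
  shows "has_cond_law M days E borel X K'"
proof -
  interpret finite_measure_subalgebra M days
    by (simp add: finite_measure_subalgebra_def finite_measure_axioms finite_measure_subalgebra_axioms_def subalgebra_days)
  have sd: "sets days \<subseteq> sets M" using subalgebra_days by (simp add: subalgebra_def)
  \<comment> \<open>The kernel runs through \<open>day_totals\<close>, which is measurable for the
    days and almost surely equal to \<open>totals\<close>. Out of the discrete space of lists every
    map \<open>K\<close> is measurable.\<close>
  define \<kappa> where "\<kappa> \<omega> = K (day_totals \<omega>)" for \<omega>
  have \<kappa>d: "\<kappa> \<in> measurable days (prob_algebra borel)"
    unfolding \<kappa>_def[abs_def] by (rule measurable_compose[OF day_totals_measurable]) (auto simp: space_prob_algebra K)
  have \<kappa>m[measurable]: "\<kappa> \<in> measurable M (prob_algebra borel)"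
    by (rule measurable_from_subalg[OF subalgebra_days \<kappa>d])
  have \<kappa>s: "sets (\<kappa> \<omega>) = sets borel" "space (\<kappa> \<omega>) = UNIV" and \<kappa>p: "prob_space (\<kappa> \<omega>)" for \<omega>
    using K sets_eq_imp_space_eq[OF K(2)] by (auto simp: \<kappa>_def)
  define S where "S = M \<Otimes>\<^sub>M (borel :: ennreal measure)"
  have spS: "space S = space M \<times> UNIV" by (simp add: S_def space_pair_measure)
  define M1 where "M1 = distr M S (\<lambda>\<omega>. (\<omega>, X \<omega>))"
  define M2 where "M2 = M \<bind> (\<lambda>\<omega>. distr (\<kappa> \<omega>) S (\<lambda>x. (\<omega>, x)))"
  have km: "(\<lambda>\<omega>. distr (\<kappa> \<omega>) S (\<lambda>x. (\<omega>, x))) \<in> measurable M (prob_algebra S)"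
    by (rule measurable_distr_prob_space2[OF \<kappa>m]) (simp add: S_def)
  have "M \<in> space (prob_algebra M)" by (simp add: space_prob_algebra prob_space_axioms)
  from measurable_space[OF measurable_bind_prob_space[OF measurable_const[OF this, of "count_space {undefined}"] km], of undefined]
  have M2: "prob_space M2" "sets M2 = sets S" by (simp_all add: space_prob_algebra M2_def)
  have pm: "(\<lambda>\<omega>. (\<omega>, X \<omega>)) \<in> measurable M S" by (simp add: S_def)
  have M1: "prob_space M1" "sets M1 = sets S" unfolding M1_def by (auto intro!: prob_space_distr pm)
  have sp1: "space M1 = space M \<times> UNIV" using sets_eq_imp_space_eq[OF M1(2)] spS by simp
  have i1: "(\<integral>\<^sup>+p. f p \<partial>M1) = (\<integral>\<^sup>+\<omega>. f (\<omega>, X \<omega>) \<partial>M)" if "f \<in> borel_measurable S" for f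
    unfolding M1_def using that by (simp add: nn_integral_distr[OF pm])
  have i2: "(\<integral>\<^sup>+p. f p \<partial>M2) = (\<integral>\<^sup>+\<omega>. \<integral>\<^sup>+x. f (\<omega>, x) \<partial>\<kappa> \<omega> \<partial>M)" if f: "f \<in> borel_measurable S" for f
  proof -
    have "(\<integral>\<^sup>+p. f p \<partial>M2) = (\<integral>\<^sup>+\<omega>. \<integral>\<^sup>+p. f p \<partial>distr (\<kappa> \<omega>) S (\<lambda>x. (\<omega>, x)) \<partial>M)"
      unfolding M2_def by (rule nn_integral_bind[OF f measurable_prob_algebraD[OF km]])
    also have "\<dots> = (\<integral>\<^sup>+\<omega>. \<integral>\<^sup>+x. f (\<omega>, x) \<partial>\<kappa> \<omega> \<partial>M)"
    proof (rule nn_integral_cong)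
      fix \<omega> assume "\<omega> \<in> space M"
      then have "(\<lambda>x. (\<omega>, x)) \<in> measurable (\<kappa> \<omega>) S" by (simp add: S_def \<kappa>s cong: measurable_cong_sets)
      then show "(\<integral>\<^sup>+p. f p \<partial>distr (\<kappa> \<omega>) S (\<lambda>x. (\<omega>, x))) = (\<integral>\<^sup>+x. f (\<omega>, x) \<partial>\<kappa> \<omega>)"
        using f by (simp add: nn_integral_distr)
    qed
    finally show ?thesis .
  qed
  have eel: "(\<lambda>x. exp_neg (ennreal l * x)) \<in> borel_measurable (\<kappa> \<omega>)" for l \<omega>
    by (simp add: \<kappa>s cong: measurable_cong_sets)
  have iK: "(\<integral>\<^sup>+x. ennreal (exp_neg (ennreal l * x)) \<partial>\<kappa> \<omega>) = ennreal (\<integral>x. exp_neg (ennreal l * x) \<partial>\<kappa> \<omega>)" for l \<omega>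
  proof -
    interpret K: prob_space "\<kappa> \<omega>" by (rule \<kappa>p)
    show ?thesis using eel by (intro nn_integral_eq_integral K.integrable_const_bound[where B=1]) auto
  qed
  define h where "h xs l p = exp_neg (day_sum xs (fst p)) * exp_neg (ennreal l * snd p)" for xs l and p :: "'a \<times> ennreal"
  define C where "C = {h xs l | xs l. valid_days D0 xs \<and> 0 \<le> l}"
  have hm: "h xs l \<in> borel_measurable S" if "valid_days D0 xs" for xs l
  proof -
    have "(\<lambda>p. day_sum xs (fst p)) \<in> borel_measurable S"
      unfolding S_def by (rule measurable_compose[OF measurable_fst day_sum_measurable[OF that]])
    moreover have "(\<lambda>p. ennreal l * snd p) \<in> borel_measurable S" unfolding S_def by measurable
    ultimately show ?thesis unfolding h_def[abs_def] by measurable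
  qed
  have h01: "0 \<le> h xs l p" "h xs l p \<le> 1" for xs l p by (auto simp: h_def mult_le_one)
  define G where "G = {f -` {a<..} \<inter> space M1 | f a. f \<in> C}"
  have agree: "emeasure M1 Z = emeasure M2 Z" if Z: "Z \<in> sigma_sets (space M1) G" for Z
    using Z unfolding G_def
  proof (rule multiplicative_class_eq[rotated -1])
    show "finite_measure M1" "finite_measure M2"
      using M1(1) M2(1) by (auto intro: prob_space.finite_measure)
    show s12: "sets M1 = sets M2" using M1 M2 by simp
    show "f \<in> borel_measurable M1" if "f \<in> C" for f
      using that hm M1(2) by (auto simp: C_def cong: measurable_cong_sets)
    show "0 \<le> f x \<and> f x \<le> 1" if fC: "f \<in> C" for f x
    proof -
      obtain xs l where "f = h xs l" using fC unfolding C_def by auto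
      then show ?thesis using h01[of xs l x] by simp
    qed
    have "h [] 0 = (\<lambda>_. 1)" by (simp add: h_def fun_eq_iff day_sum_def mark_sum_def)
    then show "(\<lambda>_. 1) \<in> C" unfolding C_def by (auto simp: valid_days_def intro!: exI[of _ "[]"] exI[of _ 0])
    show "(\<lambda>x. f x * g x) \<in> C" if fg: "f \<in> C" "g \<in> C" for f g
    proof -
      obtain xs l ys m where fg: "f = h xs l" "g = h ys m" "valid_days D0 xs" "valid_days D0 ys" "0 \<le> l" "0 \<le> m"
        using fg unfolding C_def by auto
      have "(\<lambda>x. f x * g x) = h (xs @ ys) (l + m)"
        using fg by (simp add: h_def fun_eq_iff day_sum_append exp_neg_add distrib_left distrib_right mult_ac)
      then show ?thesis using fg unfolding C_def
        by (auto simp: valid_days_def intro!: exI[of _ "xs @ ys"] exI[of _ "l + m"])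
    qed
    show "integral\<^sup>L M1 f = integral\<^sup>L M2 f" if fC: "f \<in> C" for f
    proof -
      obtain xs l where f: "f = h xs l" "valid_days D0 xs" "0 \<le> l" using fC unfolding C_def by auto
      note [measurable] = day_sum_measurable[OF f(2)]
      have fm: "f \<in> borel_measurable S" unfolding f by (rule hm[OF f(2)])
      have "(\<lambda>p. ennreal (f p)) \<in> borel_measurable S" using fm by measurable
      note i = i1[OF this] i2[OF this]
      have km: "(\<lambda>\<omega>. \<integral>x. exp_neg (ennreal l * x) \<partial>\<kappa> \<omega>) \<in> borel_measurable M"
      proof -
        have "(\<lambda>\<omega>. enn2real (\<integral>\<^sup>+x. ennreal (exp_neg (ennreal l * x)) \<partial>\<kappa> \<omega>)) \<in> borel_measurable M"
          using measurable_compose[OF measurable_prob_algebraD[OF \<kappa>m] nn_integral_measurable_subprob_algebra, of "\<lambda>x. ennreal (exp_neg (ennreal l * x))"]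
          by simp
        then show ?thesis unfolding iK by (simp add: integral_nonneg_AE)
      qed
      have k01: "0 \<le> (\<integral>x. exp_neg (ennreal l * x) \<partial>\<kappa> \<omega>)" for \<omega> by (simp add: integral_nonneg_AE)
      have "integral\<^sup>L M1 f = enn2real (\<integral>\<^sup>+\<omega>. ennreal (f (\<omega>, X \<omega>)) \<partial>M)"
        unfolding i(1)[symmetric] using fm M1(2) h01 f(1)
        by (intro integral_eq_nn_integral) (auto cong: measurable_cong_sets)
      also have "\<dots> = (\<integral>\<omega>. exp_neg (day_sum xs \<omega>) * exp_neg (ennreal l * X \<omega>) \<partial>M)"
        unfolding f h_def by (subst integral_eq_nn_integral) auto
      also have "\<dots> = (\<integral>\<omega>. exp_neg (day_sum xs \<omega>) * R l \<omega> \<partial>M)"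
        by (rule lap[OF f(2,3)])
      also have "\<dots> = (\<integral>\<omega>. exp_neg (day_sum xs \<omega>) * (\<integral>x. exp_neg (ennreal l * x) \<partial>\<kappa> \<omega>) \<partial>M)"
      proof (rule integral_cong_AE)
        show "AE \<omega> in M. exp_neg (day_sum xs \<omega>) * R l \<omega> = exp_neg (day_sum xs \<omega>) * (\<integral>x. exp_neg (ennreal l * x) \<partial>\<kappa> \<omega>)"
          using AE_day_totals RK[OF f(3)] by eventually_elim (simp add: \<kappa>_def)
      qed (use km R[OF f(3)] in measurable)
      also have "\<dots> = enn2real (\<integral>\<^sup>+\<omega>. ennreal (exp_neg (day_sum xs \<omega>) * (\<integral>x. exp_neg (ennreal l * x) \<partial>\<kappa> \<omega>)) \<partial>M)"
        using km k01 by (intro integral_eq_nn_integral) auto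
      also have "(\<integral>\<^sup>+\<omega>. ennreal (exp_neg (day_sum xs \<omega>) * (\<integral>x. exp_neg (ennreal l * x) \<partial>\<kappa> \<omega>)) \<partial>M) = (\<integral>\<^sup>+p. ennreal (f p) \<partial>M2)"
        unfolding i(2) unfolding f h_def fst_conv snd_conv
        using eel by (intro nn_integral_cong) (simp add: ennreal_mult' nn_integral_cmult iK[symmetric] k01)
      also have "enn2real \<dots> = integral\<^sup>L M2 f"
        using fm M2(2) h01 f(1) by (intro integral_eq_nn_integral[symmetric]) (auto cong: measurable_cong_sets)
      finally show ?thesis .
    qed
  qed
  \<comment> \<open>The algebra generated by the class. It contains every rectangle
    \<open>Z \<times> B\<close> with \<open>Z\<close> an event of the days, since both coordinates
    are recovered from the exponentials by \<open>neg_ln\<close>.\<close>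
  define \<Sigma> where "\<Sigma> = sigma (space M1) G"
  have s\<Sigma>: "sets \<Sigma> = sigma_sets (space M1) G" "space \<Sigma> = space M1"
    unfolding \<Sigma>_def by (auto simp: G_def intro!: sets_measure_of space_measure_of)
  have Cm: "f \<in> borel_measurable \<Sigma>" if "f \<in> C" for f
    unfolding borel_measurable_iff_greater
  proof
    fix a
    have "f -` {a<..} \<inter> space M1 \<in> G" using that by (auto simp: G_def)
    then show "{p \<in> space \<Sigma>. a < f p} \<in> sets \<Sigma>"
      unfolding s\<Sigma> by (intro sigma_sets.Basic) (simp add: vimage_def Int_def conj_commute)
  qed
  have snd\<Sigma>: "snd \<in> borel_measurable \<Sigma>"
  proof -
    have "h [] 1 \<in> C" by (auto simp: C_def valid_days_def intro!: exI[of _ "[]"] exI[of _ 1])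
    from Cm[OF this] have "(\<lambda>p. neg_ln (h [] 1 p)) \<in> borel_measurable \<Sigma>" by measurable
    then show ?thesis by (simp add: h_def day_sum_def mark_sum_def neg_ln_exp_neg)
  qed
  have fst\<Sigma>: "fst \<in> measurable \<Sigma> days"
  proof (rule measurable_sigma_sets[OF sets_days])
    show "{(\<lambda>\<omega>. emeasure (day_measure w A d \<omega>) B) -` C \<inter> space M | d B C. d \<in> {1..D0} \<and> B \<in> sets borel \<and> C \<in> sets borel} \<subseteq> Pow (space M)"
      by auto
    show "fst \<in> space \<Sigma> \<rightarrow> space M" by (auto simp: s\<Sigma> sp1)
    fix Z assume "Z \<in> {(\<lambda>\<omega>. emeasure (day_measure w A d \<omega>) B) -` C \<inter> space M | d B C. d \<in> {1..D0} \<and> B \<in> sets borel \<and> C \<in> sets borel}"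
    then obtain d B C' where Z: "Z = (\<lambda>\<omega>. emeasure (day_measure w A d \<omega>) B) -` C' \<inter> space M"
      and d: "d \<in> {1..D0}" and B: "B \<in> sets borel" and C': "C' \<in> sets borel" by blast
    have "h [(d, B)] 0 \<in> C" using d B by (auto simp: C_def valid_days_def intro!: exI[of _ "[(d, B)]"] exI[of _ 0])
    from Cm[OF this] have "(\<lambda>p. neg_ln (h [(d, B)] 0 p)) \<in> borel_measurable \<Sigma>" by measurable
    then have "(\<lambda>p. day_sum [(d, B)] (fst p)) \<in> borel_measurable \<Sigma>" by (simp add: h_def neg_ln_exp_neg)
    from measurable_sets[OF this C']
    have "(\<lambda>p. day_sum [(d, B)] (fst p)) -` C' \<inter> space \<Sigma> \<in> sets \<Sigma>" .
    moreover have "fst -` Z \<inter> space \<Sigma> = (\<lambda>p. day_sum [(d, B)] (fst p)) -` C' \<inter> space \<Sigma>"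
      using d emeasure_day_measure[OF _ B, of d] by (auto simp: Z s\<Sigma> sp1)
    ultimately show "fst -` Z \<inter> space \<Sigma> \<in> sets \<Sigma>" by simp
  qed
  have main: "AE \<omega> in M. cond_prob M days X B \<omega> = measure (\<kappa> \<omega>) B" if B: "B \<in> sets borel" for B
    unfolding cond_prob_def
  proof (rule real_cond_exp_charact)
    have XB[measurable]: "X -` B \<inter> space M \<in> sets M" using B by (rule measurable_sets[OF X])
    show "(\<lambda>\<omega>. measure (\<kappa> \<omega>) B) \<in> borel_measurable days"
      by (rule measurable_compose[OF \<kappa>d measurable_measure_prob_algebra[OF B]])
    have gm[measurable]: "(\<lambda>\<omega>. measure (\<kappa> \<omega>) B) \<in> borel_measurable M"
      by (rule measurable_compose[OF \<kappa>m measurable_measure_prob_algebra[OF B]])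
    have g1: "measure (\<kappa> \<omega>) B \<le> 1" for \<omega> by (rule prob_space.prob_le_1[OF \<kappa>p])
    show "integrable M (\<lambda>\<omega>. measure (\<kappa> \<omega>) B)"
      using g1 by (intro integrable_const_bound[where B=1]) auto
    show "integrable M (indicator (X -` B \<inter> space M) :: 'a \<Rightarrow> real)"
      by (intro integrable_const_bound[where B=1]) (auto simp: indicator_def)
    fix Z assume Z: "Z \<in> sets days"
    then have [measurable]: "Z \<in> sets M" using sd by auto
    have "Z \<times> B = (fst -` Z \<inter> space \<Sigma>) \<inter> (snd -` B \<inter> space \<Sigma>)"
      using sets.sets_into_space[OF \<open>Z \<in> sets M\<close>] by (auto simp: s\<Sigma> sp1)
    then have "Z \<times> B \<in> sets \<Sigma>" using measurable_sets[OF fst\<Sigma> Z] measurable_sets[OF snd\<Sigma> B] by simp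
    \<comment> \<open>On rectangles, equality of the joint law and the mixture is the defining
      property of the conditional expectation.\<close>
    then have eq: "emeasure M1 (Z \<times> B) = emeasure M2 (Z \<times> B)" by (intro agree) (simp add: s\<Sigma>)
    have ZB: "Z \<times> B \<in> sets S" using B by (simp add: S_def)
    then have im: "indicator (Z \<times> B) \<in> borel_measurable S" by simp
    have "ennreal (\<integral>\<omega>. indicator Z \<omega> * measure (\<kappa> \<omega>) B \<partial>M) = (\<integral>\<^sup>+\<omega>. ennreal (indicator Z \<omega> * measure (\<kappa> \<omega>) B) \<partial>M)"
      using g1 by (intro nn_integral_eq_integral[symmetric] integrable_const_bound[where B=1]) (auto simp: indicator_def)
    also have "\<dots> = (\<integral>\<^sup>+\<omega>. \<integral>\<^sup>+x. indicator (Z \<times> B) (\<omega>, x) \<partial>\<kappa> \<omega> \<partial>M)"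
    proof (rule nn_integral_cong)
      fix \<omega>
      interpret K: prob_space "\<kappa> \<omega>" by (rule \<kappa>p)
      have "(\<integral>\<^sup>+x. indicator (Z \<times> B) (\<omega>, x) \<partial>\<kappa> \<omega>) = (\<integral>\<^sup>+x. indicator Z \<omega> * indicator B x \<partial>\<kappa> \<omega>)"
        by (intro nn_integral_cong) (simp add: indicator_def)
      also have "\<dots> = indicator Z \<omega> * emeasure (\<kappa> \<omega>) B"
        using B by (intro nn_integral_cmult_indicator) (simp add: \<kappa>s)
      finally show "ennreal (indicator Z \<omega> * measure (\<kappa> \<omega>) B) = (\<integral>\<^sup>+x. indicator (Z \<times> B) (\<omega>, x) \<partial>\<kappa> \<omega>)"
        by (simp add: K.emeasure_eq_measure indicator_def)
    qed
    also have "\<dots> = emeasure M2 (Z \<times> B)"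
      unfolding i2[OF im, symmetric] using ZB M2(2) by simp
    also have "\<dots> = (\<integral>\<^sup>+\<omega>. indicator (Z \<times> B) (\<omega>, X \<omega>) \<partial>M)"
      unfolding eq[symmetric] i1[OF im, symmetric] using ZB M1(2) by simp
    also have "\<dots> = (\<integral>\<^sup>+\<omega>. indicator (Z \<inter> (X -` B \<inter> space M)) \<omega> \<partial>M)"
      by (intro nn_integral_cong) (auto simp: indicator_def)
    also have "\<dots> = ennreal (measure M (Z \<inter> (X -` B \<inter> space M)))"
      by (simp add: emeasure_eq_measure)
    finally have "(\<integral>\<omega>. indicator Z \<omega> * measure (\<kappa> \<omega>) B \<partial>M) = measure M (Z \<inter> (X -` B \<inter> space M))"
      by (subst (asm) ennreal_inj) (auto intro!: integral_nonneg_AE)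
    then show "(\<integral>\<omega>\<in>Z. indicator (X -` B \<inter> space M) \<omega> \<partial>M) = (\<integral>\<omega>\<in>Z. measure (\<kappa> \<omega>) B \<partial>M)"
      by (simp add: set_lebesgue_integral_def indicator_inter_arith[symmetric])
  qed
  show ?thesis
    unfolding has_cond_law_def
  proof (intro conjI ballI subalgebra_days X)
    fix B :: "ennreal set" assume "B \<in> sets borel"
    from main[OF this] AE_day_totals
    show "AE \<omega> in M. \<omega> \<in> E \<longrightarrow> cond_prob M days X B \<omega> = measure (K' \<omega>) B"
      by eventually_elim (auto simp: \<kappa>_def K')
  qed
qed

end

section \<open>The conditional laws of the three statistics\<close>

context sbsp_nbp_days
begin

lemma seen_sum_finite:
  fixes f :: "nat \<Rightarrow> ennreal"
  assumes "finite (observed A D0 \<omega>)"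
  shows "(\<Sum>n. f n * of_bool (seen (unit_mark \<omega> n))) = (\<Sum>n\<in>observed A D0 \<omega>. f n)"
proof -
  have "(\<Sum>n. f n * of_bool (seen (unit_mark \<omega> n))) = (\<Sum>n\<in>observed A D0 \<omega>. f n * of_bool (seen (unit_mark \<omega> n)))"
    by (rule suminf_finite[OF assms]) (simp add: observed_eq)
  also have "\<dots> = (\<Sum>n\<in>observed A D0 \<omega>. f n)" by (intro sum.cong) (auto simp: observed_eq)
  finally show ?thesis .
qed

lemma U_count_eq: "U_count A D0 D1 j \<omega> =
    (\<Sum>n. of_bool (past D0 (snd (unit_mark \<omega> n)) = 0 \<and> future D0 D1 (snd (unit_mark \<omega> n)) = j))"
  unfolding U_count_def past_unit_mark future_unit_mark unit_total_def
  by (intro suminf_cong) (simp only: of_bool_conj)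

lemma U_count_measurable[measurable]: "U_count A D0 D1 j \<in> borel_measurable M"
  unfolding U_count_eq[abs_def] by measurable

text \<open>A sum over an infinite index set is \<open>0\<close> by convention, whence the case
  distinction; by \<open>AE_finite_observed\<close> the second case is a null event.\<close>

lemma S_count_eq:
  "S_count A D0 D1 \<omega> = (if finite (observed A D0 \<omega>)
     then (\<Sum>n. of_nat (future D0 D1 (snd (unit_mark \<omega> n))) * of_bool (seen (unit_mark \<omega> n))) else 0)"
proof (cases "finite (observed A D0 \<omega>)")
  case True
  have "S_count A D0 D1 \<omega> = (\<Sum>n\<in>observed A D0 \<omega>. \<Sum>d=1..D1. of_nat (A (D0 + d) n \<omega>))"
    unfolding S_count_def by (rule sum.swap)
  then show ?thesis using True by (simp add: seen_sum_finite future_unit_mark)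
qed (simp add: S_count_def)

lemma S_count_measurable[measurable]: "S_count A D0 D1 \<in> borel_measurable M"
proof -
  have "finite (observed A D0 \<omega>) \<longleftrightarrow> (\<exists>N. \<forall>n. N \<le> n \<longrightarrow> \<not> seen (unit_mark \<omega> n))" for \<omega>
    unfolding observed_eq by (auto simp: finite_nat_set_iff_bounded not_le[symmetric])
  moreover have "Measurable.pred M (\<lambda>\<omega>. \<exists>N. \<forall>n. N \<le> n \<longrightarrow> \<not> seen (unit_mark \<omega> n))" by measurable
  ultimately have [measurable]: "Measurable.pred M (\<lambda>\<omega>. finite (observed A D0 \<omega>))" by simp
  show ?thesis unfolding S_count_eq[abs_def] by measurable
qed

lemma T_count_eq: "T_count A D0 D1 \<omega> = (\<Sum>n. of_nat (future D0 D1 (snd (unit_mark \<omega> n))))"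
proof -
  have "(\<Sum>d=D0+1..D0+D1. of_nat (A d n \<omega>)) = (of_nat (\<Sum>d=1..D1. A (D0 + d) n \<omega>) :: ennreal)" for n
    using sum.shift_bounds_cl_nat_ivl[of "\<lambda>d. of_nat (A d n \<omega>) :: ennreal" 1 D0 D1] by (simp add: add.commute)
  then show ?thesis by (simp add: T_count_def future_unit_mark)
qed

lemma T_count_measurable[measurable]: "T_count A D0 D1 \<in> borel_measurable M"
  unfolding T_count_eq[abs_def] by measurable

text \<open>A later count belongs either to an observed unit, where \<open>S_count\<close> collects
  it, or to an unobserved one, and an unobserved unit with \<open>j > 0\<close> later counts enters
  \<open>U_count\<close> at \<open>j\<close> exactly once. The shift by \<open>Suc\<close> leaves
  out \<open>j = 0\<close>, which contributes nothing.\<close>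

lemma T_count_split:
  assumes "finite (observed A D0 \<omega>)"
  shows "T_count A D0 D1 \<omega> = (\<Sum>j. of_nat (Suc j) * U_count A D0 D1 (Suc j) \<omega>) + S_count A D0 D1 \<omega>"
proof -
  let ?f = "\<lambda>n. future D0 D1 (snd (unit_mark \<omega> n))" and ?s = "\<lambda>n. seen (unit_mark \<omega> n)"
  have j: "(\<Sum>j. of_nat (Suc j) * of_bool (\<not> ?s n \<and> ?f n = Suc j) :: ennreal) = of_nat (?f n) * of_bool (\<not> ?s n)" for n
  proof -
    \<comment> \<open>The index \<open>?f n - 1\<close> is the only one that can contribute; for a
      unit without later counts the truncated difference leaves a zero term.\<close>
    have "(\<Sum>j. of_nat (Suc j) * of_bool (\<not> ?s n \<and> ?f n = Suc j) :: ennreal) =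
        (\<Sum>j\<in>{?f n - 1}. of_nat (Suc j) * of_bool (\<not> ?s n \<and> ?f n = Suc j))"
      by (rule suminf_finite) auto
    then show ?thesis by (cases "?f n") auto
  qed
  have "(\<Sum>j. of_nat (Suc j) * U_count A D0 D1 (Suc j) \<omega>) =
      (\<Sum>j. \<Sum>n. of_nat (Suc j) * of_bool (\<not> ?s n \<and> ?f n = Suc j))"
    unfolding U_count_eq seen_def not_less by (simp del: of_nat_Suc)
  also have "\<dots> = (\<integral>\<^sup>+n. (\<Sum>j. of_nat (Suc j) * of_bool (\<not> ?s n \<and> ?f n = Suc j)) \<partial>count_space UNIV)"
    by (subst nn_integral_suminf) (simp_all only: nn_integral_count_space_nat borel_measurable_count_space)
  also have "\<dots> = (\<Sum>n. of_nat (?f n) * of_bool (\<not> ?s n))"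
    unfolding j by (rule nn_integral_count_space_nat)
  finally have "(\<Sum>j. of_nat (Suc j) * U_count A D0 D1 (Suc j) \<omega>) + S_count A D0 D1 \<omega> =
      (\<Sum>n. of_nat (?f n) * of_bool (\<not> ?s n) + of_nat (?f n) * of_bool (?s n))"
    using assms by (simp add: S_count_eq suminf_add)
  also have "\<dots> = T_count A D0 D1 \<omega>" unfolding T_count_eq by (intro suminf_cong) simp
  finally show ?thesis ..
qed

text \<open>The two variables agree almost surely and not only in law, because almost surely
  finitely many units are observed.\<close>

lemma same_cond_law_T:
  "same_cond_law M days E borel (T_count A D0 D1)
     (\<lambda>\<omega>. (\<Sum>j. of_nat (Suc j) * U_count A D0 D1 (Suc j) \<omega>) + S_count A D0 D1 \<omega>)"
proof -
  interpret finite_measure_subalgebra M days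
    by (simp add: finite_measure_subalgebra_def finite_measure_axioms finite_measure_subalgebra_axioms_def subalgebra_days)
  let ?Y = "\<lambda>\<omega>. (\<Sum>j. of_nat (Suc j) * U_count A D0 D1 (Suc j) \<omega>) + S_count A D0 D1 \<omega>"
  have [measurable]: "?Y \<in> borel_measurable M" by measurable
  have "AE \<omega> in M. cond_prob M days (T_count A D0 D1) B \<omega> = cond_prob M days ?Y B \<omega>" if [measurable]: "B \<in> sets borel" for B
    unfolding cond_prob_def
  proof (rule real_cond_exp_cong)
    have [measurable]: "T_count A D0 D1 -` B \<inter> space M \<in> sets M" "?Y -` B \<inter> space M \<in> sets M"
      by (rule measurable_sets; measurable)+
    show "indicator (T_count A D0 D1 -` B \<inter> space M) \<in> borel_measurable M" "indicator (?Y -` B \<inter> space M) \<in> borel_measurable M"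
      by measurable
    show "AE \<omega> in M. (indicator (T_count A D0 D1 -` B \<inter> space M) \<omega> :: real) = indicator (?Y -` B \<inter> space M) \<omega>"
      using AE_finite_observed by eventually_elim (simp add: indicator_def T_count_split)
  qed
  note AE = this
  show ?thesis
    unfolding same_cond_law_def
  proof (intro conjI ballI subalgebra_days T_count_measurable)
    fix B :: "ennreal set" assume "B \<in> sets borel"
    from AE[OF this] show "AE \<omega> in M. \<omega> \<in> E \<longrightarrow> cond_prob M days (T_count A D0 D1) B \<omega> = cond_prob M days ?Y B \<omega>"
      by (rule eventually_mono) (rule impI)
  qed fact
qed

lemma cond_law_U:
  assumes j: "1 \<le> j"
  shows "has_cond_law M days E borel (U_count A D0 D1 j)
    (\<lambda>\<omega>. distr (measure_pmf (negbin_pmf (real (card (observed A D0 \<omega>)) + c + 1)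
       (rho \<sigma> r D0 D1 j / (\<beta> + \<psi> + rho \<sigma> r D0 D1 j)))) borel of_nat)"
proof -
  define \<rho> where "\<rho> = rho \<sigma> r D0 D1 j"
  define p where "p = \<rho> / (\<beta> + \<psi> + \<rho>)"
  \<comment> \<open>With the claimed parameter \<open>p\<close>, the base
    \<open>(1 - p) / (1 - p * exp (- l))\<close> of the generating function is the \<open>q\<close>
    of \<open>unseen_future_laplace\<close>.\<close>
  define q where "q l = (\<beta> + \<psi>) / (\<beta> + \<psi> + \<rho> * (1 - exp (- l)))" for l
  have \<rho>: "0 < \<rho>" unfolding \<rho>_def by (rule levy_unseen_future(2)[OF \<sigma> r D1 j])
  have b: "0 < \<beta> + \<psi>" using \<beta> psi_nonneg by simp
  have p: "0 < p" "p < 1" using \<rho> b by (auto simp: p_def)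
  have q: "0 < q l" "q l \<le> 1" "(1 - p) / (1 - p * exp (- l)) = q l" if l: "0 \<le> l" for l
  proof -
    have "0 \<le> \<rho> * (1 - exp (- l))" using \<rho> l by simp
    then show "0 < q l" "q l \<le> 1" using b by (auto simp: q_def divide_le_eq_1)
    have "1 - p = (\<beta> + \<psi>) / (\<beta> + \<psi> + \<rho>)" "1 - p * exp (- l) = (\<beta> + \<psi> + \<rho> * (1 - exp (- l))) / (\<beta> + \<psi> + \<rho>)"
      using b \<rho> by (auto simp: p_def field_simps)
    then show "(1 - p) / (1 - p * exp (- l)) = q l" using b \<rho> by (simp add: q_def)
  qed
  define K where "K xs = distr (measure_pmf (negbin_pmf (real (length xs) + c + 1) p)) borel (of_nat :: nat \<Rightarrow> ennreal)" for xs :: "nat list"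
  define R where "R l \<omega> = q l powr (c + 1) * exp_neg (\<Sum>n. neg_ln (q l) * of_bool (seen (unit_mark \<omega> n)))" for l \<omega>
  show ?thesis
    unfolding \<rho>_def[symmetric] p_def[symmetric]
  proof (rule cond_law_of_laplace[where K=K and R=R])
    show "prob_space (K xs)" "sets (K xs) = sets borel" for xs
      unfolding K_def by (auto intro!: prob_space.prob_space_distr prob_space_measure_pmf)
    show "(\<integral>\<omega>. exp_neg (day_sum xs \<omega>) * exp_neg (ennreal l * U_count A D0 D1 j \<omega>) \<partial>M) = (\<integral>\<omega>. exp_neg (day_sum xs \<omega>) * R l \<omega> \<partial>M)"
      if "valid_days D0 xs" "0 \<le> l" for xs l
      using unseen_future_laplace[OF j that] by (simp only: U_count_eq R_def q_def \<rho>_def)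
    show "R l \<in> borel_measurable M" for l unfolding R_def[abs_def] by measurable
    show "AE \<omega> in M. (\<integral>x. exp_neg (ennreal l * x) \<partial>K (totals \<omega>)) = R l \<omega>" if l: "0 \<le> l" for l
      using AE_finite_observed
    proof eventually_elim
      case (elim \<omega>)
      let ?n = "card (observed A D0 \<omega>)"
      have "(\<integral>x. exp_neg (ennreal l * x) \<partial>K (totals \<omega>)) =
          (\<integral>k. exp_neg (ennreal l * of_nat k) \<partial>measure_pmf (negbin_pmf (real ?n + c + 1) p))"
        unfolding K_def length_totals by (rule integral_distr) auto
      also have "\<dots> = nb_pgf (real ?n + c + 1) l p"
        using negbin_laplace[OF _ p l, of "real ?n + c + 1"] c
        by (subst integral_eq_nn_integral) (auto simp: exp_neg_of_nat l add_nonneg_pos)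
      also have "\<dots> = q l powr (c + 1) * q l ^ ?n"
        unfolding nb_pgf_def q(3)[OF l] using q(1)[OF l] by (simp add: powr_add powr_realpow)
      \<comment> \<open>Each seen unit accounts for one factor \<open>q l\<close>, which makes this
        power a functional of the unit marks.\<close>
      also have "q l ^ ?n = exp_neg (\<Sum>n. neg_ln (q l) * of_bool (seen (unit_mark \<omega> n)))"
        using elim q[OF l] by (simp only: seen_sum_finite exp_neg_sum) (simp add: exp_neg_neg_ln less_imp_le)
      finally show ?case by (simp add: R_def)
    qed
    show "K (totals \<omega>) = distr (measure_pmf (negbin_pmf (real (card (observed A D0 \<omega>)) + c + 1) p)) borel of_nat" for \<omega>
      by (simp add: K_def length_totals)
  qed measurable
qed

abbreviation "bnb m \<equiv> beta_negbin_law (real m - \<sigma>) (r * real D0 + 1) (r * real D1)"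

lemma prob_space_bnb: "1 \<le> m \<Longrightarrow> prob_space (bnb m)"
  using \<sigma> r by (intro prob_space_beta_negbin_law) (auto simp: add_nonneg_pos)

lemma sets_bnb: "1 \<le> m \<Longrightarrow> sets (bnb m) = sets (borel \<Otimes>\<^sub>M count_space UNIV)"
  using \<sigma> r by (intro sets_beta_negbin_law) (auto simp: add_nonneg_pos)

text \<open>The index set is a parameter: the law is needed over the observed units, as in the
  claim, and over the positions of the list of totals.\<close>

definition bnb_sum :: "'i set \<Rightarrow> ('i \<Rightarrow> nat) \<Rightarrow> ennreal measure" where
  "bnb_sum I m = distr (\<Pi>\<^sub>M i\<in>I. bnb (m i)) borel (\<lambda>p. \<Sum>i\<in>I. of_nat (snd (p i)))"

lemma bnb_sum:
  assumes I: "finite I" and m: "\<And>i. i \<in> I \<Longrightarrow> 1 \<le> m i"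
  shows "prob_space (bnb_sum I m)" and "sets (bnb_sum I m) = sets borel"
    and "0 \<le> l \<Longrightarrow> (\<integral>x. exp_neg (ennreal l * x) \<partial>bnb_sum I m) = (\<Prod>i\<in>I. enn2real (bnb_laplace \<sigma> r D0 D1 l (m i)))"
proof -
  have P: "prob_space (\<Pi>\<^sub>M i\<in>I. bnb (m i))" using m by (intro prob_space_PiM prob_space_bnb) auto
  have c: "(\<lambda>z. real (snd z)) \<in> borel_measurable (bnb (m i))" "(\<lambda>z. of_nat (snd z) :: ennreal) \<in> borel_measurable (bnb (m i))"
    if "i \<in> I" for i
  proof -
    note [measurable_cong] = sets_bnb[OF m[OF that]]
    show "(\<lambda>z. real (snd z)) \<in> borel_measurable (bnb (m i))" "(\<lambda>z. of_nat (snd z) :: ennreal) \<in> borel_measurable (bnb (m i))"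
      by measurable
  qed
  have sm: "(\<lambda>p. \<Sum>i\<in>I. of_nat (snd (p i)) :: ennreal) \<in> borel_measurable (\<Pi>\<^sub>M i\<in>I. bnb (m i))"
  proof (rule borel_measurable_sum)
    fix i assume i: "i \<in> I"
    show "(\<lambda>p. of_nat (snd (p i)) :: ennreal) \<in> borel_measurable (\<Pi>\<^sub>M i\<in>I. bnb (m i))"
      using measurable_compose[OF measurable_component_singleton[OF i, of "\<lambda>i. bnb (m i)"]] c(2)[OF i] by blast
  qed
  show "prob_space (bnb_sum I m)" unfolding bnb_sum_def by (rule prob_space.prob_space_distr[OF P sm])
  show s: "sets (bnb_sum I m) = sets borel" by (simp add: bnb_sum_def)
  assume l: "0 \<le> l"
  have bl: "bnb_laplace \<sigma> r D0 D1 l (m i) \<noteq> \<top>" if "i \<in> I" for i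
    using bnb_laplace_le_1[OF \<sigma> r m[OF that] l, of D0 D1] by (auto simp: top_unique)
  have "(\<integral>\<^sup>+x. ennreal (exp_neg (ennreal l * x)) \<partial>bnb_sum I m) =
      (\<integral>\<^sup>+p. ennreal (exp_neg (ennreal l * (\<Sum>i\<in>I. of_nat (snd (p i))))) \<partial>(\<Pi>\<^sub>M i\<in>I. bnb (m i)))"
    unfolding bnb_sum_def by (rule nn_integral_distr[OF sm]) simp
  also have "\<dots> = (\<integral>\<^sup>+p. (\<Prod>i\<in>I. ennreal (exp (- (l * real (snd (p i)))))) \<partial>(\<Pi>\<^sub>M i\<in>I. bnb (m i)))"
    using I l by (intro nn_integral_cong) (simp add: sum_distrib_left exp_neg_sum exp_neg_of_nat prod_ennreal)
  also have "\<dots> = (\<Prod>i\<in>I. bnb_laplace \<sigma> r D0 D1 l (m i))"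
    unfolding bnb_laplace_def
  proof (rule PiM_prod_nn_integral[where f="\<lambda>i z. ennreal (exp (- (l * real (snd z))))", OF _ I order_refl])
    show "(\<lambda>z. ennreal (exp (- (l * real (snd z))))) \<in> borel_measurable (bnb (m i))" if "i \<in> I" for i
      using c(1)[OF that] by measurable
  qed (use m in \<open>auto intro: prob_space_bnb\<close>)
  also have "\<dots> = (\<Prod>i\<in>I. ennreal (enn2real (bnb_laplace \<sigma> r D0 D1 l (m i))))"
    using bl by (intro prod.cong) (auto simp: top.not_eq_extremum)
  also have "\<dots> = ennreal (\<Prod>i\<in>I. enn2real (bnb_laplace \<sigma> r D0 D1 l (m i)))" by (rule prod_ennreal) simp
  finally show "(\<integral>x. exp_neg (ennreal l * x) \<partial>bnb_sum I m) = (\<Prod>i\<in>I. enn2real (bnb_laplace \<sigma> r D0 D1 l (m i)))"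
    using s by (subst integral_eq_nn_integral) (auto simp: prod_nonneg cong: measurable_cong_sets)
qed

text \<open>The kernel must be a function of the list of totals, so it is built over the positions
  of that list. Its transform is a product over the multiset of totals, the same as for the law
  indexed by observed units, and \<open>laplace_unique\<close> identifies the two.\<close>

lemma cond_law_S:
  assumes E: "\<And>\<omega>. \<omega> \<in> E \<Longrightarrow> finite (observed A D0 \<omega>)"
  shows "has_cond_law M days E borel (S_count A D0 D1)
    (\<lambda>\<omega>. distr (\<Pi>\<^sub>M n\<in>observed A D0 \<omega>. bnb (unit_total A D0 n \<omega>)) borel (\<lambda>p. \<Sum>n\<in>observed A D0 \<omega>. of_nat (snd (p n))))"
proof -
  \<comment> \<open>An entry \<open>0\<close> would make the beta parameter
    \<open>m - \<sigma>\<close> negative; \<open>return borel 0\<close> keeps \<open>K\<close> a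
    probability measure on all lists. Lists of observed totals have positive entries.\<close>
  define K where "K xs = (if \<forall>x\<in>set xs. 1 \<le> x then bnb_sum {..<length xs} (\<lambda>i. xs ! i) else return borel 0)" for xs :: "nat list"
  define R where "R l \<omega> = exp_neg (\<Sum>n. neg_ln (enn2real (bnb_laplace \<sigma> r D0 D1 l (past D0 (snd (unit_mark \<omega> n))))) * of_bool (seen (unit_mark \<omega> n)))" for l \<omega>
  have K: "prob_space (K xs)" "sets (K xs) = sets borel" for xs
    unfolding K_def using bnb_sum(1,2)[of "{..<length xs}" "\<lambda>i. xs ! i"] by (auto simp: prob_space_return)
  have Kl: "(\<integral>x. exp_neg (ennreal l * x) \<partial>K (totals \<omega>)) = (\<Prod>n\<in>observed A D0 \<omega>. enn2real (bnb_laplace \<sigma> r D0 D1 l (unit_total A D0 n \<omega>)))"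
    if l: "0 \<le> l" and fin: "finite (observed A D0 \<omega>)" for l \<omega>
  proof -
    let ?g = "\<lambda>m. enn2real (bnb_laplace \<sigma> r D0 D1 l m)"
    have "set (totals \<omega>) = (\<lambda>n. unit_total A D0 n \<omega>) ` observed A D0 \<omega>"
      using arg_cong[OF mset_totals[of \<omega>], of set_mset] fin by simp
    then have p: "\<forall>x\<in>set (totals \<omega>). 1 \<le> x" using observed_total by (auto simp: Suc_le_eq)
    have "(\<integral>x. exp_neg (ennreal l * x) \<partial>K (totals \<omega>)) = (\<integral>x. exp_neg (ennreal l * x) \<partial>bnb_sum {..<length (totals \<omega>)} (\<lambda>i. totals \<omega> ! i))"
      using p by (simp add: K_def)
    also have "\<dots> = (\<Prod>i<length (totals \<omega>). ?g (totals \<omega> ! i))"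
      by (rule bnb_sum(3)[OF _ _ l]) (use p nth_mem in auto)
    also have "\<dots> = prod_list (map ?g (totals \<omega>))"
      by (simp add: prod.list_conv_set_nth atLeast0LessThan)
    also have "\<dots> = prod_mset (image_mset ?g (mset (totals \<omega>)))" by (simp add: prod_mset_prod_list[symmetric])
    also have "\<dots> = (\<Prod>n\<in>observed A D0 \<omega>. ?g (unit_total A D0 n \<omega>))"
      unfolding mset_totals by (simp add: prod_unfold_prod_mset multiset.map_comp comp_def)
    finally show ?thesis .
  qed
  show ?thesis
    unfolding bnb_sum_def[symmetric]
  proof (rule cond_law_of_laplace[where K=K and R=R, OF _ K])
    show "R l \<in> borel_measurable M" for l unfolding R_def[abs_def] by measurable
    show "(\<integral>\<omega>. exp_neg (day_sum xs \<omega>) * exp_neg (ennreal l * S_count A D0 D1 \<omega>) \<partial>M) = (\<integral>\<omega>. exp_neg (day_sum xs \<omega>) * R l \<omega> \<partial>M)"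
      if xs: "valid_days D0 xs" and l: "0 \<le> l" for xs l
    proof -
      note [measurable] = day_sum_measurable[OF xs]
      have "(\<integral>\<omega>. exp_neg (day_sum xs \<omega>) * exp_neg (ennreal l * S_count A D0 D1 \<omega>) \<partial>M) =
          (\<integral>\<omega>. exp_neg (day_sum xs \<omega>) * exp_neg (ennreal l * (\<Sum>n. of_nat (future D0 D1 (snd (unit_mark \<omega> n))) * of_bool (seen (unit_mark \<omega> n)))) \<partial>M)"
        by (rule integral_cong_AE, measurable)
          (use AE_finite_observed in \<open>eventually_elim, simp add: S_count_eq\<close>)
      then show ?thesis using seen_future_laplace[OF xs l] by (simp only: R_def)
    qed
    show "AE \<omega> in M. (\<integral>x. exp_neg (ennreal l * x) \<partial>K (totals \<omega>)) = R l \<omega>" if l: "0 \<le> l" for l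
      using AE_finite_observed
    proof eventually_elim
      case (elim \<omega>)
      have "enn2real (bnb_laplace \<sigma> r D0 D1 l (unit_total A D0 n \<omega>)) \<le> 1" if "n \<in> observed A D0 \<omega>" for n
        using bnb_laplace_le_1[OF \<sigma> r _ l, of "unit_total A D0 n \<omega>" D0 D1] that observed_total[of n \<omega>]
        by (intro enn2real_leI) auto
      then show ?case
        unfolding R_def seen_sum_finite[OF elim] Kl[OF l elim] exp_neg_sum[OF elim] past_unit_mark
        by (intro prod.cong) (auto simp: exp_neg_neg_ln)
    qed
    fix \<omega> assume "\<omega> \<in> E"
    then have fin: "finite (observed A D0 \<omega>)" by (rule E)
    have B: "prob_space (bnb_sum (observed A D0 \<omega>) (\<lambda>n. unit_total A D0 n \<omega>))"
      "sets (bnb_sum (observed A D0 \<omega>) (\<lambda>n. unit_total A D0 n \<omega>)) = sets borel"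
      using fin observed_total by (auto intro!: bnb_sum simp: Suc_le_eq)
    show "K (totals \<omega>) = bnb_sum (observed A D0 \<omega>) (\<lambda>n. unit_total A D0 n \<omega>)"
    proof (rule laplace_unique)
      show "(\<integral>x. exp_neg (ennreal l * x) \<partial>K (totals \<omega>)) = (\<integral>x. exp_neg (ennreal l * x) \<partial>bnb_sum (observed A D0 \<omega>) (\<lambda>n. unit_total A D0 n \<omega>))"
        if l: "0 \<le> l" for l
        unfolding Kl[OF l fin] using fin observed_total by (intro bnb_sum(3)[OF _ _ l, symmetric]) (auto simp: Suc_le_eq)
    qed (use B K in \<open>auto intro: prob_space.finite_measure\<close>)
  qed measurable
qed

end

theorem corollary8:
  fixes M :: "'a measure"
    and \<sigma> \<beta> c r :: real
    and \<theta> w :: "nat \<Rightarrow> 'a \<Rightarrow> real"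
    and A :: "nat \<Rightarrow> nat \<Rightarrow> 'a \<Rightarrow> nat"
    and D0 D1 :: nat
    and F :: "'a measure" and E :: "'a set"
  assumes "prob_space M"
    and "0 < \<sigma>" "\<sigma> < 1" "0 < \<beta>" "0 < c" "0 < r"
    and "1 \<le> D0" "1 \<le> D1"
    and "\<And>n. \<theta> n \<in> borel_measurable M"
    and "\<And>n. w n \<in> borel_measurable M"
    and "\<And>d n. 1 \<le> d \<Longrightarrow> A d n \<in> measurable M (count_space UNIV)"
    and "SBSP_atoms \<beta> \<sigma> c
           (distr M (real_seq \<Otimes>\<^sub>M real_seq) (\<lambda>\<omega>. (\<lambda>n. \<theta> n \<omega>, \<lambda>n. w n \<omega>)))"
    and "NBP_counts M r \<theta> w A"
    and "F = days_algebra M (day_measure w A) D0"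
    and "E = {\<omega> \<in> space M. finite (observed A D0 \<omega>) \<and> 0 < card (observed A D0 \<omega>)}"
  shows "same_cond_law M F E borel
           (T_count A D0 D1)
           (\<lambda>\<omega>. (\<Sum>j. of_nat (Suc j) * U_count A D0 D1 (Suc j) \<omega>) + S_count A D0 D1 \<omega>)
       \<and> (\<forall>j\<ge>1. has_cond_law M F E borel (U_count A D0 D1 j)
            (\<lambda>\<omega>. distr (measure_pmf (negbin_pmf (real (card (observed A D0 \<omega>)) + c + 1)
                    (rho \<sigma> r D0 D1 j / (\<beta> + psi \<sigma> r 0 (real D0) + rho \<sigma> r D0 D1 j))))
                  borel of_nat))
       \<and> has_cond_law M F E borel (S_count A D0 D1)
            (\<lambda>\<omega>. distr (\<Pi>\<^sub>M n\<in>observed A D0 \<omega>.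
                    beta_negbin_law (real (unit_total A D0 n \<omega>) - \<sigma>) (r * real D0 + 1) (r * real D1))
                  borel (\<lambda>p. \<Sum>n\<in>observed A D0 \<omega>. of_nat (snd (p n))))"
proof -
  interpret prob_space M by fact
  interpret sbsp_nbp_days M \<sigma> \<beta> c r \<theta> w A D0 D1
    by unfold_locales (use assms in auto)
  show ?thesis
    unfolding assms(14)
  proof (intro conjI allI impI same_cond_law_T cond_law_U)
    show "has_cond_law M days E borel (S_count A D0 D1) (\<lambda>\<omega>. distr (\<Pi>\<^sub>M n\<in>observed A D0 \<omega>. bnb (unit_total A D0 n \<omega>))
        borel (\<lambda>p. \<Sum>n\<in>observed A D0 \<omega>. of_nat (snd (p n))))"
      by (rule cond_law_S) (simp add: assms(15))
  qed
qed

end
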